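(* Let $p$ be a prime number, let $G$ be a finite nilpotent group, and let $\chi$ and $\psi$ be irreducible complex characters of $G$, each of prime degree. Assume that $\chi(1)=p$. Then one of the following holds: (i) $\chi\psi$ is the sum of $p^2$ distinct linear characters of $G$. (ii) $\chi\psi$ is the sum of $p$ distinct linear characters of $G$ and of $p-1$ distinct irreducible characters of $G$ of degree $p$. (iii) All the irreducible constituents of $\chi\psi$ are of degree $p$. Also, either $\chi\psi$ is a multiple of an irreducible character, or it has at least $\frac{p+1}{2}$ distinct irreducible constituents and at most $p$ distinct irreducible constituents; that is, $$\text{either } \eta(\chi\psi)=1 \quad\text{or}\quad \frac{p+1}{2}\leq \eta(\chi\psi)\leq p.$$ (iv) $\chi\psi$ is an irreducible character of $G$.
   Context: All characters are complex characters of finite groups. For irreducible characters $\chi,\psi$ of $G$, the product $\chi\psi$ is the character of $G$ defined by $(\chi\psi)(g)=\chi(g)\psi(g)$ for all $g\in G$. $\eta(\chi\psi)$ denotes the number of distinct irreducible constituents of $\chi\psi$, i.e. the number of distinct irreducible characters of $G$ appearing with positive multiplicity when $\chi\psi$ is written as a linear combination of irreducible characters. A linear character is a character of degree $1$. The degrees $\chi(1)$ and $\psi(1)$ are both prime numbers, but $\psi(1)$ is not assumed to equal $p=\chi(1)$. *)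

theory Defs
  imports
    Complex_Main
    "HOL-Computational_Algebra.Primes"
    "HOL-Algebra.Generated_Groups"
    "Jordan_Normal_Form.Matrix"
    "Jordan_Normal_Form.VS_Connect"
begin

fun lower_central :: "('a, 'b) monoid_scheme \<Rightarrow> nat \<Rightarrow> 'a set" where
  "lower_central G 0 = carrier G"
| "lower_central G (Suc i) =
     generate G {x \<otimes>\<^bsub>G\<^esub> y \<otimes>\<^bsub>G\<^esub> inv\<^bsub>G\<^esub> x \<otimes>\<^bsub>G\<^esub> inv\<^bsub>G\<^esub> y | x y. x \<in> lower_central G i \<and> y \<in> carrier G}"

definition nilpotent_group :: "('a, 'b) monoid_scheme \<Rightarrow> bool" where
  "nilpotent_group G \<longleftrightarrow> group G \<and> (\<exists>c. lower_central G c = {\<one>\<^bsub>G\<^esub>})"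

text \<open>The unit group of the ring of complex n by n matrices is the general linear group.\<close>

definition matrix_rep :: "('a, 'b) monoid_scheme \<Rightarrow> nat \<Rightarrow> ('a \<Rightarrow> complex mat) \<Rightarrow> bool" where
  "matrix_rep G n \<rho> \<longleftrightarrow> \<rho> \<in> hom G (units_of (ring_mat TYPE(complex) n ()))"

definition irreducible_rep :: "('a, 'b) monoid_scheme \<Rightarrow> nat \<Rightarrow> ('a \<Rightarrow> complex mat) \<Rightarrow> bool" where
  "irreducible_rep G n \<rho> \<longleftrightarrow> matrix_rep G n \<rho> \<and> n > 0 \<and>
     (\<forall>W. VectorSpace.subspace class_ring W (module_vec TYPE(complex) n) \<and>
          (\<forall>g\<in>carrier G. \<forall>w\<in>W. \<rho> g *\<^sub>v w \<in> W)
        \<longrightarrow> W = {0\<^sub>v n} \<or> W = carrier_vec n)"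

definition mat_trace :: "complex mat \<Rightarrow> complex" where
  "mat_trace A = (\<Sum>i<dim_row A. A $$ (i, i))"

text \<open>Characters are made \<open>undefined\<close> outside the carrier, so that equality of HOL functions is
  equality of characters of \<open>G\<close>; counting distinct characters is then meaningful.\<close>

definition char_of :: "('a, 'b) monoid_scheme \<Rightarrow> ('a \<Rightarrow> complex mat) \<Rightarrow> 'a \<Rightarrow> complex" where
  "char_of G \<rho> = (\<lambda>g\<in>carrier G. mat_trace (\<rho> g))"

definition characters :: "('a, 'b) monoid_scheme \<Rightarrow> ('a \<Rightarrow> complex) set" where
  "characters G = {char_of G \<rho> | n \<rho>. matrix_rep G n \<rho> \<and> n > 0}"

definition Irr :: "('a, 'b) monoid_scheme \<Rightarrow> ('a \<Rightarrow> complex) set" where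
  "Irr G = {char_of G \<rho> | n \<rho>. irreducible_rep G n \<rho>}"

definition linear_characters :: "('a, 'b) monoid_scheme \<Rightarrow> ('a \<Rightarrow> complex) set" where
  "linear_characters G = {\<theta> \<in> characters G. \<theta> \<one>\<^bsub>G\<^esub> = 1}"

definition char_prod ::
    "('a, 'b) monoid_scheme \<Rightarrow> ('a \<Rightarrow> complex) \<Rightarrow> ('a \<Rightarrow> complex) \<Rightarrow> 'a \<Rightarrow> complex" where
  "char_prod G \<chi> \<psi> = (\<lambda>g\<in>carrier G. \<chi> g * \<psi> g)"

definition char_sum :: "('a, 'b) monoid_scheme \<Rightarrow> ('a \<Rightarrow> complex) set \<Rightarrow> 'a \<Rightarrow> complex" where
  "char_sum G S = (\<lambda>g\<in>carrier G. \<Sum>\<theta>\<in>S. \<theta> g)"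

text \<open>For a finite group the set \<open>Irr G\<close> is finite and linearly independent, so the multiplicity
  function \<open>m\<close> below is determined by \<open>\<phi>\<close> on \<open>Irr G\<close>, and it exists for every character \<open>\<phi>\<close>.\<close>

definition irr_constituents ::
    "('a, 'b) monoid_scheme \<Rightarrow> ('a \<Rightarrow> complex) \<Rightarrow> ('a \<Rightarrow> complex) set" where
  "irr_constituents G \<phi> = {\<theta> \<in> Irr G. \<exists>m :: ('a \<Rightarrow> complex) \<Rightarrow> nat.
     \<phi> = (\<lambda>g\<in>carrier G. \<Sum>\<xi>\<in>Irr G. of_nat (m \<xi>) * \<xi> g) \<and> m \<theta> > 0}"

definition eta :: "('a, 'b) monoid_scheme \<Rightarrow> ('a \<Rightarrow> complex) \<Rightarrow> nat" where
  "eta G \<phi> = card (irr_constituents G \<phi>)"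

definition multiple_of_irreducible :: "('a, 'b) monoid_scheme \<Rightarrow> ('a \<Rightarrow> complex) \<Rightarrow> bool" where
  "multiple_of_irreducible G \<phi> \<longleftrightarrow>
     (\<exists>\<theta>\<in>Irr G. \<exists>k::nat. k > 0 \<and> \<phi> = (\<lambda>g\<in>carrier G. of_nat k * \<theta> g))"

end

theory Submission
  imports
    Defs
    "HOL-Number_Theory.Cong"
    "HOL-Library.Function_Algebras"
    "Jordan_Normal_Form.Spectral_Radius"
begin

text \<open>By nilpotency some element of the lower central series has scalar commutators under \<open>\<chi>\<close>, but is
  not itself scalar; these scalars form a linear character \<open>\<kappa>\<close> of order \<open>p\<close> with \<open>\<kappa>\<chi> = \<chi>\<close>. Let \<open>H\<close> be
  the kernel of \<open>\<kappa>\<close>, of index \<open>p\<close>, and let \<open>x\<close> lie outside \<open>H\<close>. Comparing the twists of an irreducible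
  character by the powers of \<open>\<kappa>\<close> shows that it either stays irreducible on \<open>H\<close> or is induced from
  \<open>H\<close>. In particular \<open>\<chi>\<close> is induced from a linear character \<open>\<lambda>\<close> of \<open>H\<close>, and \<open>\<chi>\<psi>\<close> is induced from the
  product of \<open>\<lambda>\<close> with the restriction of \<open>\<psi>\<close>. If that restriction is irreducible, the product either
  induces irreducibly, or is invariant and has \<open>p\<close> extensions, which sum to \<open>\<chi>\<psi>\<close>; in the second case \<open>\<psi>\<close>
  has degree \<open>p\<close>. Otherwise \<open>\<psi>\<close> is induced from a linear character \<open>\<mu>\<close> and \<open>\<chi>\<psi>\<close> is the sum over
  \<open>i < p\<close> of the characters induced from \<open>\<lambda> + x\<^sup>i\<mu>\<close>, where the linear characters of \<open>H\<close> are written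
  additively. There \<open>x\<close> acts with \<open>x\<^sup>p = 1\<close>, and \<open>x - 1\<close> is nilpotent because \<open>G\<close> is. It follows that none,
  one or all of the \<open>\<lambda> + x\<^sup>i\<mu>\<close> are fixed by \<open>x\<close>; that they are pairwise not conjugate if exactly one is
  fixed; and that if none is fixed, as soon as three of them are conjugate all are.\<close>

section \<open>Cyclic actions on abelian groups\<close>

text \<open>\<open>H\<close> need not be a \<open>p\<close>-group, so its linear characters are not
  killed by \<open>p\<close>. But differences of vectors \<open>(X ^^ i) m\<close> lie in the image
  of \<open>Y\<close>, which is \<open>X - 1\<close>, and a polynomial in \<open>X\<close> whose
  coefficient sum is prime to \<open>p\<close> is injective there. The three statements about the
  vectors \<open>l + (X ^^ i) m\<close> thus come from comparing coefficient sums modulo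
  \<open>p\<close>. A sum of \<open>n\<close> consecutive powers has coefficient sum
  \<open>n\<close>; so two fixed vectors force \<open>Y (Y u) = 0\<close>, and a conjugacy next to a
  fixed vector forces \<open>Y u = 0\<close>. When nothing is fixed, conjugacies from position 0 to
  positions 1 and \<open>j\<close>, the first by \<open>X ^^ t\<close>, give an operator killing
  \<open>Y (Y u)\<close> with coefficient sum \<open>(t - 1) * j * (j - 1) / 2\<close>. For
  \<open>t\<close> not congruent to 1 its only roots \<open>j\<close> modulo \<open>p\<close> are 0
  and 1, so a third position collapses everything. This is why an induced character occurs at most
  twice unless all agree, and it is the origin of \<open>(p + 1) / 2\<close>.\<close>

definition nat_mult :: "nat \<Rightarrow> 'm::ab_group_add \<Rightarrow> 'm" where
  "nat_mult n v = (\<Sum>i<n. v)"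

lemma nat_mult_0 [simp]: "nat_mult 0 v = 0" and nat_mult_Suc: "nat_mult (Suc n) v = nat_mult n v + v"
  by (auto simp: nat_mult_def)

lemma nat_mult_zero [simp]: "nat_mult n 0 = 0"
  by (simp add: nat_mult_def)

lemma nat_mult_add: "nat_mult (a + b) v = nat_mult a v + nat_mult b v"
  by (induct b) (auto simp: nat_mult_Suc algebra_simps)

lemma nat_mult_mult: "nat_mult (a * b) v = nat_mult b (nat_mult a v)"
  by (induct b) (auto simp: nat_mult_Suc nat_mult_add)

lemma nat_mult_coprime_eq_0:
  assumes "nat_mult a w = 0" "nat_mult b w = 0" "coprime a b"
  shows "w = 0"
proof (cases "a = 0")
  case True
  then show ?thesis using assms by (auto simp: nat_mult_Suc)
next
  case False
  then obtain x y where "a * x = b * y + 1"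
    using bezout_nat[of a b] assms(3) by (metis coprime_iff_gcd_eq_1)
  then have "nat_mult (b * y + 1) w = 0" using assms(1) nat_mult_mult[of a x w] by simp
  then show ?thesis using assms(2) by (simp add: nat_mult_add nat_mult_mult nat_mult_Suc)
qed

text \<open>On a vector killed by the prime \<open>p\<close> a multiplier matters only modulo
  \<open>p\<close>; this is how two coefficient sums are compared.\<close>

lemma nat_mult_incong_eq_0:
  assumes p: "prime p" and pw: "nat_mult p w = 0" and e: "nat_mult a w = nat_mult b w"
    and n: "\<not> [a = b] (mod p)"
  shows "w = 0"
proof -
  have *: "w = 0" if e: "nat_mult a w = nat_mult b w" and n: "\<not> [a = b] (mod p)" and "b \<le> a" for a b
  proof -
    have "nat_mult a w = nat_mult (a - b) w + nat_mult b w"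
      using that(3) nat_mult_add[of "a - b" b w] by simp
    then have "nat_mult (a - b) w = 0" using e by simp
    moreover have "\<not> p dvd a - b"
      using n that(3) by (metis cong_altdef_nat cong_sym)
    then have "coprime (a - b) p" using p by (metis prime_imp_coprime coprime_commute)
    ultimately show ?thesis using pw nat_mult_coprime_eq_0 by blast
  qed
  show ?thesis
  proof (cases "b \<le> a")
    case True then show ?thesis using * e n by blast
  next
    case False then show ?thesis using *[of b a] e n by (metis cong_sym nat_le_linear)
  qed
qed

section \<open>Additive operators and the difference operator \<open>Y\<close>\<close>

locale cyclic_action =
  fixes X :: "'m::ab_group_add \<Rightarrow> 'm" and p :: nat
  assumes X_add: "X (a + b) = X a + X b" and p: "prime p"
begin

definition Y :: "'m \<Rightarrow> 'm" where "Y v = X v - v"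

text \<open>The quotient of \<open>X ^^ n - 1\<close> by \<open>X - 1\<close>: it turns
  \<open>Y v\<close> into \<open>(X ^^ n) v - v\<close>, and on fixed vectors it is multiplication
  by \<open>n\<close>.\<close>

definition bracket :: "nat \<Rightarrow> 'm \<Rightarrow> 'm" where "bracket n v = (\<Sum>i<n. (X ^^ i) v)"

text \<open>Both conditions are asked of single vectors because \<open>X\<close> will act on a full
  function type, where they need not hold for every function.\<close>

definition unipotent :: "'m set" where "unipotent = {v. (X ^^ p) v = v \<and> (\<exists>n. (Y ^^ n) v = 0)}"

lemma X_0 [simp]: "X 0 = 0" using X_add[of 0 0] by simp
lemma X_diff: "X (a - b) = X a - X b" using X_add[of "a - b" b] by (simp add: algebra_simps)
lemma X_sum: "X (sum f A) = (\<Sum>i\<in>A. X (f i))"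
  by (induct A rule: infinite_finite_induct) (auto simp: X_add)
lemma Xn_add: "(X ^^ n) (a + b) = (X ^^ n) a + (X ^^ n) b" by (induct n) (auto simp: X_add)
lemma Xn_diff: "(X ^^ n) (a - b) = (X ^^ n) a - (X ^^ n) b" by (induct n) (auto simp: X_diff)
lemma Xn_0 [simp]: "(X ^^ n) 0 = 0" by (induct n) auto
lemma Xn_Xm: "(X ^^ n) ((X ^^ m) v) = (X ^^ (n + m)) v" by (simp add: funpow_add)
lemma Xn_X: "(X ^^ n) (X v) = X ((X ^^ n) v)" by (simp add: funpow_swap1)
lemma Xn_fixed: "X w = w \<Longrightarrow> (X ^^ n) w = w" by (induct n) auto

lemma Y_0 [simp]: "Y 0 = 0" by (simp add: Y_def)
lemma Y_add: "Y (a + b) = Y a + Y b" by (simp add: Y_def X_add)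
lemma Y_diff: "Y (a - b) = Y a - Y b" by (simp add: Y_def X_diff)
lemma Y_sum: "Y (sum f A) = (\<Sum>i\<in>A. Y (f i))"
  by (induct A rule: infinite_finite_induct) (auto simp: Y_add)
lemma Y_Xn: "Y ((X ^^ n) v) = (X ^^ n) (Y v)" by (simp add: Y_def Xn_diff Xn_X)
lemma Y_eq_0: "Y v = 0 \<longleftrightarrow> X v = v" by (simp add: Y_def)
lemma Yn_0 [simp]: "(Y ^^ n) 0 = 0" by (induct n) auto
lemma Yn_add: "(Y ^^ n) (a + b) = (Y ^^ n) a + (Y ^^ n) b" by (induct n) (auto simp: Y_add)
lemma Yn_Y: "(Y ^^ n) (Y v) = Y ((Y ^^ n) v)" by (simp add: funpow_swap1)
lemma Yn_Xm: "(Y ^^ n) ((X ^^ m) v) = (X ^^ m) ((Y ^^ n) v)" by (induct n) (auto simp: Y_Xn)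

lemma bracket_0 [simp]: "bracket n 0 = 0" by (simp add: bracket_def)
lemma bracket_diff: "bracket n (a - b) = bracket n a - bracket n b"
  by (simp add: bracket_def Xn_diff sum_subtractf)
lemma X_bracket: "X (bracket n v) = bracket n (X v)"
  by (simp add: bracket_def X_sum Xn_X)
lemma Y_bracket: "Y (bracket n v) = bracket n (Y v)"
  by (simp add: Y_def bracket_diff X_bracket)
lemma bracket_Y: "bracket n (Y v) = (X ^^ n) v - v"
proof (induct n)
  case (Suc n)
  have "bracket (Suc n) (Y v) = bracket n (Y v) + (X ^^ n) (Y v)" by (simp add: bracket_def)
  then show ?case using Suc by (simp add: Y_def Xn_diff Xn_X)
qed (simp add: bracket_def)
lemma nat_mult_fixed: "X w = w \<Longrightarrow> X (nat_mult n w) = nat_mult n w"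
  by (simp add: nat_mult_def X_sum)
lemma bracket_fixed: "X w = w \<Longrightarrow> bracket n w = nat_mult n w"
  by (simp add: bracket_def nat_mult_def Xn_fixed)

text \<open>The factorization of \<open>X ^^ (t * j) - 1\<close> through \<open>X ^^ t - 1\<close>,
  divided by \<open>X - 1\<close>.\<close>

lemma bracket_mult: "bracket (t * j) v = (\<Sum>l<j. (X ^^ (t * l)) (bracket t v))"
proof (induct j)
  case (Suc j)
  have "bracket (t * j + n) v = bracket (t * j) v + (X ^^ (t * j)) (bracket n v)" for n
    by (induct n) (auto simp: bracket_def Xn_add funpow_add)
  from this[of t] Suc show ?case by (simp add: algebra_simps)
qed (simp add: bracket_def)

lemma unipotent_X: "v \<in> unipotent \<Longrightarrow> (X ^^ n) v \<in> unipotent"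
proof -
  assume v: "v \<in> unipotent"
  then obtain k where "(Y ^^ k) v = 0" by (auto simp: unipotent_def)
  then have "(Y ^^ k) ((X ^^ n) v) = 0" by (simp add: Yn_Xm)
  moreover have "(X ^^ p) ((X ^^ n) v) = (X ^^ n) ((X ^^ p) v)" by (simp add: Xn_Xm add.commute)
  ultimately show ?thesis using v by (auto simp: unipotent_def)
qed

lemma unipotent_Y: "v \<in> unipotent \<Longrightarrow> Y v \<in> unipotent"
proof -
  assume v: "v \<in> unipotent"
  then obtain n where "(Y ^^ n) v = 0" by (auto simp: unipotent_def)
  then have "(Y ^^ n) (Y v) = 0" by (simp add: Yn_Y)
  then show ?thesis using v by (auto simp: unipotent_def Y_Xn[symmetric])
qed

lemma unipotent_add: "u \<in> unipotent \<Longrightarrow> v \<in> unipotent \<Longrightarrow> u + v \<in> unipotent"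
proof -
  assume uv: "u \<in> unipotent" "v \<in> unipotent"
  then obtain a b where a: "(Y ^^ a) u = 0" and b: "(Y ^^ b) v = 0" by (auto simp: unipotent_def)
  have "(Y ^^ (b + a)) u = 0" "(Y ^^ (a + b)) v = 0" using a b by (simp_all add: funpow_add)
  then have "(Y ^^ (a + b)) (u + v) = 0" by (simp add: Yn_add add.commute)
  then show ?thesis using uv by (auto simp: unipotent_def Xn_add)
qed

lemma Xn_mod:
  assumes "v \<in> unipotent"
  shows "(X ^^ (n mod p)) v = (X ^^ n) v"
proof -
  have "(X ^^ (p * k)) v = v" for k
    by (induct k) (use assms in \<open>auto simp: unipotent_def funpow_add\<close>)
  from this[of "n div p"] show ?thesis
    by (metis Xn_Xm mod_mult_div_eq)
qed

lemma Xn_cong: "v \<in> unipotent \<Longrightarrow> [a = b] (mod p) \<Longrightarrow> (X ^^ a) v = (X ^^ b) v"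
  by (metis Xn_mod cong_def)

text \<open>On the image of \<open>Y\<close> the group ring acts through a local ring: the sum of all powers of \<open>X\<close>
  vanishes there, and on a fixed vector it is multiplication by \<open>p\<close>. So an operator that is
  injective on the fixed vectors killed by \<open>p\<close> is injective on that image.\<close>

lemma eq_0_if_annihilated:
  assumes F0: "F 0 = 0" and FX: "\<And>a. F (Y a) = Y (F a)"
    and Ffix: "\<And>w. X w = w \<Longrightarrow> nat_mult p w = 0 \<Longrightarrow> F w = 0 \<Longrightarrow> w = 0"
    and u: "u \<in> unipotent" and F: "F (Y u) = 0"
  shows "Y u = 0"
proof -
  have "Y u = 0" if "(Y ^^ n) (Y u) = 0" for n using that
  proof (induct n)
    case (Suc n)
    define w where "w = (Y ^^ n) (Y u)"
    have w: "w = Y ((Y ^^ n) u)" by (simp add: w_def Yn_Y)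
    have "Y w = 0" using Suc.prems by (simp add: w_def)
    then have Xw: "X w = w" by (simp add: Y_eq_0)
    have "F ((Y ^^ k) z) = (Y ^^ k) (F z)" for k z by (induct k) (auto simp: FX)
    then have "F w = 0" using F by (simp add: w_def)
    moreover have "bracket p w = 0"
      using u by (simp add: w bracket_Y unipotent_def Yn_Xm[symmetric])
    ultimately have "w = 0" using Ffix Xw by (simp add: bracket_fixed)
    then show ?case using Suc.hyps by (simp add: w_def)
  qed simp
  moreover obtain n where "(Y ^^ n) (Y u) = 0" using unipotent_Y[OF u] by (auto simp: unipotent_def)
  ultimately show ?thesis by blast
qed

section \<open>Fixed and conjugate vectors among the \<open>l + (X ^^ i) m\<close>\<close>

lemma bracket_injective:
  assumes "u \<in> unipotent" "\<not> p dvd n" "bracket n (Y u) = 0"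
  shows "Y u = 0"
proof (rule eq_0_if_annihilated[where F = "bracket n"])
  fix w assume w: "X w = w" "nat_mult p w = 0" "bracket n w = 0"
  have "coprime n p" using assms(2) p prime_imp_coprime coprime_commute by blast
  then show "w = 0" using w nat_mult_coprime_eq_0 by (simp add: bracket_fixed)
qed (use assms in \<open>auto simp: Y_bracket\<close>)

text \<open>The difference of two fixed vectors is \<open>bracket d (Y u)\<close> with
  \<open>d\<close> prime to \<open>p\<close>. Since \<open>Y\<close> kills it, injectivity of
  \<open>bracket d\<close> gives \<open>Y (Y u) = 0\<close>, and then every difference
  \<open>(X ^^ n) u - u\<close> is fixed.\<close>

lemma all_fixed_if_two_fixed:
  assumes m: "m \<in> unipotent" and ij: "i < p" "j < p" "i \<noteq> j"
    and fi: "X (l + (X ^^ i) m) = l + (X ^^ i) m" and fj: "X (l + (X ^^ j) m) = l + (X ^^ j) m"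
  shows "X (l + (X ^^ k) m) = l + (X ^^ k) m"
proof -
  define u where "u = (X ^^ i) m"
  \<comment> \<open>Adding \<open>p\<close> keeps the subtraction of naturals exact and does not
    change the power of \<open>X\<close> on \<open>u\<close>.\<close>
  define d where "d = j + p - i"
  have u: "u \<in> unipotent" using m by (simp add: u_def unipotent_X)
  have shift: "(X ^^ (k + p - i)) u = (X ^^ k) m" for k
    using Xn_cong[OF m, of "k + p - i + i" k] ij by (simp add: u_def Xn_Xm cong_def)
  have nd: "\<not> p dvd d"
  proof
    assume "p dvd d"
    then have "[i + d = i] (mod p)" by (simp add: cong_add_lcancel_0_nat cong_0_iff)
    then have "[j + p = i] (mod p)" using ij by (simp add: d_def)
    then show False using ij by (simp add: cong_def)
  qed
  have "Y (bracket d (Y u)) = Y ((l + (X ^^ j) m) - (l + (X ^^ i) m))"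
    using shift[of j] by (simp add: bracket_Y d_def u_def)
  also have "\<dots> = 0" using fi fj by (simp only: Y_diff) (simp add: Y_def)
  finally have "bracket d (Y (Y u)) = 0" by (simp add: Y_bracket)
  from bracket_injective[OF unipotent_Y[OF u] nd this] have YY: "Y (Y u) = 0" .
  have "Y (l + (X ^^ k) m) = Y ((l + u) + ((X ^^ (k + p - i)) u - u))"
    by (simp add: shift)
  also have "\<dots> = Y (l + u) + bracket (k + p - i) (Y (Y u))"
    by (simp only: Y_add bracket_Y[symmetric] Y_bracket)
  also have "Y (l + u) = 0" using fi by (simp add: u_def Y_eq_0)
  finally have "Y (l + (X ^^ k) m) = 0" by (simp add: YY)
  then show ?thesis by (simp add: Y_eq_0)
qed

text \<open>Measured from the fixed vector \<open>c\<close>, the other vectors are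
  \<open>c + bracket a (Y u)\<close>. A conjugacy between positions with incongruent
  \<open>a\<close> and \<open>b\<close> would force \<open>Y u = 0\<close>, and all vectors would
  equal \<open>c\<close>.\<close>

lemma nonconjugate_if_one_fixed:
  assumes m: "m \<in> unipotent" and i0: "i0 < p" and ij: "i < p" "j < p" "i \<noteq> j"
    and fix0: "X (l + (X ^^ i0) m) = l + (X ^^ i0) m"
    and nfix: "X (l + (X ^^ i1) m) \<noteq> l + (X ^^ i1) m"
  shows "(X ^^ k) (l + (X ^^ i) m) \<noteq> l + (X ^^ j) m"
proof
  assume eq: "(X ^^ k) (l + (X ^^ i) m) = l + (X ^^ j) m"
  define u where "u = (X ^^ i0) m"
  define c where "c = l + u"
  define a b where "a = i + p - i0" and "b = j + p - i0"
  have u: "u \<in> unipotent" using m by (simp add: u_def unipotent_X)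
  have shift: "(X ^^ (k + p - i0)) u = (X ^^ k) m" for k
    using Xn_cong[OF m, of "k + p - i0 + i0" k] i0 by (simp add: u_def Xn_Xm cong_def)
  have "\<not> [a + i0 = b + i0] (mod p)" using ij i0 by (simp add: a_def b_def cong_def)
  then have ab: "\<not> [a = b] (mod p)" by (simp add: cong_add_rcancel_nat)
  have Xc: "X c = c" using fix0 by (simp add: c_def u_def)
  have "(X ^^ k) (c + bracket a (Y u)) = c + bracket b (Y u)"
    using eq by (simp add: a_def b_def shift bracket_Y c_def algebra_simps)
  then have F: "(X ^^ k) (bracket a (Y u)) - bracket b (Y u) = 0"
    by (simp add: Xn_add Xn_fixed[OF Xc])
  \<comment> \<open>On fixed vectors the two sides of the conjugacy are multiplication by
    \<open>a\<close> and by \<open>b\<close>.\<close>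
  have "Y u = 0"
  proof (rule eq_0_if_annihilated[where F = "\<lambda>w. (X ^^ k) (bracket a w) - bracket b w"])
    fix w assume w: "X w = w" "nat_mult p w = 0" "(X ^^ k) (bracket a w) - bracket b w = 0"
    then have "nat_mult a w = nat_mult b w" by (simp add: Xn_fixed nat_mult_fixed bracket_fixed)
    then show "w = 0" using nat_mult_incong_eq_0[OF p w(2)] ab by blast
  qed (use u F in \<open>auto simp: Y_bracket[symmetric] Y_diff Y_Xn\<close>)
  then have "(X ^^ n) u = u" for n by (simp add: Y_eq_0 Xn_fixed)
  then have "l + (X ^^ i1) m = c" using shift[of i1] by (simp add: c_def)
  then show False using nfix Xc by simp
qed

text \<open>For \<open>t\<close> not congruent to 1, comparing the two hypotheses shows that \<open>Y (Y u)\<close> vanishes; then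
  \<open>(X ^^ n) u - u\<close> is \<open>n\<close> times \<open>Y u\<close>, which is matched by the exponent \<open>t * n\<close> on \<open>r\<close>.\<close>

lemma all_conjugate_normalized:
  assumes u: "u \<in> unipotent" and r: "r \<in> unipotent" and nf: "Y r \<noteq> 0"
    and t: "(X ^^ t) r - r = X u - u" and k: "(X ^^ k) r - r = (X ^^ j) u - u"
    and j: "\<not> [j = 0] (mod p)" "\<not> [j = 1] (mod p)"
  shows "\<exists>k. (X ^^ k) r - r = (X ^^ n) u - u"
proof -
  \<comment> \<open>A positive \<open>t\<close> makes the natural number \<open>t - 1\<close> below
    a true difference.\<close>
  have "\<exists>t>0. (X ^^ t) r - r = X u - u"
    using t Xn_cong[OF r, of "t + p" t] prime_gt_0_nat[OF p]
    by (intro exI[of _ "t + p"]) (auto simp: cong_def)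
  then obtain t where t0: "t > 0" and t: "(X ^^ t) r - r = X u - u" by blast
  have z: "bracket t (Y r) = Y u" using t by (simp add: bracket_Y Y_def[of u])
  have zk: "bracket k (Y r) = bracket j (Y u)" using k by (simp add: bracket_Y)
  \<comment> \<open>Both \<open>bracket j (bracket t w)\<close> and \<open>bracket k w\<close> give
    the same value at \<open>w = Y r\<close>; on fixed vectors they multiply by \<open>j * t\<close>
    and by \<open>k\<close>.\<close>
  have tj: "[j * t = k] (mod p)"
  proof (rule ccontr)
    assume n: "\<not> [j * t = k] (mod p)"
    have "Y r = 0"
    proof (rule eq_0_if_annihilated[where F = "\<lambda>w. bracket j (bracket t w) - bracket k w"])
      fix w assume w: "X w = w" "nat_mult p w = 0" "bracket j (bracket t w) - bracket k w = 0"
      then have "nat_mult (t * j) w = nat_mult k w" by (simp add: bracket_fixed nat_mult_fixed nat_mult_mult)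
      then show "w = 0" using nat_mult_incong_eq_0[OF p w(2)] n by (simp add: mult.commute)
    qed (use r zk in \<open>auto simp: Y_bracket Y_diff z\<close>)
    then show False using nf by simp
  qed
  have orbit: "bracket (t * n) (Y r) = (\<Sum>l<n. (X ^^ (t * l)) (Y u))" for n
    by (simp add: bracket_mult z)
  have "bracket k (Y r) = bracket (t * j) (Y r)"
    using Xn_cong[OF r tj] by (simp add: bracket_Y mult.commute)
  then have s: "(\<Sum>l<j. (X ^^ (t * l)) (Y u) - (X ^^ l) (Y u)) = 0"
    using zk by (simp add: orbit sum_subtractf) (simp add: bracket_def)
  \<comment> \<open>The exponents differ by \<open>(t - 1) * l\<close>, so each difference contains
    a second factor \<open>Y\<close>.\<close>
  have e: "(X ^^ (t * l)) (Y u) - (X ^^ l) (Y u) = (X ^^ l) (bracket ((t - 1) * l) (Y (Y u)))" for l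
  proof -
    have "t * l = l + (t - 1) * l" using t0 by (cases t) auto
    then show ?thesis by (simp add: bracket_Y Xn_diff Xn_Xm)
  qed
  show ?thesis
  proof (cases "[t = 1] (mod p)")
    case True
    then have "Y r = Y u" using t Xn_cong[OF r True] by (simp add: Y_def)
    then have "(X ^^ n) r - r = (X ^^ n) u - u" by (metis bracket_Y)
    then show ?thesis by blast
  next
    case False
    \<comment> \<open>\<open>N\<close> is the coefficient sum of the operator that kills
      \<open>Y (Y u)\<close>; doubling it avoids the division in the triangular number.\<close>
    define N where "N = (\<Sum>l<j. (t - 1) * l)"
    have "2 * N = (t - 1) * (j * (j - 1))"
      unfolding N_def sum_distrib_left[symmetric]
      using gauss_sum_nat[of "j - 1"] by (cases j) (auto simp: lessThan_Suc_atMost atLeast0AtMost)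
    moreover have "\<not> p dvd (t - 1)" using False t0 by (metis One_nat_def Suc_leI cong_altdef_nat)
    moreover have "\<not> p dvd j" using j by (simp add: cong_0_iff)
    moreover have "\<not> p dvd (j - 1)"
    proof -
      have "j > 0" using j(1) by (cases j) auto
      then show ?thesis using j(2) by (metis One_nat_def Suc_leI cong_altdef_nat)
    qed
    ultimately have "\<not> p dvd 2 * N" using p by (simp add: prime_dvd_mult_iff)
    then have N: "coprime N p" using p by (metis prime_imp_coprime coprime_commute dvd_mult)
    have "Y (Y u) = 0"
    proof (rule eq_0_if_annihilated[where F = "\<lambda>w. \<Sum>l<j. (X ^^ l) (bracket ((t - 1) * l) w)"])
      fix w assume w: "X w = w" "nat_mult p w = 0" "(\<Sum>l<j. (X ^^ l) (bracket ((t - 1) * l) w)) = 0"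
      have "(\<Sum>l<i. nat_mult (f l) w) = nat_mult (\<Sum>l<i. f l) w" for i and f :: "nat \<Rightarrow> nat"
        by (induct i) (auto simp: nat_mult_add)
      then have "nat_mult N w = 0" using w
        by (simp add: Xn_fixed nat_mult_fixed bracket_fixed N_def)
      then show "w = 0" using N w(2) nat_mult_coprime_eq_0 by blast
    next
      show "(\<Sum>l<j. (X ^^ l) (bracket ((t - 1) * l) (Y (Y u)))) = 0" using s by (simp add: e)
    qed (use unipotent_Y[OF u] in \<open>auto simp: Y_bracket Y_sum Y_Xn\<close>)
    then have fx: "X (Y u) = Y u" by (simp add: Y_eq_0)
    then have "bracket (t * n) (Y r) = bracket n (Y u)"
      unfolding orbit by (simp add: Xn_fixed bracket_def)
    then have "(X ^^ (t * n)) r - r = (X ^^ n) u - u" by (simp add: bracket_Y)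
    then show ?thesis by blast
  qed
qed

end

text \<open>With \<open>B\<close> congruent to \<open>b - a\<close>, which is prime to
  \<open>p\<close>, the operator \<open>X ^^ B\<close> generates the same action. Replacing
  \<open>X\<close> by it moves the positions \<open>a\<close> and \<open>b\<close> to 0 and 1 and
  \<open>c\<close> to some \<open>j\<close> different from both modulo \<open>p\<close>.\<close>

lemma (in cyclic_action) all_conjugate_if_three_conjugate:
  assumes l: "l \<in> unipotent" and m: "m \<in> unipotent" and abc: "a < p" "b < p" "c < p" "a \<noteq> b" "a \<noteq> c" "b \<noteq> c"
    and nf: "X (l + (X ^^ a) m) \<noteq> l + (X ^^ a) m"
    and k1: "(X ^^ k1) (l + (X ^^ a) m) = l + (X ^^ b) m"
    and k2: "(X ^^ k2) (l + (X ^^ a) m) = l + (X ^^ c) m"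
  shows "\<exists>k. (X ^^ k) (l + (X ^^ a) m) = l + (X ^^ n) m"
proof -
  define u where "u = (X ^^ a) m"
  define r where "r = l + u"
  define B where "B = b + p - a"
  have u: "u \<in> unipotent" using m by (simp add: u_def unipotent_X)
  have r: "r \<in> unipotent" using l u by (simp add: r_def unipotent_add)
  have shift: "(X ^^ (k + p - a)) u = (X ^^ k) m" for k
    using Xn_cong[OF m, of "k + p - a + a" k] abc by (simp add: u_def Xn_Xm cong_def)
  have Ba: "B + a = b + p" using abc by (simp add: B_def)
  have nB: "\<not> p dvd B"
  proof
    assume "p dvd B"
    then have "[B + a = 0 + a] (mod p)" by (simp add: cong_add_rcancel_0_nat cong_0_iff)
    then show False using abc by (simp add: Ba cong_def)
  qed
  have cop: "coprime B p" using nB p prime_imp_coprime coprime_commute by blast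
  have ex: "\<exists>s. [B * s = k] (mod p)" for k
  proof -
    obtain s where "[B * s = 1] (mod p)" using cop cong_solve_coprime_nat by auto
    then have "[B * s * k = 1 * k] (mod p)" using cong_scalar_right by blast
    then show ?thesis by (metis mult.assoc mult_1)
  qed
  obtain t where t: "[B * t = k1] (mod p)" using ex by blast
  obtain s where s: "[B * s = k2] (mod p)" using ex by blast
  obtain j where j: "[B * j = c + p - a] (mod p)" using ex by blast
  obtain n' where n': "[B * n' = n + p - a] (mod p)" using ex by blast
  let ?Z = "X ^^ B"
  interpret Z: cyclic_action ?Z p by unfold_locales (auto simp: Xn_add p)
  \<comment> \<open>\<open>X ^^ B - 1\<close> is the product of the commuting operators
    \<open>bracket B\<close> and \<open>Y\<close>, so nilpotency of \<open>Y\<close> on a vector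
    carries over.\<close>
  have ZY: "Z.Y v = bracket B (Y v)" for v by (simp add: Z.Y_def bracket_Y)
  have ZYn: "(Z.Y ^^ i) v = (bracket B ^^ i) ((Y ^^ i) v)" for i v
  proof (induct i arbitrary: v)
    case (Suc i)
    have br: "(bracket B ^^ i) (Y w) = Y ((bracket B ^^ i) w)" for i w
      by (induct i) (auto simp: Y_bracket)
    show ?case using Suc by (simp add: ZY br)
  qed simp
  have Zpow: "(?Z ^^ i) v = (X ^^ (B * i)) v" for i v by (simp add: funpow_mult)
  have Zdom: "v \<in> Z.unipotent" if "v \<in> unipotent" for v
  proof -
    from that obtain i where "(Y ^^ i) v = 0" by (auto simp: unipotent_def)
    moreover have "(bracket B ^^ i) 0 = 0" for i by (induct i) auto
    ultimately have "(Z.Y ^^ i) v = 0" by (simp add: ZYn)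
    moreover have "(?Z ^^ p) v = v"
      using Xn_cong[OF that, of "B * p" 0] by (simp add: Zpow cong_0_iff)
    ultimately show ?thesis by (auto simp: Z.unipotent_def)
  qed
  have Yr: "Y r \<noteq> 0" using nf by (simp add: r_def u_def Y_eq_0)
  have "\<exists>k. (?Z ^^ k) r - r = (?Z ^^ n') u - u"
  proof (rule Z.all_conjugate_normalized)
    show "Z.Y r \<noteq> 0" using bracket_injective[OF r nB] Yr by (auto simp: ZY)
    show "(?Z ^^ t) r - r = ?Z u - u"
      using k1 Xn_cong[OF r t] shift[of b, folded B_def] by (simp add: Zpow r_def u_def)
    show "(?Z ^^ s) r - r = (?Z ^^ j) u - u"
      using k2 Xn_cong[OF r s] Xn_cong[OF u j] shift[of c] by (simp add: Zpow r_def u_def)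
    have "[B * j + a = c + p] (mod p)"
      using cong_add[OF j cong_refl[of a]] abc by simp
    then have ja: "[B * j + a = c] (mod p)" by (simp add: cong_def)
    show "\<not> [j = 0] (mod p)"
    proof
      assume "[j = 0] (mod p)"
      then have "p dvd B * j" by (simp add: cong_0_iff)
      then have "[B * j + a = 0 + a] (mod p)" by (simp add: cong_add_rcancel_0_nat cong_0_iff)
      then show False using ja abc by (simp add: cong_def)
    qed
    show "\<not> [j = 1] (mod p)"
    proof
      assume "[j = 1] (mod p)"
      then have "[B * j + a = B * 1 + a] (mod p)" by (intro cong_add cong_mult) auto
      then show False using ja abc Ba by (simp add: cong_def)
    qed
  qed (use Zdom u r in auto)
  then obtain k where "(X ^^ (B * k)) r = l + (X ^^ n) m"
    using Xn_cong[OF u n'] shift[of n] by (auto simp: Zpow r_def algebra_simps)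
  then show ?thesis by (auto simp: r_def u_def)
qed

section \<open>Matrix representations and Schur's lemma\<close>

lemma matrix_repI:
  assumes G: "group G"
    and c: "\<And>g. g \<in> carrier G \<Longrightarrow> \<rho> g \<in> carrier_mat n n"
    and m: "\<And>g h. g \<in> carrier G \<Longrightarrow> h \<in> carrier G \<Longrightarrow> \<rho> (g \<otimes>\<^bsub>G\<^esub> h) = \<rho> g * \<rho> h"
    and o: "\<rho> \<one>\<^bsub>G\<^esub> = 1\<^sub>m n"
  shows "matrix_rep G n \<rho>"
proof -
  interpret G: group G by fact
  have "\<rho> g \<in> Units (ring_mat TYPE(complex) n ())" if g: "g \<in> carrier G" for g
  proof -
    have "\<rho> g * \<rho> (inv\<^bsub>G\<^esub> g) = 1\<^sub>m n" "\<rho> (inv\<^bsub>G\<^esub> g) * \<rho> g = 1\<^sub>m n"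
      using g m[symmetric] o by auto
    then show ?thesis using c g by (auto simp: Units_def ring_mat_simps intro!: bexI[of _ "\<rho> (inv\<^bsub>G\<^esub> g)"])
  qed
  then show ?thesis using m
    by (auto simp: matrix_rep_def hom_def units_of_def ring_mat_simps)
qed

lemma matrix_rep_carrier:
  "matrix_rep G n \<rho> \<Longrightarrow> g \<in> carrier G \<Longrightarrow> \<rho> g \<in> carrier_mat n n"
  by (auto simp: matrix_rep_def hom_def units_of_def ring_mat_simps Units_def)

lemma matrix_rep_mult:
  "matrix_rep G n \<rho> \<Longrightarrow> g \<in> carrier G \<Longrightarrow> h \<in> carrier G \<Longrightarrow> \<rho> (g \<otimes>\<^bsub>G\<^esub> h) = \<rho> g * \<rho> h"
  by (auto simp: matrix_rep_def hom_def units_of_def ring_mat_simps)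

lemma matrix_rep_one:
  assumes "group G" and r: "matrix_rep G n \<rho>"
  shows "\<rho> \<one>\<^bsub>G\<^esub> = 1\<^sub>m n"
proof -
  interpret G: group G by fact
  have "\<rho> \<one>\<^bsub>G\<^esub> \<in> Units (ring_mat TYPE(complex) n ())"
    using r by (auto simp: matrix_rep_def hom_def units_of_def)
  then obtain B where B: "B \<in> carrier_mat n n" "B * \<rho> \<one>\<^bsub>G\<^esub> = 1\<^sub>m n"
    by (auto simp: Units_def ring_mat_simps)
  have c: "\<rho> \<one>\<^bsub>G\<^esub> \<in> carrier_mat n n" using r by (simp add: matrix_rep_carrier)
  have "\<rho> \<one>\<^bsub>G\<^esub> * \<rho> \<one>\<^bsub>G\<^esub> = \<rho> \<one>\<^bsub>G\<^esub>" using matrix_rep_mult[OF r, of "\<one>\<^bsub>G\<^esub>" "\<one>\<^bsub>G\<^esub>"] by simp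
  then have "B * \<rho> \<one>\<^bsub>G\<^esub> * \<rho> \<one>\<^bsub>G\<^esub> = 1\<^sub>m n" using B c by (subst assoc_mult_mat[of _ n n _ n _ n]) auto
  then show ?thesis using B(2) c by simp
qed

lemma matrix_rep_inv:
  assumes G: "group G" and r: "matrix_rep G n \<rho>" and g: "g \<in> carrier G"
  shows "\<rho> g * \<rho> (inv\<^bsub>G\<^esub> g) = 1\<^sub>m n" "\<rho> (inv\<^bsub>G\<^esub> g) * \<rho> g = 1\<^sub>m n"
proof -
  interpret G: group G by fact
  show "\<rho> g * \<rho> (inv\<^bsub>G\<^esub> g) = 1\<^sub>m n" "\<rho> (inv\<^bsub>G\<^esub> g) * \<rho> g = 1\<^sub>m n"
    using matrix_rep_one[OF G r] matrix_rep_mult[OF r] g by (metis G.inv_closed G.r_inv G.l_inv)+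
qed

lemma mat_trace_mult:
  assumes "A \<in> carrier_mat n m" "B \<in> carrier_mat m n"
  shows "mat_trace (A * B) = (\<Sum>i<n. \<Sum>j<m. A $$ (i, j) * B $$ (j, i))"
  using assms by (auto simp: mat_trace_def scalar_prod_def lessThan_atLeast0 intro!: sum.cong)

lemma mat_trace_mult_commute:
  assumes "A \<in> carrier_mat n m" "B \<in> carrier_mat m n"
  shows "mat_trace (A * B) = mat_trace (B * A)"
  unfolding mat_trace_mult[OF assms] mat_trace_mult[OF assms(2,1)]
  by (subst sum.swap) (simp add: mult.commute)

lemma mat_trace_one [simp]: "mat_trace (1\<^sub>m n) = of_nat n"
  by (simp add: mat_trace_def)

lemma mat_trace_smult: "A \<in> carrier_mat n n \<Longrightarrow> mat_trace (c \<cdot>\<^sub>m A) = c * mat_trace A"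
  by (auto simp: mat_trace_def sum_distrib_left)

lemma mat_trace_similar:
  assumes "A \<in> carrier_mat n n" "S \<in> carrier_mat n m" "S' \<in> carrier_mat m n" "S * S' = 1\<^sub>m n"
  shows "mat_trace (S' * A * S) = mat_trace A"
proof -
  have "mat_trace (S' * A * S) = mat_trace (S' * (A * S))" using assms by (simp add: assoc_mult_mat[of _ m n _ n _ m])
  also have "\<dots> = mat_trace (A * S * S')" using assms by (intro mat_trace_mult_commute[of _ m n]) auto
  also have "\<dots> = mat_trace A" using assms by (simp add: assoc_mult_mat[of _ n n _ m _ n])
  finally show ?thesis .
qed

section \<open>Invariant subspaces and Schur's lemma\<close>

lemma subspaceI:
  assumes "W \<subseteq> carrier_vec n" "0\<^sub>v n \<in> W" "\<And>u v. u \<in> W \<Longrightarrow> v \<in> W \<Longrightarrow> u + v \<in> W"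
    "\<And>c v. v \<in> W \<Longrightarrow> c \<cdot>\<^sub>v v \<in> W"
  shows "VectorSpace.subspace class_ring W (module_vec TYPE(complex) n)"
proof -
  interpret vectorspace "class_ring :: complex ring" "module_vec TYPE(complex) n" by (rule vec_vs)
  show ?thesis
    using assms vectorspace_axioms module_axioms
    by (simp add: VectorSpace.subspace_def LinearCombinations.submodule_def module_vec_simps)
qed

lemma subspaceD:
  assumes "VectorSpace.subspace class_ring W (module_vec TYPE(complex) n)"
  shows "W \<subseteq> carrier_vec n" "0\<^sub>v n \<in> W" "\<And>u v. u \<in> W \<Longrightarrow> v \<in> W \<Longrightarrow> u + v \<in> W"
    "\<And>c v. v \<in> W \<Longrightarrow> c \<cdot>\<^sub>v v \<in> W"
  using assms by (auto simp: VectorSpace.subspace_def LinearCombinations.submodule_def module_vec_simps)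

lemma irreducible_rep_cases:
  assumes "irreducible_rep G n \<rho>"
    and "W \<subseteq> carrier_vec n" "0\<^sub>v n \<in> W" "\<And>u v. u \<in> W \<Longrightarrow> v \<in> W \<Longrightarrow> u + v \<in> W"
    "\<And>c v. v \<in> W \<Longrightarrow> c \<cdot>\<^sub>v v \<in> W" "\<And>g v. g \<in> carrier G \<Longrightarrow> v \<in> W \<Longrightarrow> \<rho> g *\<^sub>v v \<in> W"
  shows "W = {0\<^sub>v n} \<or> W = carrier_vec n"
  using assms subspaceI[OF assms(2-5)] unfolding irreducible_rep_def by blast

lemma mat_eq_0_if_mult_vec_eq_0:
  fixes A :: "complex mat"
  assumes A: "A \<in> carrier_mat n m" and z: "\<And>v. v \<in> carrier_vec m \<Longrightarrow> A *\<^sub>v v = 0\<^sub>v n"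
  shows "A = 0\<^sub>m n m"
proof (rule eq_matI)
  fix i j assume ij: "i < dim_row (0\<^sub>m n m)" "j < dim_col (0\<^sub>m n m)"
  have "(A *\<^sub>v unit_vec m j) $ i = A $$ (i, j)" using A ij by simp
  then show "A $$ (i, j) = 0\<^sub>m n m $$ (i, j)" using z[of "unit_vec m j"] ij by simp
qed (use A in auto)

theorem schur:
  fixes T :: "complex mat"
  assumes r: "irreducible_rep G n \<rho>" and s: "irreducible_rep G m \<sigma>"
    and T: "T \<in> carrier_mat n m" and inter: "\<And>g. g \<in> carrier G \<Longrightarrow> \<rho> g * T = T * \<sigma> g"
    and nz: "T \<noteq> 0\<^sub>m n m"
  obtains S where "n = m" "S \<in> carrier_mat m n" "T * S = 1\<^sub>m n" "S * T = 1\<^sub>m m"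
proof -
  have mr: "matrix_rep G n \<rho>" "matrix_rep G m \<sigma>" using r s by (auto simp: irreducible_rep_def)
  note c = matrix_rep_carrier[OF mr(1)] matrix_rep_carrier[OF mr(2)]
  have app: "\<rho> g *\<^sub>v (T *\<^sub>v v) = T *\<^sub>v (\<sigma> g *\<^sub>v v)" if "g \<in> carrier G" "v \<in> carrier_vec m" for g v
    using inter[OF that(1)] c that T by (metis assoc_mult_mat_vec)
  define K where "K = {v \<in> carrier_vec m. T *\<^sub>v v = 0\<^sub>v n}"
  have "K = {0\<^sub>v m} \<or> K = carrier_vec m"
  proof (rule irreducible_rep_cases[OF s])
    fix g v assume gv: "g \<in> carrier G" "v \<in> K"
    have "\<rho> g *\<^sub>v 0\<^sub>v n = 0\<^sub>v n" using c(1)[OF gv(1)] by auto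
    then show "\<sigma> g *\<^sub>v v \<in> K" using gv app[of g v] c(2)[of g]
      by (auto simp: K_def intro!: mult_mat_vec_carrier)
  qed (use T in \<open>auto simp: K_def mult_add_distrib_mat_vec[of _ n m] mult_mat_vec[of _ n m]\<close>)
  then have K: "K = {0\<^sub>v m}" using mat_eq_0_if_mult_vec_eq_0[OF T] nz by (auto simp: K_def)
  define R where "R = (\<lambda>v. T *\<^sub>v v) ` carrier_vec m"
  have "R = {0\<^sub>v n} \<or> R = carrier_vec n"
  proof (rule irreducible_rep_cases[OF r])
    show "0\<^sub>v n \<in> R" unfolding R_def using T by (intro image_eqI[of _ _ "0\<^sub>v m"]) auto
    show "u + v \<in> R" if uv: "u \<in> R" "v \<in> R" for u v
    proof -
      obtain a b where "a \<in> carrier_vec m" "b \<in> carrier_vec m" "u = T *\<^sub>v a" "v = T *\<^sub>v b"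
        using uv by (auto simp: R_def)
      then show ?thesis unfolding R_def using T
        by (intro image_eqI[of _ _ "a + b"]) (auto simp: mult_add_distrib_mat_vec[of _ n m])
    qed
    show "k \<cdot>\<^sub>v v \<in> R" if v: "v \<in> R" for k v
    proof -
      obtain a where "a \<in> carrier_vec m" "v = T *\<^sub>v a" using v by (auto simp: R_def)
      then show ?thesis unfolding R_def using T
        by (intro image_eqI[of _ _ "k \<cdot>\<^sub>v a"]) (auto simp: mult_mat_vec[of _ n m])
    qed
    show "\<rho> g *\<^sub>v v \<in> R" if g: "g \<in> carrier G" and v: "v \<in> R" for g v
    proof -
      obtain a where "a \<in> carrier_vec m" "v = T *\<^sub>v a" using v by (auto simp: R_def)
      then show ?thesis unfolding R_def using T app[OF g] c(2)[OF g]
        by (intro image_eqI[of _ _ "\<sigma> g *\<^sub>v a"]) auto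
    qed
  qed (use T in \<open>auto simp: R_def\<close>)
  moreover have "R \<noteq> {0\<^sub>v n}"
  proof
    assume "R = {0\<^sub>v n}"
    then have "T *\<^sub>v v = 0\<^sub>v n" if "v \<in> carrier_vec m" for v using that by (auto simp: R_def)
    then show False using mat_eq_0_if_mult_vec_eq_0[OF T] nz by blast
  qed
  ultimately have R: "R = carrier_vec n" by blast
  \<comment> \<open>Preimages of the unit vectors under the surjective \<open>T\<close> become the
    columns of a right inverse.\<close>
  have "\<forall>i. \<exists>v. i < n \<longrightarrow> v \<in> carrier_vec m \<and> T *\<^sub>v v = unit_vec n i"
  proof
    fix i
    have "unit_vec n i \<in> R" by (simp add: R)
    then show "\<exists>v. i < n \<longrightarrow> v \<in> carrier_vec m \<and> T *\<^sub>v v = unit_vec n i" by (auto simp: R_def)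
  qed
  then obtain f where f: "\<And>i. i < n \<Longrightarrow> f i \<in> carrier_vec m \<and> T *\<^sub>v f i = unit_vec n i" by metis
  define S where "S = mat_of_cols m (map f [0..<n])"
  have S: "S \<in> carrier_mat m n" by (simp add: S_def mat_of_cols_def)
  have colS: "col S i = f i" if "i < n" for i using that f[OF that] by (simp add: S_def)
  have TS: "T * S = 1\<^sub>m n"
  proof (rule eq_matI)
    fix i j assume ij: "i < dim_row (1\<^sub>m n)" "j < dim_col (1\<^sub>m n)"
    have "(T * S) $$ (i, j) = (T *\<^sub>v col S j) $ i" using ij T S by simp
    also have "\<dots> = (1\<^sub>m n) $$ (i, j)" using ij f[of j] colS[of j] by (simp add: unit_vec_def)
    finally show "(T * S) $$ (i, j) = (1\<^sub>m n) $$ (i, j)" .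
  qed (use T S in auto)
  \<comment> \<open>\<open>T\<close> kills the image of \<open>S * T - 1\<^sub>m m\<close>, and its
    kernel is trivial.\<close>
  have ST0: "S * T - 1\<^sub>m m = 0\<^sub>m m m"
  proof (rule mat_eq_0_if_mult_vec_eq_0)
    fix v :: "complex vec" assume v: "v \<in> carrier_vec m"
    have "T *\<^sub>v ((S * T - 1\<^sub>m m) *\<^sub>v v) = (T * (S * T - 1\<^sub>m m)) *\<^sub>v v"
      using T S v by (intro assoc_mult_mat_vec[symmetric, of _ n m _ m]) auto
    also have "T * (S * T - 1\<^sub>m m) = T * S * T - T"
      using T S by (simp add: mult_minus_distrib_mat[of _ n m _ m] assoc_mult_mat[of _ n m _ n _ m])
    also have "\<dots> = 0\<^sub>m n m" using T TS by simp
    finally have "(S * T - 1\<^sub>m m) *\<^sub>v v \<in> K" using S T v by (auto simp: K_def intro!: mult_mat_vec_carrier)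
    then show "(S * T - 1\<^sub>m m) *\<^sub>v v = 0\<^sub>v m" using K by simp
  qed (use S T in auto)
  have ST: "S * T = 1\<^sub>m m"
  proof (rule eq_matI)
    fix i j assume ij: "i < dim_row (1\<^sub>m m)" "j < dim_col (1\<^sub>m m)"
    have "(S * T - 1\<^sub>m m) $$ (i, j) = (S * T) $$ (i, j) - (1\<^sub>m m) $$ (i, j)"
      using ij S T by (subst index_minus_mat) auto
    moreover have "(S * T - 1\<^sub>m m) $$ (i, j) = 0" using ij by (simp only: ST0) simp
    ultimately show "(S * T) $$ (i, j) = (1\<^sub>m m) $$ (i, j)" by simp
  qed (use S T in auto)
  \<comment> \<open>The dimensions agree because \<open>T * S\<close> and \<open>S * T\<close> have
    the same trace.\<close>
  have "of_nat n = (of_nat m :: complex)"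
    using mat_trace_mult_commute[OF T S] by (simp add: TS ST)
  then have "n = m" by simp
  then show thesis using that S TS ST by blast
qed

text \<open>If \<open>k\<close> is an eigenvalue, \<open>T - k\<close> intertwines and has a nonzero
  kernel vector, so \<open>schur\<close> leaves only the zero matrix.\<close>

lemma schur_scalar:
  assumes r: "irreducible_rep G n \<rho>" and T: "T \<in> carrier_mat n n"
    and com: "\<And>g. g \<in> carrier G \<Longrightarrow> \<rho> g * T = T * \<rho> g"
  obtains c where "T = c \<cdot>\<^sub>m 1\<^sub>m n"
proof -
  have n: "n > 0" and mr: "matrix_rep G n \<rho>" using r by (auto simp: irreducible_rep_def)
  obtain k where "eigenvalue T k" using spectrum_non_empty[OF T] n by (auto simp: spectrum_def)
  then obtain v where v: "v \<in> carrier_vec n" "v \<noteq> 0\<^sub>v n" "T *\<^sub>v v = k \<cdot>\<^sub>v v"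
    using T by (auto simp: eigenvalue_def eigenvector_def)
  define D where "D = T - k \<cdot>\<^sub>m 1\<^sub>m n"
  have D: "D \<in> carrier_mat n n" using T by (auto simp: D_def)
  have "(k \<cdot>\<^sub>m 1\<^sub>m n) *\<^sub>v v = k \<cdot>\<^sub>v v"
    using v by (intro eq_vecI) auto
  then have Dv: "D *\<^sub>v v = 0\<^sub>v n"
    using T v by (simp add: D_def minus_mult_distrib_mat_vec[of _ n n])
  have "D = 0\<^sub>m n n"
  proof (rule ccontr)
    assume nz: "D \<noteq> 0\<^sub>m n n"
    have "\<rho> g * D = D * \<rho> g" if "g \<in> carrier G" for g
    proof -
      have c: "\<rho> g \<in> carrier_mat n n" using matrix_rep_carrier[OF mr that] .
      show ?thesis using T c com[OF that]
        by (simp add: D_def mult_minus_distrib_mat[of _ n n _ n] minus_mult_distrib_mat[of _ n n _ _ n]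
            mult_smult_distrib[of _ n n _ n] mult_smult_assoc_mat[of _ n n _ n])
    qed
    then obtain S where S: "S \<in> carrier_mat n n" "S * D = 1\<^sub>m n" using schur[OF r r D _ nz] by metis
    have "v = (S * D) *\<^sub>v v" using S v by simp
    also have "\<dots> = S *\<^sub>v (D *\<^sub>v v)" using S D v by (intro assoc_mult_mat_vec) auto
    also have "\<dots> = 0\<^sub>v n" unfolding Dv using S by (intro eq_vecI) auto
    finally show False using v by simp
  qed
  have "T = k \<cdot>\<^sub>m 1\<^sub>m n"
  proof (rule eq_matI)
    fix i j assume ij: "i < dim_row (k \<cdot>\<^sub>m 1\<^sub>m n)" "j < dim_col (k \<cdot>\<^sub>m 1\<^sub>m n)"
    have "D $$ (i, j) = T $$ (i, j) - (k \<cdot>\<^sub>m 1\<^sub>m n) $$ (i, j)"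
      unfolding D_def using ij T by (subst index_minus_mat) auto
    then show "T $$ (i, j) = (k \<cdot>\<^sub>m 1\<^sub>m n) $$ (i, j)" using ij \<open>D = 0\<^sub>m n n\<close> by simp
  qed (use T in auto)
  then show thesis using that by blast
qed

section \<open>Orthogonality and decomposition\<close>

text \<open>On characters of a finite group the value at the inverse is the complex conjugate, so
  there this is the usual Hermitian product; written this way it is bilinear and symmetric.\<close>

definition ip :: "('a, 'b) monoid_scheme \<Rightarrow> ('a \<Rightarrow> complex) \<Rightarrow> ('a \<Rightarrow> complex) \<Rightarrow> complex" where
  "ip G f f' = (\<Sum>g\<in>carrier G. f g * f' (inv\<^bsub>G\<^esub> g)) / of_nat (card (carrier G))"

lemma (in group) sum_mult_left:
  assumes "h \<in> carrier G"
  shows "(\<Sum>g\<in>carrier G. f (h \<otimes> g)) = (\<Sum>g\<in>carrier G. f g)"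
  by (rule sum.reindex_bij_witness[of _ "\<lambda>g. inv h \<otimes> g" "\<lambda>g. h \<otimes> g"])
    (use assms in \<open>auto simp: m_assoc[symmetric]\<close>)

lemma index_mult_mat_sum:
  "A \<in> carrier_mat n m \<Longrightarrow> B \<in> carrier_mat m l \<Longrightarrow> i < n \<Longrightarrow> j < l \<Longrightarrow>
    (A * B) $$ (i, j) = (\<Sum>k<m. A $$ (i, k) * B $$ (k, j))"
  by (simp add: scalar_prod_def lessThan_atLeast0)

text \<open>\<open>T\<close> is the sum over \<open>g\<close> of \<open>\<rho> g\<close>, a matrix
  unit with its 1 at \<open>(k, l)\<close>, and the inverse of \<open>\<sigma> g\<close>;
  translating the summation variable by \<open>h\<close> moves \<open>\<rho> h\<close>
  across.\<close>

lemma coefficient_intertwiner: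
  assumes G: "group G" and r: "matrix_rep G n \<rho>" and s: "matrix_rep G m \<sigma>"
    and k: "k < n" and l: "l < m" and h: "h \<in> carrier G"
  defines "T \<equiv> mat n m (\<lambda>(i, j). \<Sum>g\<in>carrier G. \<rho> g $$ (i, k) * \<sigma> (inv\<^bsub>G\<^esub> g) $$ (l, j))"
  shows "\<rho> h * T = T * \<sigma> h"
proof -
  interpret G: group G by fact
  have rc: "\<rho> g \<in> carrier_mat n n" and sc: "\<sigma> g \<in> carrier_mat m m" if "g \<in> carrier G" for g
    using matrix_rep_carrier[OF r that] matrix_rep_carrier[OF s that] .
  have T: "T \<in> carrier_mat n m" by (simp add: T_def)
  show ?thesis
  proof (rule eq_matI)
    fix i j assume "i < dim_row (T * \<sigma> h)" "j < dim_col (T * \<sigma> h)"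
    then have ij: "i < n" "j < m" using T sc[OF h] by auto
    have "(\<rho> h * T) $$ (i, j) = (\<Sum>a<n. \<rho> h $$ (i, a) * (\<Sum>g\<in>carrier G. \<rho> g $$ (a, k) * \<sigma> (inv\<^bsub>G\<^esub> g) $$ (l, j)))"
      using ij by (subst index_mult_mat_sum[OF rc[OF h] T]) (auto simp: T_def)
    also have "\<dots> = (\<Sum>g\<in>carrier G. (\<Sum>a<n. \<rho> h $$ (i, a) * \<rho> g $$ (a, k)) * \<sigma> (inv\<^bsub>G\<^esub> g) $$ (l, j))"
      by (simp only: sum_distrib_left sum_distrib_right) (subst sum.swap, simp add: mult.assoc)
    also have "\<dots> = (\<Sum>g\<in>carrier G. \<rho> (h \<otimes>\<^bsub>G\<^esub> g) $$ (i, k) * \<sigma> (inv\<^bsub>G\<^esub> g) $$ (l, j))"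
      using ij k h by (intro sum.cong)
        (auto simp: matrix_rep_mult[OF r] index_mult_mat_sum[OF rc rc])
    also have "\<dots> = (\<Sum>g\<in>carrier G. \<rho> (h \<otimes>\<^bsub>G\<^esub> g) $$ (i, k) * \<sigma> (inv\<^bsub>G\<^esub> (h \<otimes>\<^bsub>G\<^esub> g) \<otimes>\<^bsub>G\<^esub> h) $$ (l, j))"
      using h by (intro sum.cong) (auto simp: G.inv_mult_group G.m_assoc)
    also have "\<dots> = (\<Sum>g\<in>carrier G. \<rho> g $$ (i, k) * \<sigma> (inv\<^bsub>G\<^esub> g \<otimes>\<^bsub>G\<^esub> h) $$ (l, j))"
      by (rule G.sum_mult_left[OF h])
    also have "\<dots> = (\<Sum>g\<in>carrier G. \<rho> g $$ (i, k) * (\<Sum>b<m. \<sigma> (inv\<^bsub>G\<^esub> g) $$ (l, b) * \<sigma> h $$ (b, j)))"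
      using ij l h by (intro sum.cong)
        (auto simp: matrix_rep_mult[OF s] index_mult_mat_sum[OF sc sc])
    also have "\<dots> = (\<Sum>b<m. (\<Sum>g\<in>carrier G. \<rho> g $$ (i, k) * \<sigma> (inv\<^bsub>G\<^esub> g) $$ (l, b)) * \<sigma> h $$ (b, j))"
      by (simp only: sum_distrib_left sum_distrib_right) (subst sum.swap, simp add: mult.assoc)
    also have "\<dots> = (T * \<sigma> h) $$ (i, j)"
      using ij by (subst index_mult_mat_sum[OF T sc[OF h]]) (auto simp: T_def)
    finally show "(\<rho> h * T) $$ (i, j) = (T * \<sigma> h) $$ (i, j)" .
  qed (use T rc[OF h] sc[OF h] in auto)
qed

lemma char_of_apply:
  "matrix_rep G n \<rho> \<Longrightarrow> g \<in> carrier G \<Longrightarrow> char_of G \<rho> g = (\<Sum>i<n. \<rho> g $$ (i, i))"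
  using matrix_rep_carrier[of G n \<rho> g] by (auto simp: char_of_def mat_trace_def)

theorem irr_orthonormal:
  assumes G: "group G" and fin: "finite (carrier G)" and chi: "\<chi> \<in> Irr G" "\<psi> \<in> Irr G"
  shows "ip G \<chi> \<psi> = (if \<chi> = \<psi> then 1 else 0)"
proof -
  interpret G: group G by fact
  have cpos: "card (carrier G) > 0" using fin G.one_closed by (auto simp: card_gt_0_iff)
  have coeff: "(\<Sum>g\<in>carrier G. char_of G \<rho> g * char_of G \<sigma> (inv\<^bsub>G\<^esub> g)) =
     (\<Sum>k<n. \<Sum>l<m. \<Sum>g\<in>carrier G. \<rho> g $$ (k, k) * \<sigma> (inv\<^bsub>G\<^esub> g) $$ (l, l))"
    if r: "matrix_rep G n \<rho>" "matrix_rep G m \<sigma>" for n m \<rho> \<sigma>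
  proof -
    have "(\<Sum>g\<in>carrier G. char_of G \<rho> g * char_of G \<sigma> (inv\<^bsub>G\<^esub> g)) =
      (\<Sum>g\<in>carrier G. \<Sum>k<n. \<Sum>l<m. \<rho> g $$ (k, k) * \<sigma> (inv\<^bsub>G\<^esub> g) $$ (l, l))"
      by (intro sum.cong) (auto simp: char_of_apply[OF r(1)] char_of_apply[OF r(2)] sum_product)
    also have "\<dots> = (\<Sum>k<n. \<Sum>g\<in>carrier G. \<Sum>l<m. \<rho> g $$ (k, k) * \<sigma> (inv\<^bsub>G\<^esub> g) $$ (l, l))"
      by (rule sum.swap)
    also have "\<dots> = (\<Sum>k<n. \<Sum>l<m. \<Sum>g\<in>carrier G. \<rho> g $$ (k, k) * \<sigma> (inv\<^bsub>G\<^esub> g) $$ (l, l))"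
      by (intro sum.cong refl sum.swap)
    finally show ?thesis .
  qed
  obtain n \<rho> where \<rho>: "irreducible_rep G n \<rho>" "\<chi> = char_of G \<rho>" using chi by (auto simp: Irr_def)
  have r: "matrix_rep G n \<rho>" and n: "n > 0" using \<rho> by (auto simp: irreducible_rep_def)
  show ?thesis
  proof (cases "\<chi> = \<psi>")
    case True
    have e: "(\<Sum>g\<in>carrier G. \<rho> g $$ (i, k) * \<rho> (inv\<^bsub>G\<^esub> g) $$ (l, j)) =
       (if i = j \<and> k = l then of_nat (card (carrier G)) / of_nat n else 0)"
      if ik: "i < n" "j < n" "k < n" "l < n" for i j k l
    proof -
      define T where "T = mat n n (\<lambda>(i, j). \<Sum>g\<in>carrier G. \<rho> g $$ (i, k) * \<rho> (inv\<^bsub>G\<^esub> g) $$ (l, j))"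
      have T: "T \<in> carrier_mat n n" by (simp add: T_def)
      have "\<rho> g * T = T * \<rho> g" if "g \<in> carrier G" for g
        using coefficient_intertwiner[OF G r r ik(3,4) that] by (simp add: T_def)
      then obtain c where c: "T = c \<cdot>\<^sub>m 1\<^sub>m n" using schur_scalar[OF \<rho>(1) T] by blast
      \<comment> \<open>The scalar is found from the trace of \<open>T\<close>, in which the two
        representing matrices multiply to the identity.\<close>
      have "of_nat n * c = (\<Sum>i<n. T $$ (i, i))" by (simp add: c)
      also have "\<dots> = (\<Sum>i<n. \<Sum>g\<in>carrier G. \<rho> g $$ (i, k) * \<rho> (inv\<^bsub>G\<^esub> g) $$ (l, i))"
        by (simp add: T_def)
      also have "\<dots> = (\<Sum>g\<in>carrier G. \<Sum>i<n. \<rho> (inv\<^bsub>G\<^esub> g) $$ (l, i) * \<rho> g $$ (i, k))"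
        by (subst sum.swap) (simp add: mult.commute)
      also have "\<dots> = (\<Sum>g\<in>carrier G. (1\<^sub>m n) $$ (l, k))"
        using ik by (intro sum.cong refl)
          (simp add: index_mult_mat_sum[OF matrix_rep_carrier[OF r] matrix_rep_carrier[OF r], symmetric]
            matrix_rep_inv[OF G r] del: index_mult_mat)
      finally have "of_nat n * c = (if k = l then of_nat (card (carrier G)) else 0)"
        using ik by auto
      then have "c = (if k = l then of_nat (card (carrier G)) / of_nat n else 0)"
        using n by (auto simp: field_simps)
      moreover have "(\<Sum>g\<in>carrier G. \<rho> g $$ (i, k) * \<rho> (inv\<^bsub>G\<^esub> g) $$ (l, j)) = T $$ (i, j)"
        using ik by (simp add: T_def)
      ultimately show ?thesis using ik by (simp add: c)
    qed
    have "(\<Sum>g\<in>carrier G. \<chi> g * \<chi> (inv\<^bsub>G\<^esub> g)) =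
       (\<Sum>k<n. \<Sum>l<n. if k = l then of_nat (card (carrier G)) / of_nat n else 0)"
      unfolding \<rho>(2) coeff[OF r r] by (intro sum.cong refl) (simp add: e)
    also have "\<dots> = of_nat (card (carrier G))" using n by simp
    finally show ?thesis using True cpos by (simp add: ip_def)
  next
    case False
    obtain m \<sigma> where \<sigma>: "irreducible_rep G m \<sigma>" "\<psi> = char_of G \<sigma>" using chi by (auto simp: Irr_def)
    have s: "matrix_rep G m \<sigma>" using \<sigma> by (auto simp: irreducible_rep_def)
    have e: "(\<Sum>g\<in>carrier G. \<rho> g $$ (k, k) * \<sigma> (inv\<^bsub>G\<^esub> g) $$ (l, l)) = 0"
      if kl: "k < n" "l < m" for k l
    proof -
      define T where "T = mat n m (\<lambda>(i, j). \<Sum>g\<in>carrier G. \<rho> g $$ (i, k) * \<sigma> (inv\<^bsub>G\<^esub> g) $$ (l, j))"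
      have T: "T \<in> carrier_mat n m" by (simp add: T_def)
      have inter: "\<rho> g * T = T * \<sigma> g" if "g \<in> carrier G" for g
        using coefficient_intertwiner[OF G r s kl that] by (simp add: T_def)
      have "T = 0\<^sub>m n m"
      proof (rule ccontr)
        assume "T \<noteq> 0\<^sub>m n m"
        then obtain S where S: "n = m" "S \<in> carrier_mat m n" "T * S = 1\<^sub>m n" "S * T = 1\<^sub>m m"
          using schur[OF \<rho>(1) \<sigma>(1) T inter] by blast
        have "char_of G \<rho> = char_of G \<sigma>"
        proof
          fix g
          show "char_of G \<rho> g = char_of G \<sigma> g"
          proof (cases "g \<in> carrier G")
            case True
            have c: "\<rho> g \<in> carrier_mat n n" "\<sigma> g \<in> carrier_mat m m"
              using matrix_rep_carrier[OF r True] matrix_rep_carrier[OF s True] .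
            have "S * \<rho> g * T = S * (T * \<sigma> g)" using S(2) T c(1)
              by (simp add: inter[OF True, symmetric] assoc_mult_mat[of _ m n _ n _ m])
            also have "\<dots> = (S * T) * \<sigma> g" using S(2) T c(2)
              by (rule assoc_mult_mat[symmetric])
            also have "\<dots> = \<sigma> g" using S(4) c(2) by simp
            finally show ?thesis
              using mat_trace_similar[OF c(1) T S(2,3)] True by (simp add: char_of_def)
          qed (simp add: char_of_def)
        qed
        then show False using False \<rho> \<sigma> by simp
      qed
      then have "T $$ (k, l) = 0" using kl by simp
      then show ?thesis using kl by (simp add: T_def)
    qed
    have "(\<Sum>g\<in>carrier G. \<chi> g * \<psi> (inv\<^bsub>G\<^esub> g)) = 0"
      unfolding \<rho>(2) \<sigma>(2) coeff[OF r s] by (simp add: e)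
    then show ?thesis using False by (simp add: ip_def)
  qed
qed

section \<open>Splitting a representation along an invariant subspace\<close>

text \<open>The number \<open>k\<close> of leading columns in \<open>W\<close> is taken maximal: a vector of \<open>W\<close> with a nonzero coordinate
  beyond \<open>k\<close> could be exchanged for column \<open>k\<close>.\<close>

lemma adapted_basis:
  fixes W :: "complex vec set"
  assumes W: "W \<subseteq> carrier_vec n" "0\<^sub>v n \<in> W" "\<And>u v. u \<in> W \<Longrightarrow> v \<in> W \<Longrightarrow> u + v \<in> W"
    "\<And>c v. v \<in> W \<Longrightarrow> c \<cdot>\<^sub>v v \<in> W"
  obtains P Q k where "P \<in> carrier_mat n n" "Q \<in> carrier_mat n n" "P * Q = 1\<^sub>m n" "Q * P = 1\<^sub>m n"
    "k \<le> n" "\<And>j. j < k \<Longrightarrow> col P j \<in> W" "\<And>w i. w \<in> W \<Longrightarrow> k \<le> i \<Longrightarrow> i < n \<Longrightarrow> (Q *\<^sub>v w) $ i = 0"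
proof -
  define good where "good k \<longleftrightarrow> k \<le> n \<and> (\<exists>P Q. P \<in> carrier_mat n n \<and> Q \<in> carrier_mat n n \<and> P * Q = 1\<^sub>m n
     \<and> Q * P = 1\<^sub>m n \<and> (\<forall>j<k. col P j \<in> W))" for k
  have "good 0" unfolding good_def by (auto intro!: exI[of _ "1\<^sub>m n"])
  moreover have bd: "k \<le> n" if "good k" for k using that by (simp add: good_def)
  ultimately obtain k where k: "good k" and mx: "\<And>k'. good k' \<Longrightarrow> k' \<le> k"
    using GreatestI_nat[of good 0 n] Greatest_le_nat[of good _ n] by blast
  then obtain P Q where PQ: "P \<in> carrier_mat n n" "Q \<in> carrier_mat n n" "P * Q = 1\<^sub>m n" "Q * P = 1\<^sub>m n"
    and col: "\<And>j. j < k \<Longrightarrow> col P j \<in> W" by (auto simp: good_def)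
  have "(Q *\<^sub>v w) $ r = 0" if w: "w \<in> W" and r: "k \<le> r" "r < n" for w r
  proof (rule ccontr)
    define u where "u = Q *\<^sub>v w"
    assume "(Q *\<^sub>v w) $ r \<noteq> 0"
    then have ur: "u $ r \<noteq> 0" by (simp add: u_def)
    have wc: "w \<in> carrier_vec n" using w W by blast
    have uc: "u \<in> carrier_vec n" using PQ wc by (simp add: u_def mult_mat_vec_carrier[of _ n n])
    \<comment> \<open>The exchange matrix: \<open>P * M\<close> has \<open>w\<close> as column
      \<open>k\<close>, carries the old column \<open>k\<close> in column \<open>r\<close> if
      \<open>r\<close> differs from \<open>k\<close>, and agrees with \<open>P\<close> elsewhere. It
      is invertible because \<open>u $ r\<close> is nonzero.\<close>
    define M where "M = mat n n (\<lambda>(i, j). if j = k then u $ i else if j = r then of_bool (i = k) else of_bool (i = j))"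
    have M: "M \<in> carrier_mat n n" by (simp add: M_def)
    have "det M \<noteq> 0"
    proof
      assume "det M = 0"
      then obtain v where v: "v \<in> carrier_vec n" "v \<noteq> 0\<^sub>v n" "M *\<^sub>v v = 0\<^sub>v n"
        using det_0_iff_vec_prod_zero[OF M] by blast
      have row: "(\<Sum>j<n. M $$ (i, j) * v $ j) = 0" if "i < n" for i
      proof -
        have "(M *\<^sub>v v) $ i = (\<Sum>j<n. M $$ (i, j) * v $ j)"
          using that v(1) M by (simp add: scalar_prod_def lessThan_atLeast0)
        then show ?thesis using v that by simp
      qed
      have Mij: "M $$ (i, j) = (if j = k then u $ i else if j = r then of_bool (i = k) else of_bool (i = j))"
        if "i < n" "j < n" for i j using that by (simp add: M_def)
      have kn: "k < n" using r by simp
      have "(\<Sum>j<n. M $$ (r, j) * v $ j) = (\<Sum>j<n. if j = k then u $ r * v $ k else 0)"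
        using r by (intro sum.cong) (auto simp: Mij)
      then have "v $ k = 0" using row[OF r(2)] kn ur by simp
      moreover have "v $ r = 0"
      proof (cases "r = k")
        case False
        have "(\<Sum>j<n. M $$ (k, j) * v $ j) = (\<Sum>j<n. if j = r then v $ r else 0)"
          using r kn False \<open>v $ k = 0\<close> by (intro sum.cong) (auto simp: Mij)
        then show ?thesis using row[OF kn] r by simp
      qed (use \<open>v $ k = 0\<close> in simp)
      moreover have "v $ i = 0" if "i < n" "i \<noteq> k" "i \<noteq> r" for i
      proof -
        have "(\<Sum>j<n. M $$ (i, j) * v $ j) = (\<Sum>j<n. if j = i then v $ i else 0)"
          using that \<open>v $ k = 0\<close> by (intro sum.cong) (auto simp: Mij)
        then show ?thesis using row that by simp
      qed
      ultimately have "v $ i = 0" if "i < n" for i using that by metis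
      then have "v = 0\<^sub>v n" using v by (intro eq_vecI) auto
      then show False using v by simp
    qed
    then have "M \<in> Units (ring_mat TYPE(complex) n ())" by (rule det_non_zero_imp_unit[OF M])
    then obtain N where N: "N \<in> carrier_mat n n" "N * M = 1\<^sub>m n" "M * N = 1\<^sub>m n"
      by (auto simp: Units_def ring_mat_simps)
    have c: "P * M \<in> carrier_mat n n" "N * Q \<in> carrier_mat n n" using PQ M N by auto
    have 1: "(P * M) * (N * Q) = 1\<^sub>m n"
    proof -
      have "(P * M) * (N * Q) = P * ((M * N) * Q)"
        using PQ(1,2) M N(1) by (simp add: assoc_mult_mat[of _ n n _ n _ n])
      then show ?thesis using PQ N by simp
    qed
    have 2: "(N * Q) * (P * M) = 1\<^sub>m n"
    proof -
      have "(N * Q) * (P * M) = N * ((Q * P) * M)"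
        using PQ(1,2) M N(1) by (simp add: assoc_mult_mat[of _ n n _ n _ n])
      then show ?thesis using PQ N M by simp
    qed
    have "col (P * M) j \<in> W" if j: "j < Suc k" for j
    proof -
      have jn: "j < n" using j r by simp
      have cj: "col (P * M) j = P *\<^sub>v col M j" using PQ(1) M jn by (rule col_mult2)
      show ?thesis
      proof (cases "j = k")
        case True
        have "col M j = u" using True jn uc by (intro eq_vecI) (auto simp: M_def)
        then have "col (P * M) j = (P * Q) *\<^sub>v w" using cj PQ(1,2) wc by (subst assoc_mult_mat_vec[of _ n n _ n]) (auto simp: u_def)
        then show ?thesis using PQ wc w by simp
      next
        case False
        have "col M j = unit_vec n j" using False j jn r by (intro eq_vecI) (auto simp: M_def unit_vec_def)
        then have "col (P * M) j = col P j" using cj PQ jn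
          by (simp) (intro eq_vecI, auto)
        then show ?thesis using col False j by simp
      qed
    qed
    then have "good (Suc k)" using r c 1 2 unfolding good_def by (intro conjI exI[of _ "P * M"] exI[of _ "N * Q"]) auto
    then show False using mx by fastforce
  qed
  then show thesis using that PQ col bd[OF k] by blast
qed

lemma block_triangular_reps:
  assumes G: "group G" and r: "matrix_rep G n \<rho>" and k: "k \<le> n"
    and z: "\<And>g i j. g \<in> carrier G \<Longrightarrow> k \<le> i \<Longrightarrow> i < n \<Longrightarrow> j < k \<Longrightarrow> \<rho> g $$ (i, j) = 0"
  shows "\<exists>\<alpha> \<beta>. matrix_rep G k \<alpha> \<and> matrix_rep G (n - k) \<beta> \<and>
     (\<forall>g\<in>carrier G. char_of G \<rho> g = char_of G \<alpha> g + char_of G \<beta> g)"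
proof -
  interpret G: group G by fact
  define \<alpha> where "\<alpha> g = mat k k (\<lambda>(i, j). \<rho> g $$ (i, j))" for g
  define \<beta> where "\<beta> g = mat (n - k) (n - k) (\<lambda>(i, j). \<rho> g $$ (i + k, j + k))" for g
  have c: "\<rho> g \<in> carrier_mat n n" if "g \<in> carrier G" for g by (rule matrix_rep_carrier[OF r that])
  have split: "(\<Sum>l<n. f l) = (\<Sum>l<k. f l) + (\<Sum>l<n-k. f (l + k))" for f :: "nat \<Rightarrow> complex"
  proof -
    have "(\<Sum>l<k + m. f l) = (\<Sum>l<k. f l) + (\<Sum>l<m. f (l + k))" for m
      by (induct m) (auto simp: add_ac)
    from this[of "n - k"] show ?thesis using k by simp
  qed
  have a: "matrix_rep G k \<alpha>"
  proof (rule matrix_repI[OF G])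
    fix g h assume gh: "g \<in> carrier G" "h \<in> carrier G"
    show "\<alpha> (g \<otimes>\<^bsub>G\<^esub> h) = \<alpha> g * \<alpha> h"
    proof (rule eq_matI)
      fix i j assume "i < dim_row (\<alpha> g * \<alpha> h)" "j < dim_col (\<alpha> g * \<alpha> h)"
      then have ij: "i < k" "j < k" by (auto simp: \<alpha>_def)
      have "\<alpha> (g \<otimes>\<^bsub>G\<^esub> h) $$ (i, j) = (\<Sum>l<n. \<rho> g $$ (i, l) * \<rho> h $$ (l, j))"
        using ij k gh by (simp add: \<alpha>_def matrix_rep_mult[OF r] index_mult_mat_sum[OF c c] del: index_mult_mat)
      also have "\<dots> = (\<Sum>l<k. \<rho> g $$ (i, l) * \<rho> h $$ (l, j))"
        unfolding split using ij gh by (simp add: z)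
      also have "\<dots> = (\<alpha> g * \<alpha> h) $$ (i, j)"
        using ij by (subst index_mult_mat_sum[of _ k k _ k]) (auto simp: \<alpha>_def)
      finally show "\<alpha> (g \<otimes>\<^bsub>G\<^esub> h) $$ (i, j) = (\<alpha> g * \<alpha> h) $$ (i, j)" .
    qed (auto simp: \<alpha>_def)
  next
    show "\<alpha> \<one>\<^bsub>G\<^esub> = 1\<^sub>m k" using k by (intro eq_matI) (auto simp: \<alpha>_def matrix_rep_one[OF G r])
  qed (simp add: \<alpha>_def)
  have b: "matrix_rep G (n - k) \<beta>"
  proof (rule matrix_repI[OF G])
    fix g h assume gh: "g \<in> carrier G" "h \<in> carrier G"
    show "\<beta> (g \<otimes>\<^bsub>G\<^esub> h) = \<beta> g * \<beta> h"
    proof (rule eq_matI)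
      fix i j assume "i < dim_row (\<beta> g * \<beta> h)" "j < dim_col (\<beta> g * \<beta> h)"
      then have ij: "i < n - k" "j < n - k" by (auto simp: \<beta>_def)
      have "\<beta> (g \<otimes>\<^bsub>G\<^esub> h) $$ (i, j) = (\<Sum>l<n. \<rho> g $$ (i + k, l) * \<rho> h $$ (l, j + k))"
        using ij k gh by (simp add: \<beta>_def matrix_rep_mult[OF r] index_mult_mat_sum[OF c c] del: index_mult_mat)
      also have "\<dots> = (\<Sum>l<n-k. \<rho> g $$ (i + k, l + k) * \<rho> h $$ (l + k, j + k))"
        unfolding split using ij gh by (simp add: z)
      also have "\<dots> = (\<beta> g * \<beta> h) $$ (i, j)"
        using ij by (subst index_mult_mat_sum[of _ "n-k" "n-k" _ "n-k"]) (auto simp: \<beta>_def)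
      finally show "\<beta> (g \<otimes>\<^bsub>G\<^esub> h) $$ (i, j) = (\<beta> g * \<beta> h) $$ (i, j)" .
    qed (auto simp: \<beta>_def)
  next
    show "\<beta> \<one>\<^bsub>G\<^esub> = 1\<^sub>m (n - k)" using k by (intro eq_matI) (auto simp: \<beta>_def matrix_rep_one[OF G r])
  qed (simp add: \<beta>_def)
  have "char_of G \<rho> g = char_of G \<alpha> g + char_of G \<beta> g" if "g \<in> carrier G" for g
    using that by (simp add: char_of_apply[OF r] char_of_apply[OF a] char_of_apply[OF b] split)
      (simp add: \<alpha>_def \<beta>_def)
  then show ?thesis using a b by blast
qed

lemma matrix_rep_conjugate:
  assumes G: "group G" and r: "matrix_rep G n \<rho>"
    and PQ: "P \<in> carrier_mat n n" "Q \<in> carrier_mat n n" "P * Q = 1\<^sub>m n" "Q * P = 1\<^sub>m n"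
  shows "matrix_rep G n (\<lambda>g. Q * \<rho> g * P)" "char_of G (\<lambda>g. Q * \<rho> g * P) = char_of G \<rho>"
proof -
  have c: "\<rho> g \<in> carrier_mat n n" if "g \<in> carrier G" for g by (rule matrix_rep_carrier[OF r that])
  show "matrix_rep G n (\<lambda>g. Q * \<rho> g * P)"
  proof (rule matrix_repI[OF G])
    fix g h assume gh: "g \<in> carrier G" "h \<in> carrier G"
    have "(Q * \<rho> g * P) * (Q * \<rho> h * P) = Q * (\<rho> g * ((P * Q) * (\<rho> h * P)))"
      using PQ(1,2) c gh by (simp add: assoc_mult_mat[of _ n n _ n _ n] mult_carrier_mat[of _ n n _ n])
    also have "\<dots> = Q * (\<rho> g * \<rho> h) * P"
      using PQ c gh by (simp add: assoc_mult_mat[of _ n n _ n _ n] mult_carrier_mat[of _ n n _ n]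
          left_mult_one_mat[of _ n n])
    finally show "Q * \<rho> (g \<otimes>\<^bsub>G\<^esub> h) * P = (Q * \<rho> g * P) * (Q * \<rho> h * P)"
      using gh by (simp add: matrix_rep_mult[OF r])
  qed (use c PQ in \<open>auto simp: matrix_rep_one[OF G r]\<close>)
  show "char_of G (\<lambda>g. Q * \<rho> g * P) = char_of G \<rho>"
    unfolding char_of_def
    by (intro restrict_ext mat_trace_similar[OF c PQ(1,2)]) (use PQ in auto)
qed

text \<open>The trace adds over an invariant subspace and its quotient. Hence a proper nonzero
  invariant subspace is brought to block triangular form, and the recursion runs on the two smaller
  diagonal blocks.\<close>

lemma character_list_decomposition:
  assumes G: "group G" and r: "matrix_rep G n \<rho>"
  shows "\<exists>xs. set xs \<subseteq> Irr G \<and> (\<forall>g\<in>carrier G. char_of G \<rho> g = (\<Sum>\<xi>\<leftarrow>xs. \<xi> g))"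
  using r
proof (induct n arbitrary: \<rho> rule: less_induct)
  case (less n)
  show ?case
  proof (cases "irreducible_rep G n \<rho>")
    case True
    then have "char_of G \<rho> \<in> Irr G" by (auto simp: Irr_def)
    then show ?thesis by (intro exI[of _ "[char_of G \<rho>]"]) auto
  next
    case irr: False
    show ?thesis
    proof (cases "n = 0")
      case True
      then show ?thesis using less.prems by (intro exI[of _ "[]"]) (auto simp: char_of_apply)
    next
      case False
      then obtain W where sub: "VectorSpace.subspace class_ring W (module_vec TYPE(complex) n)"
        and inv: "\<And>g w. g \<in> carrier G \<Longrightarrow> w \<in> W \<Longrightarrow> \<rho> g *\<^sub>v w \<in> W"
        and W0: "W \<noteq> {0\<^sub>v n}" and W1: "W \<noteq> carrier_vec n"
        using irr less.prems by (auto simp: irreducible_rep_def)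
      note W = subspaceD[OF sub]
      obtain P Q k where PQ: "P \<in> carrier_mat n n" "Q \<in> carrier_mat n n" "P * Q = 1\<^sub>m n" "Q * P = 1\<^sub>m n"
        and k: "k \<le> n" and colP: "\<And>j. j < k \<Longrightarrow> col P j \<in> W"
        and sup: "\<And>w i. w \<in> W \<Longrightarrow> k \<le> i \<Longrightarrow> i < n \<Longrightarrow> (Q *\<^sub>v w) $ i = 0"
        using adapted_basis[OF W] by metis
      have recon: "w = P *\<^sub>v (Q *\<^sub>v w)" if "w \<in> carrier_vec n" for w
      proof -
        have "P *\<^sub>v (Q *\<^sub>v w) = (P * Q) *\<^sub>v w" using PQ(1,2) that by (intro assoc_mult_mat_vec[symmetric])
        then show ?thesis using PQ that by simp
      qed
      have "k \<noteq> 0"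
      proof
        assume "k = 0"
        have "w = 0\<^sub>v n" if w: "w \<in> W" for w
        proof -
          have "Q *\<^sub>v w = 0\<^sub>v n" using sup[OF w] \<open>k = 0\<close> PQ by (intro eq_vecI) auto
          moreover have "P *\<^sub>v 0\<^sub>v n = 0\<^sub>v n" using PQ by (intro eq_vecI) auto
          ultimately show ?thesis using recon[of w] W(1) w by auto
        qed
        then show False using W0 W(2) by blast
      qed
      moreover have "k \<noteq> n"
      proof
        assume kn: "k = n"
        \<comment> \<open>If all columns of \<open>P\<close> lay in \<open>W\<close>, so would
          everything; the induction is on the number \<open>t\<close> of leading coordinates that
          may be nonzero.\<close>
        have span: "P *\<^sub>v v \<in> W" if "v \<in> carrier_vec n" "\<And>i. t \<le> i \<Longrightarrow> i < n \<Longrightarrow> v $ i = 0" "t \<le> n" for t v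
          using that
        proof (induct t arbitrary: v)
          case 0
          then have "v = 0\<^sub>v n" by (intro eq_vecI) auto
          moreover have "P *\<^sub>v 0\<^sub>v n = 0\<^sub>v n" using PQ by (intro eq_vecI) auto
          ultimately show ?case using W(2) by simp
        next
          case (Suc t)
          define v' where "v' = vec n (\<lambda>i. if i = t then 0 else v $ i)"
          have v': "v' \<in> carrier_vec n" by (simp add: v'_def)
          have "v' $ i = 0" if "t \<le> i" "i < n" for i using that Suc.prems(2)[of i] by (auto simp: v'_def)
          then have "P *\<^sub>v v' \<in> W" using Suc v' by auto
          moreover have "P *\<^sub>v unit_vec n t = col P t" using PQ Suc.prems(3) by (intro eq_vecI) auto
          then have "(v $ t) \<cdot>\<^sub>v (P *\<^sub>v unit_vec n t) \<in> W" using colP[of t] Suc.prems(3) kn W(4) by simp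
          moreover have "v = v' + (v $ t) \<cdot>\<^sub>v unit_vec n t"
            using Suc.prems(1) by (intro eq_vecI) (auto simp: v'_def unit_vec_def)
          then have "P *\<^sub>v v = P *\<^sub>v v' + (v $ t) \<cdot>\<^sub>v (P *\<^sub>v unit_vec n t)"
            using PQ(1) v' by (metis mult_add_distrib_mat_vec mult_mat_vec smult_carrier_vec unit_vec_carrier)
          ultimately show ?case using W(3) by simp
        qed
        have "w \<in> W" if "w \<in> carrier_vec n" for w
          using span[of "Q *\<^sub>v w" n] recon[OF that] that PQ by (simp add: mult_mat_vec_carrier[of _ n n])
        then show False using W1 W(1) by blast
      qed
      ultimately have k: "0 < k" "k < n" using k by auto
      let ?\<sigma> = "\<lambda>g. Q * \<rho> g * P"
      have s: "matrix_rep G n ?\<sigma>" "char_of G ?\<sigma> = char_of G \<rho>"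
        using matrix_rep_conjugate[OF G less.prems PQ] by blast+
      have z: "?\<sigma> g $$ (i, j) = 0" if g: "g \<in> carrier G" and ij: "k \<le> i" "i < n" "j < k" for g i j
      proof -
        have c: "\<rho> g \<in> carrier_mat n n" by (rule matrix_rep_carrier[OF less.prems g])
        have "?\<sigma> g $$ (i, j) = (Q * (\<rho> g * P)) $$ (i, j)" using PQ c by simp
        also have "\<dots> = (Q *\<^sub>v col (\<rho> g * P) j) $ i" using PQ c ij by simp
        also have "col (\<rho> g * P) j = \<rho> g *\<^sub>v col P j" using PQ c ij k by (intro col_mult2[of _ n n _ n]) auto
        also have "(Q *\<^sub>v (\<rho> g *\<^sub>v col P j)) $ i = 0" using sup inv g colP ij by blast
        finally show ?thesis .
      qed
      obtain \<alpha> \<beta> where ab: "matrix_rep G k \<alpha>" "matrix_rep G (n - k) \<beta>"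
        "\<And>g. g \<in> carrier G \<Longrightarrow> char_of G ?\<sigma> g = char_of G \<alpha> g + char_of G \<beta> g"
        using block_triangular_reps[OF G s(1) less_imp_le[OF k(2)] z] by blast
      obtain xs where xs: "set xs \<subseteq> Irr G" "\<forall>g\<in>carrier G. char_of G \<alpha> g = (\<Sum>\<xi>\<leftarrow>xs. \<xi> g)"
        using less.hyps[OF k(2) ab(1)] by blast
      obtain ys where ys: "set ys \<subseteq> Irr G" "\<forall>g\<in>carrier G. char_of G \<beta> g = (\<Sum>\<xi>\<leftarrow>ys. \<xi> g)"
        using less.hyps[OF _ ab(2)] k by auto
      have "\<forall>g\<in>carrier G. char_of G \<rho> g = (\<Sum>\<xi>\<leftarrow>xs @ ys. \<xi> g)"
        using xs ys ab s(2) by auto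
      then show ?thesis using xs ys by (intro exI[of _ "xs @ ys"]) auto
    qed
  qed
qed

section \<open>Constructions of characters\<close>

definition class_function :: "('a, 'b) monoid_scheme \<Rightarrow> ('a \<Rightarrow> complex) \<Rightarrow> bool" where
  "class_function G f \<longleftrightarrow> f \<in> extensional (carrier G) \<and>
     (\<forall>g\<in>carrier G. \<forall>h\<in>carrier G. f (h \<otimes>\<^bsub>G\<^esub> g \<otimes>\<^bsub>G\<^esub> inv\<^bsub>G\<^esub> h) = f g)"

lemma class_functionI:
  assumes "f \<in> extensional (carrier G)"
    "\<And>g h. g \<in> carrier G \<Longrightarrow> h \<in> carrier G \<Longrightarrow> f (h \<otimes>\<^bsub>G\<^esub> g \<otimes>\<^bsub>G\<^esub> inv\<^bsub>G\<^esub> h) = f g"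
  shows "class_function G f"
  using assms by (auto simp: class_function_def)

lemma class_function_conj:
  "class_function G f \<Longrightarrow> g \<in> carrier G \<Longrightarrow> h \<in> carrier G \<Longrightarrow> f (h \<otimes>\<^bsub>G\<^esub> g \<otimes>\<^bsub>G\<^esub> inv\<^bsub>G\<^esub> h) = f g"
  by (auto simp: class_function_def)

lemma class_function_ext: "class_function G f \<Longrightarrow> f \<in> extensional (carrier G)"
  by (auto simp: class_function_def)

lemma char_of_one: "group G \<Longrightarrow> matrix_rep G n \<rho> \<Longrightarrow> char_of G \<rho> \<one>\<^bsub>G\<^esub> = of_nat n"
proof -
  assume G: "group G" and r: "matrix_rep G n \<rho>"
  interpret G: group G by fact
  show ?thesis by (simp add: char_of_def matrix_rep_one[OF G r])
qed

lemma char_of_class_function: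
  assumes G: "group G" and r: "matrix_rep G n \<rho>"
  shows "class_function G (char_of G \<rho>)"
proof (rule class_functionI)
  interpret G: group G by fact
  fix g h assume gh: "g \<in> carrier G" "h \<in> carrier G"
  note c = matrix_rep_carrier[OF r]
  have "mat_trace (\<rho> h * \<rho> g * \<rho> (inv\<^bsub>G\<^esub> h)) = mat_trace (\<rho> g)"
    using gh by (intro mat_trace_similar[of _ n _ n] c) (auto simp: matrix_rep_inv[OF G r])
  then show "char_of G \<rho> (h \<otimes>\<^bsub>G\<^esub> g \<otimes>\<^bsub>G\<^esub> inv\<^bsub>G\<^esub> h) = char_of G \<rho> g"
    using gh by (simp add: char_of_def matrix_rep_mult[OF r])
qed (simp add: char_of_def)

lemma charactersI: "matrix_rep G n \<rho> \<Longrightarrow> n > 0 \<Longrightarrow> char_of G \<rho> \<in> characters G"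
  by (auto simp: characters_def)

lemma characters_class_function: "group G \<Longrightarrow> \<chi> \<in> characters G \<Longrightarrow> class_function G \<chi>"
  using char_of_class_function by (auto simp: characters_def)

lemma Irr_characters: "\<chi> \<in> Irr G \<Longrightarrow> \<chi> \<in> characters G"
  by (auto simp: Irr_def characters_def irreducible_rep_def)

lemma characters_degree:
  assumes "group G" "\<chi> \<in> characters G"
  obtains n where "n > 0" "\<chi> \<one>\<^bsub>G\<^esub> = of_nat n"
  using assms char_of_one by (auto simp: characters_def)

lemma characters_linear_mult:
  assumes G: "group G" and chi: "\<chi> \<in> characters G"
    and l: "\<And>g h. g \<in> carrier G \<Longrightarrow> h \<in> carrier G \<Longrightarrow> \<mu> (g \<otimes>\<^bsub>G\<^esub> h) = \<mu> g * \<mu> h" and l1: "\<mu> \<one>\<^bsub>G\<^esub> = 1"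
  shows "(\<lambda>g\<in>carrier G. \<mu> g * \<chi> g) \<in> characters G"
proof -
  obtain n \<rho> where n: "n > 0" and r: "matrix_rep G n \<rho>" and c: "\<chi> = char_of G \<rho>"
    using chi by (auto simp: characters_def)
  note rc = matrix_rep_carrier[OF r]
  have r': "matrix_rep G n (\<lambda>g. \<mu> g \<cdot>\<^sub>m \<rho> g)"
  proof (rule matrix_repI[OF G])
    fix g h assume gh: "g \<in> carrier G" "h \<in> carrier G"
    show "\<mu> (g \<otimes>\<^bsub>G\<^esub> h) \<cdot>\<^sub>m \<rho> (g \<otimes>\<^bsub>G\<^esub> h) = (\<mu> g \<cdot>\<^sub>m \<rho> g) * (\<mu> h \<cdot>\<^sub>m \<rho> h)"
      using rc[OF gh(1)] rc[OF gh(2)] gh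
      by (intro eq_matI) (auto simp: l matrix_rep_mult[OF r] scalar_prod_def sum_distrib_left mult_ac)
  next
    show "\<mu> \<one>\<^bsub>G\<^esub> \<cdot>\<^sub>m \<rho> \<one>\<^bsub>G\<^esub> = 1\<^sub>m n" by (simp add: l1 matrix_rep_one[OF G r]) (intro eq_matI, auto)
  qed (use rc in auto)
  have "(\<lambda>g\<in>carrier G. \<mu> g * \<chi> g) = char_of G (\<lambda>g. \<mu> g \<cdot>\<^sub>m \<rho> g)"
    unfolding c char_of_def by (intro restrict_ext) (simp add: mat_trace_smult[OF rc])
  then show ?thesis using charactersI[OF r' n] by simp
qed

section \<open>Restriction and induction of characters\<close>

lemma subgroup_inv:
  assumes "group G" "subgroup H G" "h \<in> H"
  shows "inv\<^bsub>G\<lparr>carrier := H\<rparr>\<^esub> h = inv\<^bsub>G\<^esub> h"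
  using assms group.m_inv_consistent by metis

lemma characters_restrict:
  assumes G: "group G" and H: "subgroup H G" and chi: "\<chi> \<in> characters G"
  shows "restrict \<chi> H \<in> characters (G\<lparr>carrier := H\<rparr>)"
proof -
  interpret G: group G by fact
  interpret H: subgroup H G by fact
  obtain n \<rho> where n: "n > 0" and r: "matrix_rep G n \<rho>" and c: "\<chi> = char_of G \<rho>"
    using chi by (auto simp: characters_def)
  have r': "matrix_rep (G\<lparr>carrier := H\<rparr>) n \<rho>"
    by (rule matrix_repI[OF G.subgroup_imp_group[OF H]])
      (use H.mem_carrier in \<open>auto simp: matrix_rep_carrier[OF r] matrix_rep_mult[OF r] matrix_rep_one[OF G r]\<close>)
  have "restrict \<chi> H = char_of (G\<lparr>carrier := H\<rparr>) \<rho>"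
    using H.mem_carrier by (auto simp: c char_of_def fun_eq_iff)
  then show ?thesis using charactersI[OF r' n] by simp
qed

text \<open>An index \<open>K\<close> into \<open>r\<close> blocks of size \<open>n\<close> is read
  as position \<open>K mod n\<close> in block \<open>K div n\<close>.\<close>

lemma sum_nat_div_mod:
  fixes f :: "nat \<Rightarrow> nat \<Rightarrow> 'c::comm_monoid_add"
  assumes "n > 0"
  shows "(\<Sum>K<r * n. f (K div n) (K mod n)) = (\<Sum>k<r. \<Sum>c<n. f k c)"
proof (induct r)
  case (Suc r)
  have "(\<Sum>K<r * n + m. f (K div n) (K mod n)) = (\<Sum>K<r * n. f (K div n) (K mod n)) + (\<Sum>c<m. f r c)"
    if "m \<le> n" for m using that by (induct m) (auto simp: add.assoc)
  from this[of n] show ?case using Suc by (simp add: add.commute)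
qed simp

text \<open>The induced representation is the block matrix whose block \<open>(i, j)\<close> is
  \<open>\<rho>\<close> at \<open>inv (t i) \<otimes> g \<otimes> t j\<close>, with
  \<open>\<rho>\<close> extended by zero off \<open>H\<close>. The \<open>t i\<close> represent the
  left cosets, so each block row has exactly one nonzero block.\<close>

lemma induced_character:
  fixes G :: "('a, 'b) monoid_scheme" and t :: "nat \<Rightarrow> 'a"
  assumes G: "group G" and H: "subgroup H G" and chi: "\<chi> \<in> characters (G\<lparr>carrier := H\<rparr>)"
    and t: "\<And>i. i < r \<Longrightarrow> t i \<in> carrier G"
    and uniq: "\<And>g. g \<in> carrier G \<Longrightarrow> \<exists>!i. i < r \<and> inv\<^bsub>G\<^esub> (t i) \<otimes>\<^bsub>G\<^esub> g \<in> H"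
  shows "(\<lambda>g\<in>carrier G. \<Sum>i<r. if inv\<^bsub>G\<^esub> (t i) \<otimes>\<^bsub>G\<^esub> g \<otimes>\<^bsub>G\<^esub> t i \<in> H
      then \<chi> (inv\<^bsub>G\<^esub> (t i) \<otimes>\<^bsub>G\<^esub> g \<otimes>\<^bsub>G\<^esub> t i) else 0) \<in> characters G"
proof -
  interpret G: group G by fact
  interpret H: subgroup H G by fact
  let ?H = "G\<lparr>carrier := H\<rparr>"
  have gH: "group ?H" by (rule G.subgroup_imp_group[OF H])
  obtain n \<rho> where n: "n > 0" and rep: "matrix_rep ?H n \<rho>" and c: "\<chi> = char_of ?H \<rho>"
    using chi by (auto simp: characters_def)
  have rpos: "r > 0" using uniq[OF G.one_closed] by auto
  define \<rho>0 where "\<rho>0 g = (if g \<in> H then \<rho> g else 0\<^sub>m n n)" for g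
  have rc: "\<rho>0 g \<in> carrier_mat n n" for g using matrix_rep_carrier[OF rep] by (simp add: \<rho>0_def)
  have div: "I div n < r" if "I < r * n" for I using that by (simp add: less_mult_imp_div_less)
  define \<tau> where "\<tau> g = mat (r * n) (r * n) (\<lambda>(I, J).
     \<rho>0 (inv\<^bsub>G\<^esub> (t (I div n)) \<otimes>\<^bsub>G\<^esub> g \<otimes>\<^bsub>G\<^esub> t (J div n)) $$ (I mod n, J mod n))" for g
  have \<tau>: "matrix_rep G (r * n) \<tau>"
  proof (rule matrix_repI[OF G])
    fix g h assume gh: "g \<in> carrier G" "h \<in> carrier G"
    show "\<tau> (g \<otimes>\<^bsub>G\<^esub> h) = \<tau> g * \<tau> h"
    proof (rule eq_matI)
      fix I J assume "I < dim_row (\<tau> g * \<tau> h)" "J < dim_col (\<tau> g * \<tau> h)"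
      then have IJ: "I < r * n" "J < r * n" by (auto simp: \<tau>_def)
      define i j where "i = I div n" and "j = J div n"
      define a b where "a = I mod n" and "b = J mod n"
      have ij: "i < r" "j < r" using IJ div by (auto simp: i_def j_def)
      have ab: "a < n" "b < n" using n by (auto simp: a_def b_def)
      let ?x = "\<lambda>k. inv\<^bsub>G\<^esub> (t i) \<otimes>\<^bsub>G\<^esub> g \<otimes>\<^bsub>G\<^esub> t k" and ?y = "\<lambda>k. inv\<^bsub>G\<^esub> (t k) \<otimes>\<^bsub>G\<^esub> h \<otimes>\<^bsub>G\<^esub> t j"
      have xc: "?x k \<in> carrier G" and yc: "?y k \<in> carrier G" if "k < r" for k using that t ij gh by auto
      have xy: "?x k \<otimes>\<^bsub>G\<^esub> ?y k = inv\<^bsub>G\<^esub> (t i) \<otimes>\<^bsub>G\<^esub> (g \<otimes>\<^bsub>G\<^esub> h) \<otimes>\<^bsub>G\<^esub> t j" if "k < r" for k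
      proof -
        have "t k \<otimes>\<^bsub>G\<^esub> (inv\<^bsub>G\<^esub> (t k) \<otimes>\<^bsub>G\<^esub> (h \<otimes>\<^bsub>G\<^esub> t j)) = h \<otimes>\<^bsub>G\<^esub> t j"
          using that t ij gh by (metis G.inv_solve_left G.inv_closed G.m_closed)
        then show ?thesis using that t ij gh by (simp add: G.m_assoc)
      qed
      \<comment> \<open>The inverse of \<open>?x k\<close> is \<open>inv (t k)\<close> times this
        element, so the coset condition picks the one \<open>k\<close> with \<open>?x k\<close> in
        \<open>H\<close>.\<close>
      have "\<exists>!k. k < r \<and> inv\<^bsub>G\<^esub> (t k) \<otimes>\<^bsub>G\<^esub> (inv\<^bsub>G\<^esub> g \<otimes>\<^bsub>G\<^esub> t i) \<in> H"
        using uniq[of "inv\<^bsub>G\<^esub> g \<otimes>\<^bsub>G\<^esub> t i"] gh t ij by auto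
      moreover have "inv\<^bsub>G\<^esub> (t k) \<otimes>\<^bsub>G\<^esub> (inv\<^bsub>G\<^esub> g \<otimes>\<^bsub>G\<^esub> t i) \<in> H \<longleftrightarrow> ?x k \<in> H" if "k < r" for k
      proof -
        have "inv\<^bsub>G\<^esub> (?x k) = inv\<^bsub>G\<^esub> (t k) \<otimes>\<^bsub>G\<^esub> (inv\<^bsub>G\<^esub> g \<otimes>\<^bsub>G\<^esub> t i)"
          using that t ij gh by (simp add: G.inv_mult_group G.m_assoc)
        then show ?thesis using H.m_inv_closed xc[OF that] G.inv_inv by metis
      qed
      ultimately obtain k0 where k0: "k0 < r" "?x k0 \<in> H" and k0u: "\<And>k. k < r \<Longrightarrow> ?x k \<in> H \<Longrightarrow> k = k0"
        by metis
      have "(\<tau> g * \<tau> h) $$ (I, J) = (\<Sum>K<r * n. \<tau> g $$ (I, K) * \<tau> h $$ (K, J))"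
        using IJ by (intro index_mult_mat_sum[of _ "r*n" "r*n" _ "r*n"]) (auto simp: \<tau>_def)
      also have "\<dots> = (\<Sum>K<r * n. \<rho>0 (?x (K div n)) $$ (a, K mod n) * \<rho>0 (?y (K div n)) $$ (K mod n, b))"
        using IJ by (intro sum.cong) (auto simp: \<tau>_def i_def j_def a_def b_def)
      also have "\<dots> = (\<Sum>k<r. \<Sum>c<n. \<rho>0 (?x k) $$ (a, c) * \<rho>0 (?y k) $$ (c, b))"
        by (rule sum_nat_div_mod[OF n])
      also have "\<dots> = (\<Sum>k<r. if k = k0 then \<Sum>c<n. \<rho>0 (?x k) $$ (a, c) * \<rho>0 (?y k) $$ (c, b) else 0)"
      proof (intro sum.cong refl)
        fix k assume "k \<in> {..<r}"
        then have "\<rho>0 (?x k) = 0\<^sub>m n n" if "k \<noteq> k0" using k0u[of k] that unfolding \<rho>0_def by auto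
        then show "(\<Sum>c<n. \<rho>0 (?x k) $$ (a, c) * \<rho>0 (?y k) $$ (c, b)) =
            (if k = k0 then \<Sum>c<n. \<rho>0 (?x k) $$ (a, c) * \<rho>0 (?y k) $$ (c, b) else 0)"
          using ab by simp
      qed
      also have "\<dots> = (\<Sum>c<n. \<rho>0 (?x k0) $$ (a, c) * \<rho>0 (?y k0) $$ (c, b))"
        using k0 by simp
      also have "\<dots> = \<rho>0 (?x k0 \<otimes>\<^bsub>G\<^esub> ?y k0) $$ (a, b)"
      proof (cases "?y k0 \<in> H")
        case True
        have "(\<Sum>c<n. \<rho>0 (?x k0) $$ (a, c) * \<rho>0 (?y k0) $$ (c, b)) = (\<rho> (?x k0) * \<rho> (?y k0)) $$ (a, b)"
          using index_mult_mat_sum[OF rc rc ab, of "?x k0" "?y k0"] True k0 by (simp add: \<rho>0_def)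
        also have "\<rho> (?x k0) * \<rho> (?y k0) = \<rho> (?x k0 \<otimes>\<^bsub>G\<^esub> ?y k0)"
          using matrix_rep_mult[OF rep, of "?x k0" "?y k0"] True k0 by simp
        finally show ?thesis using True k0 by (simp add: \<rho>0_def)
      next
        case False
        \<comment> \<open>With one factor inside \<open>H\<close> and the other outside, both sides
          are zero blocks.\<close>
        have "?x k0 \<otimes>\<^bsub>G\<^esub> ?y k0 \<notin> H"
        proof
          assume "?x k0 \<otimes>\<^bsub>G\<^esub> ?y k0 \<in> H"
          then have "inv\<^bsub>G\<^esub> (?x k0) \<otimes>\<^bsub>G\<^esub> (?x k0 \<otimes>\<^bsub>G\<^esub> ?y k0) \<in> H" using k0 by blast
          then show False using False xc[OF k0(1)] yc[OF k0(1)]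
            by (metis G.inv_closed G.m_assoc G.l_inv G.l_one)
        qed
        then show ?thesis using False ab by (simp add: \<rho>0_def)
      qed
      also have "\<dots> = \<tau> (g \<otimes>\<^bsub>G\<^esub> h) $$ (I, J)"
        using IJ xy[OF k0(1)] by (simp add: \<tau>_def i_def j_def a_def b_def)
      finally show "\<tau> (g \<otimes>\<^bsub>G\<^esub> h) $$ (I, J) = (\<tau> g * \<tau> h) $$ (I, J)" by simp
    qed (auto simp: \<tau>_def)
  next
    show "\<tau> \<one>\<^bsub>G\<^esub> = 1\<^sub>m (r * n)"
    proof (rule eq_matI)
      fix I J assume "I < dim_row (1\<^sub>m (r * n))" "J < dim_col (1\<^sub>m (r * n))"
      then have IJ: "I < r * n" "J < r * n" by auto
      have e: "I = J \<longleftrightarrow> I div n = J div n \<and> I mod n = J mod n" by (metis div_mult_mod_eq)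
      have iff: "inv\<^bsub>G\<^esub> (t i) \<otimes>\<^bsub>G\<^esub> t j \<in> H \<longleftrightarrow> i = j" if "i < r" "j < r" for i j
      proof -
        have "inv\<^bsub>G\<^esub> (t j) \<otimes>\<^bsub>G\<^esub> t j \<in> H" using that t by simp
        then show ?thesis using uniq[OF t[OF that(2)]] that by blast
      qed
      have "\<tau> \<one>\<^bsub>G\<^esub> $$ (I, J) = \<rho>0 (inv\<^bsub>G\<^esub> (t (I div n)) \<otimes>\<^bsub>G\<^esub> t (J div n)) $$ (I mod n, J mod n)"
        using IJ t div by (simp add: \<tau>_def)
      also have "\<dots> = (if I div n = J div n then (1\<^sub>m n) $$ (I mod n, J mod n) else 0)"
        using iff[of "I div n" "J div n"] div IJ n t matrix_rep_one[OF gH rep]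
        by (auto simp: \<rho>0_def)
      also have "\<dots> = (1\<^sub>m (r * n)) $$ (I, J)"
        using IJ n e by auto
      finally show "\<tau> \<one>\<^bsub>G\<^esub> $$ (I, J) = (1\<^sub>m (r * n)) $$ (I, J)" .
    qed (auto simp: \<tau>_def)
  qed (simp add: \<tau>_def)
  have "char_of G \<tau> g = (\<Sum>i<r. if inv\<^bsub>G\<^esub> (t i) \<otimes>\<^bsub>G\<^esub> g \<otimes>\<^bsub>G\<^esub> t i \<in> H
      then \<chi> (inv\<^bsub>G\<^esub> (t i) \<otimes>\<^bsub>G\<^esub> g \<otimes>\<^bsub>G\<^esub> t i) else 0)" if g: "g \<in> carrier G" for g
  proof -
    have "char_of G \<tau> g = (\<Sum>I<r*n. \<tau> g $$ (I, I))" by (rule char_of_apply[OF \<tau> g])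
    also have "\<dots> = (\<Sum>I<r*n. \<rho>0 (inv\<^bsub>G\<^esub> (t (I div n)) \<otimes>\<^bsub>G\<^esub> g \<otimes>\<^bsub>G\<^esub> t (I div n)) $$ (I mod n, I mod n))"
      by (intro sum.cong) (auto simp: \<tau>_def)
    also have "\<dots> = (\<Sum>i<r. \<Sum>c<n. \<rho>0 (inv\<^bsub>G\<^esub> (t i) \<otimes>\<^bsub>G\<^esub> g \<otimes>\<^bsub>G\<^esub> t i) $$ (c, c))"
      by (rule sum_nat_div_mod[OF n])
    also have "\<dots> = (\<Sum>i<r. if inv\<^bsub>G\<^esub> (t i) \<otimes>\<^bsub>G\<^esub> g \<otimes>\<^bsub>G\<^esub> t i \<in> H
      then \<chi> (inv\<^bsub>G\<^esub> (t i) \<otimes>\<^bsub>G\<^esub> g \<otimes>\<^bsub>G\<^esub> t i) else 0)"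
      by (intro sum.cong refl) (auto simp: c \<rho>0_def char_of_apply[OF rep])
    finally show ?thesis .
  qed
  then have "(\<lambda>g\<in>carrier G. \<Sum>i<r. if inv\<^bsub>G\<^esub> (t i) \<otimes>\<^bsub>G\<^esub> g \<otimes>\<^bsub>G\<^esub> t i \<in> H
      then \<chi> (inv\<^bsub>G\<^esub> (t i) \<otimes>\<^bsub>G\<^esub> g \<otimes>\<^bsub>G\<^esub> t i) else 0) = char_of G \<tau>"
    by (auto simp: fun_eq_iff char_of_def)
  then show ?thesis using charactersI[OF \<tau>] n rpos by simp
qed

text \<open>For a non-scalar \<open>a\<close> whose commutators are all scalar,
  \<open>\<kappa> g\<close> is the scalar of the commutator of \<open>a\<close> and
  \<open>g\<close>. Conjugating \<open>g\<close> by \<open>a\<close> multiplies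
  \<open>\<rho> g\<close> by \<open>\<kappa> g\<close>, and taking traces gives
  \<open>\<kappa> g * \<chi> g = \<chi> g\<close>. A commutator has determinant 1, so
  \<open>\<kappa> g ^ n = 1\<close>. Were \<open>\<kappa>\<close> trivial, \<open>a\<close> would
  commute with everything and be scalar by Schur's lemma.\<close>

theorem scalar_commutator_character:
  assumes nil: "nilpotent_group G" and chi: "\<chi> \<in> Irr G" and deg: "\<chi> \<one>\<^bsub>G\<^esub> = of_nat n" "n > 1"
  obtains \<kappa> :: "'a \<Rightarrow> complex" where
    "\<And>g h. g \<in> carrier G \<Longrightarrow> h \<in> carrier G \<Longrightarrow> \<kappa> (g \<otimes>\<^bsub>G\<^esub> h) = \<kappa> g * \<kappa> h"
    "\<And>g. g \<in> carrier G \<Longrightarrow> \<kappa> g ^ n = 1"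
    "\<exists>x\<in>carrier G. \<kappa> x \<noteq> 1"
    "\<And>g. g \<in> carrier G \<Longrightarrow> \<kappa> g * \<chi> g = \<chi> g"
proof -
  have G: "group G" using nil by (simp add: nilpotent_group_def)
  interpret G: group G by fact
  obtain m \<rho> where irr: "irreducible_rep G m \<rho>" and c: "\<chi> = char_of G \<rho>" using chi by (auto simp: Irr_def)
  have r: "matrix_rep G m \<rho>" using irr by (simp add: irreducible_rep_def)
  have "m = n" using char_of_one[OF G r] deg c by simp
  note irr = irr[unfolded \<open>m = n\<close>] and r = r[unfolded \<open>m = n\<close>]
  note rc = matrix_rep_carrier[OF r] and rm = matrix_rep_mult[OF r]
  define Z where "Z g \<longleftrightarrow> (\<exists>k. \<rho> g = k \<cdot>\<^sub>m 1\<^sub>m n)" for g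
  have lcG: "lower_central G i \<subseteq> carrier G" for i
  proof (induct i)
    case (Suc i)
    have "{x \<otimes>\<^bsub>G\<^esub> y \<otimes>\<^bsub>G\<^esub> inv\<^bsub>G\<^esub> x \<otimes>\<^bsub>G\<^esub> inv\<^bsub>G\<^esub> y | x y. x \<in> lower_central G i \<and> y \<in> carrier G} \<subseteq> carrier G"
      using Suc by auto
    then show ?case using G.generate_in_carrier by auto
  qed simp
  have notall: "\<not> (\<forall>g\<in>lower_central G 0. Z g)"
  proof
    assume Z: "\<forall>g\<in>lower_central G 0. Z g"
    \<comment> \<open>A non-scalar matrix, available because \<open>n > 1\<close>, that would
      commute with a representation by scalars.\<close>
    define T where "T = mat n n (\<lambda>(i, j). of_bool (i = 0 \<and> j = 1) :: complex)"
    have T: "T \<in> carrier_mat n n" by (simp add: T_def)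
    have "\<rho> g * T = T * \<rho> g" if g: "g \<in> carrier G" for g
    proof -
      obtain k where "\<rho> g = k \<cdot>\<^sub>m 1\<^sub>m n" using Z g by (auto simp: Z_def)
      then show ?thesis using T by (simp add: mult_smult_distrib[of _ n n _ n] mult_smult_assoc_mat[of _ n n _ n])
    qed
    then obtain k where "T = k \<cdot>\<^sub>m 1\<^sub>m n" using schur_scalar[OF irr T] by blast
    then have "T $$ (0, 1) = (k \<cdot>\<^sub>m 1\<^sub>m n) $$ (0, 1)" by simp
    then show False using deg by (simp add: T_def)
  qed
  obtain c where "lower_central G c = {\<one>\<^bsub>G\<^esub>}" using nil by (auto simp: nilpotent_group_def)
  moreover have "Z \<one>\<^bsub>G\<^esub>" by (auto simp: Z_def matrix_rep_one[OF G r] intro!: exI[of _ 1] eq_matI)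
  ultimately have "\<exists>c. \<forall>g\<in>lower_central G c. Z g" by (intro exI[of _ c]) simp
  then obtain i where i: "\<forall>g\<in>lower_central G (Suc i). Z g" "\<not> (\<forall>g\<in>lower_central G i. Z g)"
    using notall exists_least_lemma[of "\<lambda>c. \<forall>g\<in>lower_central G c. Z g"] by blast
  then obtain a where a: "a \<in> lower_central G i" "\<not> Z a" by blast
  have ac: "a \<in> carrier G" using a lcG by blast
  define cm where "cm g = a \<otimes>\<^bsub>G\<^esub> g \<otimes>\<^bsub>G\<^esub> inv\<^bsub>G\<^esub> a \<otimes>\<^bsub>G\<^esub> inv\<^bsub>G\<^esub> g" for g
  define \<kappa> where "\<kappa> g = \<rho> (cm g) $$ (0, 0)" for g
  have cmc: "cm g \<in> carrier G" if "g \<in> carrier G" for g using that ac by (simp add: cm_def)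
  have k: "\<rho> (cm g) = \<kappa> g \<cdot>\<^sub>m 1\<^sub>m n" if g: "g \<in> carrier G" for g
  proof -
    have "cm g \<in> lower_central G (Suc i)" using a g by (auto simp: cm_def intro!: generate.incl)
    then obtain k where "\<rho> (cm g) = k \<cdot>\<^sub>m 1\<^sub>m n" using i by (auto simp: Z_def)
    then show ?thesis using deg by (simp add: \<kappa>_def)
  qed
  have mult: "\<kappa> (g \<otimes>\<^bsub>G\<^esub> h) = \<kappa> g * \<kappa> h" if gh: "g \<in> carrier G" "h \<in> carrier G" for g h
  proof -
    have "cm (g \<otimes>\<^bsub>G\<^esub> h) = cm g \<otimes>\<^bsub>G\<^esub> (g \<otimes>\<^bsub>G\<^esub> cm h \<otimes>\<^bsub>G\<^esub> inv\<^bsub>G\<^esub> g)"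
    proof -
      have e: "inv\<^bsub>G\<^esub> a \<otimes>\<^bsub>G\<^esub> (a \<otimes>\<^bsub>G\<^esub> z) = z" "inv\<^bsub>G\<^esub> g \<otimes>\<^bsub>G\<^esub> (g \<otimes>\<^bsub>G\<^esub> z) = z" if "z \<in> carrier G" for z
        using that ac gh by (simp_all add: G.m_assoc[symmetric])
      show ?thesis using ac gh by (simp add: cm_def G.m_assoc G.inv_mult_group e)
    qed
    then have "\<rho> (cm (g \<otimes>\<^bsub>G\<^esub> h)) = (\<kappa> g \<cdot>\<^sub>m 1\<^sub>m n) * (\<rho> g * (\<kappa> h \<cdot>\<^sub>m 1\<^sub>m n) * \<rho> (inv\<^bsub>G\<^esub> g))"
      using gh cmc by (simp add: rm k)
    also have "\<rho> g * (\<kappa> h \<cdot>\<^sub>m 1\<^sub>m n) * \<rho> (inv\<^bsub>G\<^esub> g) = \<kappa> h \<cdot>\<^sub>m (\<rho> g * \<rho> (inv\<^bsub>G\<^esub> g))"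
      using gh rc[OF gh(1)] rc[of "inv\<^bsub>G\<^esub> g"]
      by (simp add: mult_smult_distrib[of _ n n _ n] mult_smult_assoc_mat[of _ n n _ n])
    also have "\<dots> = \<kappa> h \<cdot>\<^sub>m 1\<^sub>m n" using gh by (simp add: matrix_rep_inv[OF G r])
    finally have "\<kappa> (g \<otimes>\<^bsub>G\<^esub> h) = ((\<kappa> g \<cdot>\<^sub>m 1\<^sub>m n) * (\<kappa> h \<cdot>\<^sub>m 1\<^sub>m n)) $$ (0, 0)" by (simp add: \<kappa>_def)
    then show ?thesis using deg by (simp add: mult_smult_distrib[of _ n n _ n] mult_smult_assoc_mat[of _ n n _ n])
  qed
  have root: "\<kappa> g ^ n = 1" if g: "g \<in> carrier G" for g
  proof -
    have dm: "det (\<rho> (x \<otimes>\<^bsub>G\<^esub> y)) = det (\<rho> x) * det (\<rho> y)" if "x \<in> carrier G" "y \<in> carrier G" for x y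
      using that by (simp add: rm det_mult[OF rc rc])
    have di: "det (\<rho> x) * det (\<rho> (inv\<^bsub>G\<^esub> x)) = 1" if "x \<in> carrier G" for x
      using that by (simp add: dm[symmetric] matrix_rep_one[OF G r])
    have "\<kappa> g ^ n = det (\<rho> (cm g))" using k[OF g] by (simp add: det_smult)
    also have "\<dots> = det (\<rho> a) * det (\<rho> g) * det (\<rho> (inv\<^bsub>G\<^esub> a)) * det (\<rho> (inv\<^bsub>G\<^esub> g))"
      using ac g by (simp add: cm_def dm)
    also have "\<dots> = (det (\<rho> a) * det (\<rho> (inv\<^bsub>G\<^esub> a))) * (det (\<rho> g) * det (\<rho> (inv\<^bsub>G\<^esub> g)))" by simp
    also have "\<dots> = 1" using di ac g by simp
    finally show ?thesis .
  qed
  have cmg: "cm g \<otimes>\<^bsub>G\<^esub> g = a \<otimes>\<^bsub>G\<^esub> g \<otimes>\<^bsub>G\<^esub> inv\<^bsub>G\<^esub> a" if "g \<in> carrier G" for g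
    using that ac by (simp add: cm_def G.m_assoc)
  have conj: "\<rho> (a \<otimes>\<^bsub>G\<^esub> g \<otimes>\<^bsub>G\<^esub> inv\<^bsub>G\<^esub> a) = \<kappa> g \<cdot>\<^sub>m \<rho> g" if g: "g \<in> carrier G" for g
    using rm[OF cmc[OF g] g] rc[OF g]
    by (simp add: cmg[OF g] k[OF g] mult_smult_assoc_mat[of _ n n _ n])
  have nontriv: "\<exists>x\<in>carrier G. \<kappa> x \<noteq> 1"
  proof (rule ccontr)
    assume "\<not> (\<exists>x\<in>carrier G. \<kappa> x \<noteq> 1)"
    then have one: "\<kappa> g = 1" if "g \<in> carrier G" for g using that by blast
    have "\<rho> g * \<rho> a = \<rho> a * \<rho> g" if g: "g \<in> carrier G" for g
    proof -
      have "\<rho> (cm g \<otimes>\<^bsub>G\<^esub> (g \<otimes>\<^bsub>G\<^esub> a)) = \<rho> (g \<otimes>\<^bsub>G\<^esub> a)"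
        using g ac rc[of "g \<otimes>\<^bsub>G\<^esub> a"] by (subst rm[OF cmc]) (auto simp: k one mult_smult_assoc_mat[of _ n n _ n] intro!: eq_matI)
      moreover have "cm g \<otimes>\<^bsub>G\<^esub> (g \<otimes>\<^bsub>G\<^esub> a) = a \<otimes>\<^bsub>G\<^esub> g"
        using g ac cmg[OF g] cmc[OF g] by (simp add: G.m_assoc[symmetric]) (simp add: G.m_assoc)
      ultimately show ?thesis using g ac by (simp add: rm)
    qed
    then obtain k where "\<rho> a = k \<cdot>\<^sub>m 1\<^sub>m n" using schur_scalar[OF irr rc[OF ac]] by blast
    then show False using a by (auto simp: Z_def)
  qed
  have van: "\<kappa> g * \<chi> g = \<chi> g" if g: "g \<in> carrier G" for g
  proof -
    have "\<chi> (a \<otimes>\<^bsub>G\<^esub> g \<otimes>\<^bsub>G\<^esub> inv\<^bsub>G\<^esub> a) = \<chi> g"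
      using class_function_conj[OF characters_class_function[OF G Irr_characters[OF chi]] g ac] .
    moreover have "\<chi> (a \<otimes>\<^bsub>G\<^esub> g \<otimes>\<^bsub>G\<^esub> inv\<^bsub>G\<^esub> a) = \<kappa> g * \<chi> g"
      using g ac by (simp add: c char_of_def conj mat_trace_smult[OF rc])
    ultimately show ?thesis by simp
  qed
  show thesis by (rule that[of \<kappa>]) (use mult root nontriv van in blast)+
qed

section \<open>Multiplicities\<close>

lemma sum_list_count:
  fixes f :: "'b \<Rightarrow> complex"
  shows "(\<Sum>x\<leftarrow>xs. f x) = (\<Sum>x\<in>set xs. of_nat (count_list xs x) * f x)"
proof -
  have "(\<Sum>x\<leftarrow>xs. f x) = (\<Sum>x\<in>A. of_nat (count_list xs x) * f x)" if "finite A" "set xs \<subseteq> A" for A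
    using that(2)
  proof (induct xs)
    case (Cons y xs)
    have "(\<Sum>x\<in>A. of_nat (count_list (y # xs) x) * f x) =
        (\<Sum>x\<in>A. (if x = y then f y else 0) + of_nat (count_list xs x) * f x)"
      by (intro sum.cong) (auto simp: algebra_simps)
    then show ?case using Cons that(1) by (simp add: sum.distrib)
  qed simp
  then show ?thesis by blast
qed

locale finite_grp = group G for G :: "('a, 'b) monoid_scheme" (structure) +
  assumes fin: "finite (carrier G)"
begin

lemma card_pos: "card (carrier G) > 0"
  using fin one_closed by (auto simp: card_gt_0_iff)

lemma ip_cong:
  "(\<And>g. g \<in> carrier G \<Longrightarrow> f g = f' g) \<Longrightarrow> (\<And>g. g \<in> carrier G \<Longrightarrow> h g = h' g) \<Longrightarrow> ip G f h = ip G f' h'"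
  unfolding ip_def by (intro arg_cong2[of _ _ _ _ "(/)"] sum.cong) auto

lemma ip_sum_left:
  "ip G (\<lambda>g. \<Sum>a\<in>A. c a * f a g) h = (\<Sum>a\<in>A. c a * ip G (f a) h)"
proof -
  have "(\<Sum>g\<in>carrier G. (\<Sum>a\<in>A. c a * f a g) * h (inv g)) = (\<Sum>a\<in>A. c a * (\<Sum>g\<in>carrier G. f a g * h (inv g)))"
    by (simp only: sum_distrib_left sum_distrib_right mult.assoc) (rule sum.swap)
  then show ?thesis by (simp add: ip_def sum_divide_distrib[of _ A])
qed

lemma ip_sum_left': "ip G (\<lambda>g. \<Sum>a\<in>A. f a g) h = (\<Sum>a\<in>A. ip G (f a) h)"
  using ip_sum_left[where A = A and c = "\<lambda>_. 1"] by simp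

lemma ip_scale_left: "ip G (\<lambda>g. c * f g) h = c * ip G f h"
  using ip_sum_left[where A = "{()}" and c = "\<lambda>_. c" and f = "\<lambda>_. f"] by simp

lemma ip_commute: "ip G f h = ip G h f"
proof -
  have "(\<Sum>g\<in>carrier G. f g * h (inv g)) = (\<Sum>g\<in>carrier G. h g * f (inv g))"
    by (rule sum.reindex_bij_witness[of _ "m_inv G" "m_inv G"]) auto
  then show ?thesis by (simp add: ip_def)
qed

lemma Irr_ip: "\<chi> \<in> Irr G \<Longrightarrow> \<psi> \<in> Irr G \<Longrightarrow> ip G \<chi> \<psi> = (if \<chi> = \<psi> then 1 else 0)"
  by (rule irr_orthonormal[OF is_group fin])

lemma characters_ext: "\<chi> \<in> characters G \<Longrightarrow> \<chi> \<in> extensional (carrier G)"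
  using characters_class_function[OF is_group] class_function_ext by blast

lemma ext_eqI:
  "f \<in> extensional (carrier G) \<Longrightarrow> h \<in> extensional (carrier G) \<Longrightarrow> (\<And>g. g \<in> carrier G \<Longrightarrow> f g = h g) \<Longrightarrow> f = h"
  by (rule extensionalityI)

lemma characters_list:
  assumes "\<chi> \<in> characters G"
  obtains xs where "set xs \<subseteq> Irr G"
    "\<And>g. g \<in> carrier G \<Longrightarrow> \<chi> g = (\<Sum>\<xi>\<in>set xs. of_nat (count_list xs \<xi>) * \<xi> g)"
proof -
  obtain n \<rho> where r: "matrix_rep G n \<rho>" "\<chi> = char_of G \<rho>" using assms by (auto simp: characters_def)
  obtain xs where "set xs \<subseteq> Irr G" "\<forall>g\<in>carrier G. \<chi> g = (\<Sum>\<xi>\<leftarrow>xs. \<xi> g)"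
    using character_list_decomposition[OF is_group r(1)] r(2) by blast
  then show thesis by (intro that[of xs]) (auto simp: sum_list_count)
qed

text \<open>The regular character pairs with every irreducible character to its degree, hence contains
  all of them.\<close>

lemma finite_Irr: "finite (Irr G)"
proof -
  let ?n = "card (carrier G)" and ?T = "G\<lparr>carrier := {\<one>}\<rparr>"
  have T: "subgroup {\<one>} G" by (rule triv_subgroup)
  have "matrix_rep ?T 1 (\<lambda>_. 1\<^sub>m 1)"
    by (rule matrix_repI[OF subgroup_imp_group[OF T]]) auto
  from charactersI[OF this] have triv: "char_of ?T (\<lambda>_. 1\<^sub>m 1) \<in> characters ?T" by simp
  obtain t where t: "bij_betw t {0..<?n} (carrier G)" using ex_bij_betw_nat_finite[OF fin] by blast
  have tc: "t i \<in> carrier G" if "i < ?n" for i using t that by (auto simp: bij_betw_def)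
  have uniq: "\<exists>!i. i < ?n \<and> inv (t i) \<otimes> g \<in> {\<one>}" if g: "g \<in> carrier G" for g
  proof -
    have "g \<in> t ` {0..<?n}" using t g by (simp add: bij_betw_def)
    then obtain i where i: "i < ?n" "t i = g" by auto
    have "inv (t j) \<otimes> g = \<one> \<longleftrightarrow> j = i" if j: "j < ?n" for j
    proof -
      have "inv (t j) \<otimes> g = \<one> \<longleftrightarrow> t j = g"
      proof
        assume "inv (t j) \<otimes> g = \<one>"
        then have "inv g = inv (t j)" using g tc[OF j] by (intro inv_equality) auto
        then have "inv (inv g) = inv (inv (t j))" by simp
        then show "t j = g" using g tc[OF j] by simp
      qed (use tc[OF j] in simp)
      also have "\<dots> \<longleftrightarrow> j = i" using t i j by (auto simp: bij_betw_def inj_on_def)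
      finally show ?thesis .
    qed
    then show ?thesis using i by auto
  qed
  \<comment> \<open>Inducing the trivial character of the trivial subgroup gives the regular
    character, with all of \<open>G\<close> as transversal.\<close>
  define R where "R = (\<lambda>g\<in>carrier G. \<Sum>i<?n. if inv (t i) \<otimes> g \<otimes> t i \<in> {\<one>}
      then char_of ?T (\<lambda>_. 1\<^sub>m 1) (inv (t i) \<otimes> g \<otimes> t i) else 0)"
  have R: "R \<in> characters G"
    unfolding R_def by (rule induced_character[OF is_group T triv tc uniq])
  have Rg: "R g = (if g = \<one> then of_nat ?n else 0)" if g: "g \<in> carrier G" for g
  proof -
    have iff: "inv (t i) \<otimes> g \<otimes> t i = \<one> \<longleftrightarrow> g = \<one>" if "i < ?n" for i
    proof
      assume "inv (t i) \<otimes> g \<otimes> t i = \<one>"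
      then have "inv (t i) = inv (t i) \<otimes> g" using tc[OF that] g by (intro inv_equality) auto
      then show "g = \<one>" using tc[OF that] g by simp
    qed (use tc[OF that] in simp)
    have "R g = (\<Sum>i<?n. if g = \<one> then 1 else 0)"
      unfolding R_def restrict_apply'[OF g]
    proof (intro sum.cong refl)
      fix i assume "i \<in> {..<?n}"
      then show "(if inv (t i) \<otimes> g \<otimes> t i \<in> {\<one>} then char_of ?T (\<lambda>_. 1\<^sub>m 1) (inv (t i) \<otimes> g \<otimes> t i) else 0) =
          (if g = \<one> then 1 else 0)"
        using iff[of i] by (auto simp: char_of_def)
    qed
    then show ?thesis by simp
  qed
  obtain xs where xs: "set xs \<subseteq> Irr G" "\<And>g. g \<in> carrier G \<Longrightarrow> R g = (\<Sum>\<xi>\<in>set xs. of_nat (count_list xs \<xi>) * \<xi> g)"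
    using characters_list[OF R] by blast
  have "Irr G \<subseteq> set xs"
  proof
    fix \<theta> assume \<theta>: "\<theta> \<in> Irr G"
    obtain d where d: "d > 0" "\<theta> \<one> = of_nat d" using characters_degree[OF is_group Irr_characters[OF \<theta>]] .
    have "(\<Sum>g\<in>carrier G. R g * \<theta> (inv g)) = (\<Sum>g\<in>carrier G. if g = \<one> then of_nat ?n * \<theta> \<one> else 0)"
      by (intro sum.cong) (auto simp: Rg)
    then have "ip G R \<theta> = of_nat d" using fin card_pos d(2) by (simp add: ip_def card_gt_0_iff)
    moreover have "ip G R \<theta> = (\<Sum>\<xi>\<in>set xs. of_nat (count_list xs \<xi>) * ip G \<xi> \<theta>)"
      using ip_cong[of R "\<lambda>g. \<Sum>\<xi>\<in>set xs. of_nat (count_list xs \<xi>) * \<xi> g" \<theta> \<theta>] xs(2) by (simp add: ip_sum_left)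
    ultimately have "(\<Sum>\<xi>\<in>set xs. of_nat (count_list xs \<xi>) * ip G \<xi> \<theta>) \<noteq> 0"
      using d(1) by (metis of_nat_eq_0_iff less_numeral_extra(3))
    then obtain \<xi> where \<xi>: "\<xi> \<in> set xs" "of_nat (count_list xs \<xi>) * ip G \<xi> \<theta> \<noteq> 0"
      by (rule sum.not_neutral_contains_not_neutral)
    then have "ip G \<xi> \<theta> \<noteq> 0" by simp
    moreover have "\<xi> \<in> Irr G" using xs(1) \<xi>(1) by blast
    ultimately have "\<xi> = \<theta>" using Irr_ip[OF _ \<theta>] by metis
    then show "\<theta> \<in> set xs" using \<xi>(1) by simp
  qed
  then show ?thesis by (rule finite_subset) simp
qed

lemma ip_combination:
  assumes "\<And>g. g \<in> carrier G \<Longrightarrow> f g = (\<Sum>\<xi>\<in>Irr G. m \<xi> * \<xi> g)"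
  shows "ip G f h = (\<Sum>\<xi>\<in>Irr G. m \<xi> * ip G \<xi> h)"
    and "\<theta> \<in> Irr G \<Longrightarrow> ip G f \<theta> = m \<theta>"
proof -
  show 1: "ip G f h = (\<Sum>\<xi>\<in>Irr G. m \<xi> * ip G \<xi> h)" for h
    using ip_cong[of f "\<lambda>g. \<Sum>\<xi>\<in>Irr G. m \<xi> * \<xi> g" h h] assms by (simp add: ip_sum_left)
  show "ip G f \<theta> = m \<theta>" if "\<theta> \<in> Irr G"
  proof -
    have "ip G f \<theta> = (\<Sum>\<xi>\<in>Irr G. if \<xi> = \<theta> then m \<theta> else 0)"
      unfolding 1 using that by (intro sum.cong) (auto simp: Irr_ip)
    then show ?thesis using that finite_Irr by simp
  qed
qed

lemma characters_decompose:
  assumes "\<chi> \<in> characters G"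
  shows "\<exists>m :: ('a \<Rightarrow> complex) \<Rightarrow> nat. (\<forall>g\<in>carrier G. \<chi> g = (\<Sum>\<xi>\<in>Irr G. of_nat (m \<xi>) * \<xi> g)) \<and>
     (\<forall>\<theta>\<in>Irr G. ip G \<chi> \<theta> = of_nat (m \<theta>))"
proof -
  obtain xs where xs: "set xs \<subseteq> Irr G" "\<And>g. g \<in> carrier G \<Longrightarrow> \<chi> g = (\<Sum>\<xi>\<in>set xs. of_nat (count_list xs \<xi>) * \<xi> g)"
    using characters_list[OF assms] by blast
  have e: "\<chi> g = (\<Sum>\<xi>\<in>Irr G. of_nat (count_list xs \<xi>) * \<xi> g)" if "g \<in> carrier G" for g
    unfolding xs(2)[OF that] using xs(1) finite_Irr by (intro sum.mono_neutral_left) (auto simp: count_list_0_iff)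
  show ?thesis using e ip_combination(2)[of \<chi>, OF e] by (intro exI[of _ "count_list xs"]) blast
qed

lemma ip_self_decompose:
  assumes "\<And>g. g \<in> carrier G \<Longrightarrow> \<chi> g = (\<Sum>\<xi>\<in>Irr G. of_nat (m \<xi>) * \<xi> g)"
  shows "ip G \<chi> \<chi> = of_nat (\<Sum>\<xi>\<in>Irr G. m \<xi> ^ 2)"
proof -
  have "ip G \<chi> \<chi> = (\<Sum>\<xi>\<in>Irr G. of_nat (m \<xi>) * ip G \<xi> \<chi>)" by (rule ip_combination(1)[OF assms])
  also have "\<dots> = (\<Sum>\<xi>\<in>Irr G. of_nat (m \<xi> ^ 2))"
    by (intro sum.cong refl) (simp add: ip_commute[of _ \<chi>] ip_combination(2)[OF assms] power2_eq_square)
  finally show ?thesis by simp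
qed

text \<open>The norm is the sum of the squares of the multiplicities, and 1 is such a sum only if a
  single multiplicity is 1 and the others are 0.\<close>

lemma Irr_if_norm_one:
  assumes chi: "\<chi> \<in> characters G" and one: "ip G \<chi> \<chi> = 1"
  shows "\<chi> \<in> Irr G"
proof -
  obtain m where m: "\<And>g. g \<in> carrier G \<Longrightarrow> \<chi> g = (\<Sum>\<xi>\<in>Irr G. of_nat (m \<xi>) * \<xi> g)"
    using characters_decompose[OF chi] by metis
  have "of_nat (\<Sum>\<xi>\<in>Irr G. m \<xi> ^ 2) = (of_nat 1 :: complex)"
    using ip_self_decompose[of \<chi> m, OF m] one by (simp del: of_nat_sum)
  then have s: "(\<Sum>\<xi>\<in>Irr G. m \<xi> ^ 2) = 1" by (simp only: of_nat_eq_iff)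
  then obtain \<theta> where \<theta>: "\<theta> \<in> Irr G" "m \<theta> \<noteq> 0"
    by (metis (no_types, lifting) one_neq_zero power_zero_numeral sum.neutral)
  have "(\<Sum>\<xi>\<in>Irr G. m \<xi> ^ 2) = m \<theta> ^ 2 + (\<Sum>\<xi>\<in>Irr G - {\<theta>}. m \<xi> ^ 2)"
    using \<theta> finite_Irr by (simp add: sum.remove)
  moreover have "m \<theta> ^ 2 \<ge> 1" using \<theta> by simp
  ultimately have "m \<theta> ^ 2 = 1" and "(\<Sum>\<xi>\<in>Irr G - {\<theta>}. m \<xi> ^ 2) = 0" using s by linarith+
  then have m1: "m \<theta> = 1" and m0: "\<And>\<xi>. \<xi> \<in> Irr G - {\<theta>} \<Longrightarrow> m \<xi> = 0" using finite_Irr by auto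
  have "\<chi> g = \<theta> g" if "g \<in> carrier G" for g
  proof -
    have "\<chi> g = (\<Sum>\<xi>\<in>Irr G. if \<xi> = \<theta> then \<theta> g else 0)"
      unfolding m[OF that] using m1 m0 by (intro sum.cong) auto
    then show ?thesis using \<theta> finite_Irr by simp
  qed
  then have "\<chi> = \<theta>" using ext_eqI characters_ext chi Irr_characters[OF \<theta>(1)] by blast
  then show ?thesis using \<theta> by simp
qed

lemma characters_constituent:
  assumes chi: "\<chi> \<in> characters G"
  obtains \<theta> where "\<theta> \<in> Irr G" "ip G \<chi> \<theta> \<noteq> 0"
proof -
  obtain d where d: "d > 0" "\<chi> \<one> = of_nat d" using characters_degree[OF is_group chi] .
  obtain m where m: "\<And>g. g \<in> carrier G \<Longrightarrow> \<chi> g = (\<Sum>\<xi>\<in>Irr G. of_nat (m \<xi>) * \<xi> g)"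
     "\<And>\<theta>. \<theta> \<in> Irr G \<Longrightarrow> ip G \<chi> \<theta> = of_nat (m \<theta>)"
    using characters_decompose[OF chi] by metis
  have "(\<Sum>\<xi>\<in>Irr G. of_nat (m \<xi>) * \<xi> \<one>) \<noteq> (0::complex)"
    using d(1) unfolding m(1)[OF one_closed, symmetric] d(2) by simp
  then obtain \<theta> where "\<theta> \<in> Irr G" "of_nat (m \<theta>) * \<theta> \<one> \<noteq> (0::complex)"
    using sum.not_neutral_contains_not_neutral by blast
  then show thesis using that m(2) by auto
qed

text \<open>The family may repeat characters; the multiplicity of \<open>\<xi>\<close> is the size
  of its fibre. Pairing with \<open>\<theta>\<close> shows that any other multiplicity function in
  the definition of \<open>irr_constituents\<close> has the same value at
  \<open>\<theta>\<close>.\<close>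

lemma irr_constituents_sum:
  assumes I: "finite I" and f: "\<And>i. i \<in> I \<Longrightarrow> f i \<in> Irr G"
    and phi: "\<phi> = (\<lambda>g\<in>carrier G. \<Sum>i\<in>I. f i g)"
  shows "irr_constituents G \<phi> = f ` I"
proof -
  define m where "m \<xi> = card {i \<in> I. f i = \<xi>}" for \<xi>
  have "(\<Sum>i\<in>I. f i g) = (\<Sum>\<xi>\<in>Irr G. of_nat (m \<xi>) * \<xi> g)" for g
  proof -
    have "(\<Sum>i\<in>I. f i g) = (\<Sum>\<xi>\<in>Irr G. \<Sum>i\<in>{i \<in> I. f i = \<xi>}. f i g)"
      using I f finite_Irr by (intro sum.group[symmetric]) auto
    also have "\<dots> = (\<Sum>\<xi>\<in>Irr G. of_nat (m \<xi>) * \<xi> g)" by (intro sum.cong) (auto simp: m_def)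
    finally show ?thesis .
  qed
  then have m: "\<phi> = (\<lambda>g\<in>carrier G. \<Sum>\<xi>\<in>Irr G. of_nat (m \<xi>) * \<xi> g)" by (simp add: phi)
  have pos: "m \<theta> > 0 \<longleftrightarrow> \<theta> \<in> f ` I" for \<theta> using I by (auto simp: m_def card_gt_0_iff)
  show ?thesis
  proof (intro equalityI subsetI)
    fix \<theta> assume "\<theta> \<in> irr_constituents G \<phi>"
    then obtain m' :: "_ \<Rightarrow> nat" where t: "\<theta> \<in> Irr G" and
      m': "\<phi> = (\<lambda>g\<in>carrier G. \<Sum>\<xi>\<in>Irr G. of_nat (m' \<xi>) * \<xi> g)" and p: "m' \<theta> > 0"
      by (auto simp: irr_constituents_def)
    have "ip G \<phi> \<theta> = of_nat (m' \<theta>)" by (rule ip_combination(2)[OF _ t]) (simp add: m')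
    moreover have "ip G \<phi> \<theta> = of_nat (m \<theta>)" by (rule ip_combination(2)[OF _ t]) (simp add: m)
    ultimately have "m \<theta> > 0" using p by simp
    then show "\<theta> \<in> f ` I" by (simp add: pos)
  next
    fix \<theta> assume "\<theta> \<in> f ` I"
    then show "\<theta> \<in> irr_constituents G \<phi>" using f m pos unfolding irr_constituents_def by blast
  qed
qed

section \<open>Twists and linear characters\<close>

definition twist :: "('a \<Rightarrow> complex) \<Rightarrow> ('a \<Rightarrow> complex) \<Rightarrow> 'a \<Rightarrow> complex" where
  "twist \<mu> \<theta> = (\<lambda>g\<in>carrier G. \<mu> g * \<theta> g)"

text \<open>The factors \<open>\<mu> g\<close> and \<open>\<mu> (inv g)\<close> cancel in the norm,
  so irreducibility survives.\<close>

lemma twist_character: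
  assumes "\<And>g h. g \<in> carrier G \<Longrightarrow> h \<in> carrier G \<Longrightarrow> \<mu> (g \<otimes> h) = \<mu> g * \<mu> h" "\<mu> \<one> = 1"
  shows "\<theta> \<in> characters G \<Longrightarrow> twist \<mu> \<theta> \<in> characters G" "\<theta> \<in> Irr G \<Longrightarrow> twist \<mu> \<theta> \<in> Irr G"
proof -
  show c: "twist \<mu> \<theta> \<in> characters G" if "\<theta> \<in> characters G" for \<theta>
    unfolding twist_def by (rule characters_linear_mult[OF is_group that assms])
  have "\<mu> g * \<mu> (inv g) = 1" if "g \<in> carrier G" for g
    using assms(1)[OF that inv_closed[OF that]] assms(2) that by simp
  then have "(\<mu> g * \<theta> g) * (\<mu> (inv g) * \<theta> (inv g)) = \<theta> g * \<theta> (inv g)" if "g \<in> carrier G" for g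
    using that by (metis mult.assoc mult.left_commute mult_1)
  then have "ip G (twist \<mu> \<theta>) (twist \<mu> \<theta>) = ip G \<theta> \<theta>"
    unfolding ip_def twist_def by (intro arg_cong2[of _ _ _ _ "(/)"] sum.cong) auto
  then show "twist \<mu> \<theta> \<in> Irr G" if "\<theta> \<in> Irr G"
    using Irr_if_norm_one[OF c[OF Irr_characters[OF that]]] Irr_ip[OF that that] by simp
qed

lemma linear_character_mult:
  assumes "\<theta> \<in> characters G" "\<theta> \<one> = 1" "g \<in> carrier G" "h \<in> carrier G"
  shows "\<theta> (g \<otimes> h) = \<theta> g * \<theta> h"
proof -
  obtain n \<rho> where r: "matrix_rep G n \<rho>" "\<theta> = char_of G \<rho>" using assms by (auto simp: characters_def)
  then have "n = 1" using char_of_one[OF is_group r(1)] assms by simp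
  then have r1: "matrix_rep G 1 \<rho>" using r by simp
  note c = matrix_rep_carrier[OF r1]
  have e: "\<theta> y = \<rho> y $$ (0, 0)" if "y \<in> carrier G" for y
    unfolding r(2) char_of_apply[OF r1 that] by simp
  have "\<rho> (g \<otimes> h) $$ (0, 0) = \<rho> g $$ (0, 0) * \<rho> h $$ (0, 0)"
    unfolding matrix_rep_mult[OF r1 assms(3,4)] using index_mult_mat_sum[OF c[OF assms(3)] c[OF assms(4)], of 0 0] by simp
  then show ?thesis using assms(3,4) by (simp add: e)
qed

lemma linear_character_Irr: "\<theta> \<in> characters G \<Longrightarrow> \<theta> \<one> = 1 \<Longrightarrow> \<theta> \<in> Irr G"
proof -
  assume t: "\<theta> \<in> characters G" "\<theta> \<one> = 1"
  have "\<theta> g * \<theta> (inv g) = 1" if "g \<in> carrier G" for g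
    using linear_character_mult[OF t that inv_closed[OF that]] that t by simp
  then have "ip G \<theta> \<theta> = 1" using card_pos by (simp add: ip_def)
  then show ?thesis using Irr_if_norm_one t by blast
qed

lemma linear_character_nonzero:
  assumes "\<theta> \<in> characters G" "\<theta> \<one> = 1" "g \<in> carrier G"
  shows "\<theta> g \<noteq> 0"
proof
  assume "\<theta> g = 0"
  then have "\<theta> \<one> = 0" using linear_character_mult[OF assms inv_closed[OF assms(3)]] assms(3) by simp
  then show False using assms(2) by simp
qed

end

section \<open>Clifford theory for a normal subgroup of prime index\<close>

lemma root_of_unity_power_eq_one:
  fixes z :: complex
  assumes p: "prime p" and z: "z ^ p = 1" "z \<noteq> 1"
  shows "z ^ k = 1 \<longleftrightarrow> p dvd k"
proof
  assume k: "z ^ k = 1"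
  show "p dvd k"
  proof (rule ccontr)
    assume "\<not> p dvd k"
    then have "coprime k p" using p prime_imp_coprime coprime_commute by blast
    moreover have "k \<noteq> 0" using \<open>\<not> p dvd k\<close> by (intro notI) simp
    ultimately obtain a b where ab: "k * a = p * b + 1"
      using bezout_nat[of k p] by (metis coprime_iff_gcd_eq_1)
    have "(z ^ k) ^ a = (z ^ p) ^ b * z" by (metis ab power_add power_mult power_one_right)
    then show False using k z by simp
  qed
qed (use z in \<open>auto simp: dvd_def power_mult\<close>)

lemma root_of_unity_powers_sum:
  fixes z :: complex
  assumes "z ^ p = 1"
  shows "(\<Sum>j<p. z ^ j) = (if z = 1 then of_nat p else 0)"
  using assms by (simp add: sum_gp_strict)

text \<open>For \<open>z = \<kappa> x\<close> and \<open>w = \<kappa> g\<close> this is the unique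
  \<open>i\<close> with \<open>x [^] i \<otimes> g\<close> in the kernel of \<open>\<kappa>\<close>.
  The \<open>p\<close> powers of \<open>z\<close> are distinct, so they exhaust the
  \<open>p\<close>-th roots of unity.\<close>

lemma root_of_unity_generates:
  fixes z w :: complex
  assumes p: "prime p" and z: "z ^ p = 1" "z \<noteq> 1" and w: "w ^ p = 1"
  shows "\<exists>!i. i < p \<and> z ^ i * w = 1"
proof -
  have z0: "z \<noteq> 0" using z(1) prime_gt_0_nat[OF p] by (auto simp: power_0_left)
  have ne: False if "i < j" "j < p" "z ^ i = z ^ j" for i j
  proof -
    have "z ^ j = z ^ i * z ^ (j - i)" using that(1) by (simp flip: power_add)
    then have "z ^ (j - i) = 1" using that z0 by simp
    then have "p dvd j - i" using root_of_unity_power_eq_one[OF p z] by simp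
    then show False using that by (auto dest: dvd_imp_le)
  qed
  have inj: "inj_on (\<lambda>i. z ^ i) {..<p}"
    by (rule inj_onI) (metis ne lessThan_iff linorder_neqE_nat)
  have "(\<lambda>i. z ^ i) ` {..<p} = {u. u ^ p = 1}"
  proof (rule card_subset_eq)
    show "finite {u::complex. u ^ p = 1}" using prime_gt_0_nat[OF p] by (intro finite_roots_unity) auto
    show "(\<lambda>i. z ^ i) ` {..<p} \<subseteq> {u. u ^ p = 1}"
    proof safe
      fix i
      have "(z ^ i) ^ p = (z ^ p) ^ i" by (simp add: power_mult[symmetric] mult.commute)
      then show "(z ^ i) ^ p = 1" using z(1) by simp
    qed
    show "card ((\<lambda>i. z ^ i) ` {..<p}) = card {u::complex. u ^ p = 1}"
      using prime_gt_0_nat[OF p] by (simp add: card_image[OF inj] card_roots_unity_eq)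
  qed
  moreover have "inverse w \<in> {u. u ^ p = 1}" using w by (simp add: power_inverse)
  ultimately obtain i where i: "i < p" "z ^ i = inverse w" by (metis (no_types, lifting) imageE lessThan_iff)
  have w0: "w \<noteq> 0" using w prime_gt_0_nat[OF p] by (auto simp: power_0_left)
  have "z ^ j * w = 1 \<longleftrightarrow> j = i" if "j < p" for j
  proof -
    have "z ^ j * w = 1 \<longleftrightarrow> z ^ j = inverse w" using w0 by (simp add: field_simps)
    also have "\<dots> \<longleftrightarrow> j = i" using inj that i by (auto simp: inj_on_def)
    finally show ?thesis .
  qed
  then show ?thesis using i by auto
qed

text \<open>Nilpotency is left to an extension of this locale, since the theory is applied both to
  \<open>G\<close> with \<open>\<kappa>\<close> and to the kernel of \<open>\<kappa>\<close> with
  another character of order \<open>p\<close>.\<close>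

locale prime_kernel = finite_grp +
  fixes p :: nat and \<kappa> :: "'a \<Rightarrow> complex" and x :: 'a
  assumes p: "prime p"
    and \<kappa>_mult: "g \<in> carrier G \<Longrightarrow> h \<in> carrier G \<Longrightarrow> \<kappa> (g \<otimes> h) = \<kappa> g * \<kappa> h"
    and \<kappa>_root: "g \<in> carrier G \<Longrightarrow> \<kappa> g ^ p = 1"
    and x: "x \<in> carrier G" and \<kappa>x: "\<kappa> x \<noteq> 1"
begin

definition H :: "'a set" where "H = {g \<in> carrier G. \<kappa> g = 1}"
abbreviation K :: "('a, 'b) monoid_scheme" where "K \<equiv> G\<lparr>carrier := H\<rparr>"

definition cj :: "nat \<Rightarrow> ('a \<Rightarrow> complex) \<Rightarrow> 'a \<Rightarrow> complex" where
  "cj k f = (\<lambda>h\<in>H. f (x [^] k \<otimes> h \<otimes> inv (x [^] k)))"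

text \<open>The powers \<open>x [^] i\<close> with \<open>i < p\<close> represent the cosets of the normal subgroup \<open>H\<close>, so this is the
  induced class function.\<close>

definition Ind :: "('a \<Rightarrow> complex) \<Rightarrow> 'a \<Rightarrow> complex" where
  "Ind f = (\<lambda>g\<in>carrier G. if g \<in> H then \<Sum>i<p. f (x [^] i \<otimes> g \<otimes> inv (x [^] i)) else 0)"

lemma p_pos: "p > 0" using p by (rule prime_gt_0_nat)

lemma \<kappa>_nonzero: "g \<in> carrier G \<Longrightarrow> \<kappa> g \<noteq> 0"
  using \<kappa>_root[of g] p_pos by (auto simp: power_0_left)

lemma \<kappa>_one: "\<kappa> \<one> = 1"
  using \<kappa>_mult[of \<one> \<one>] \<kappa>_nonzero[of \<one>] by simp

lemma \<kappa>_inv: "g \<in> carrier G \<Longrightarrow> \<kappa> g * \<kappa> (inv g) = 1"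
  using \<kappa>_mult[of g "inv g"] \<kappa>_one by simp

lemma \<kappa>_pow: "g \<in> carrier G \<Longrightarrow> \<kappa> (g [^] (k::nat)) = \<kappa> g ^ k"
  by (induct k) (auto simp: \<kappa>_one \<kappa>_mult)

lemma \<kappa>_conj: "g \<in> carrier G \<Longrightarrow> h \<in> carrier G \<Longrightarrow> \<kappa> (h \<otimes> g \<otimes> inv h) = \<kappa> g"
  using \<kappa>_inv[of h] by (simp add: \<kappa>_mult)

lemma H_carrier: "h \<in> H \<Longrightarrow> h \<in> carrier G" by (simp add: H_def)

lemma H_conj: "h \<in> H \<Longrightarrow> g \<in> carrier G \<Longrightarrow> g \<otimes> h \<otimes> inv g \<in> H"
  by (simp add: H_def \<kappa>_conj)

lemma H_conj': "h \<in> H \<Longrightarrow> g \<in> carrier G \<Longrightarrow> inv g \<otimes> h \<otimes> g \<in> H"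
  using H_conj[of h "inv g"] by simp

lemma H_subgroup: "subgroup H G"
proof (rule subgroupI)
  show "inv a \<in> H" if "a \<in> H" for a using that \<kappa>_inv[of a] by (simp add: H_def)
qed (use \<kappa>_one in \<open>auto simp: H_def \<kappa>_mult\<close>)

lemma K_grp: "finite_grp K"
proof -
  have "finite H" using fin by (simp add: H_def)
  then show ?thesis
    using subgroup_imp_group[OF H_subgroup] by (simp add: finite_grp_def finite_grp_axioms_def)
qed

sublocale K: finite_grp K rewrites "carrier K = H" and "(\<otimes>\<^bsub>K\<^esub>) = (\<otimes>)" and "\<one>\<^bsub>K\<^esub> = \<one>"
  by (rule K_grp) auto

lemma K_inv: "h \<in> H \<Longrightarrow> m_inv K h = inv h"
  by (rule subgroup_inv[OF is_group H_subgroup])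

lemma x_pow_p: "x [^] p \<in> H"
  using x by (simp add: H_def \<kappa>_pow \<kappa>_root)

lemma conj_inverse:
  assumes "h \<in> carrier G" "g \<in> carrier G"
  shows "inv g \<otimes> (g \<otimes> h \<otimes> inv g) \<otimes> g = h" "g \<otimes> (inv g \<otimes> h \<otimes> g) \<otimes> inv g = h"
proof -
  have e: "inv g \<otimes> (g \<otimes> z) = z" "g \<otimes> (inv g \<otimes> z) = z" if "z \<in> carrier G" for z
    using that assms by (simp_all add: m_assoc[symmetric])
  show "inv g \<otimes> (g \<otimes> h \<otimes> inv g) \<otimes> g = h" "g \<otimes> (inv g \<otimes> h \<otimes> g) \<otimes> inv g = h"
    using assms by (simp_all add: m_assoc e)
qed

lemma conj_inv: "h \<in> carrier G \<Longrightarrow> g \<in> carrier G \<Longrightarrow> inv (g \<otimes> h \<otimes> inv g) = g \<otimes> inv h \<otimes> inv g"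
  by (simp add: inv_mult_group m_assoc)

lemma conj_conj:
  "h \<in> carrier G \<Longrightarrow> a \<in> carrier G \<Longrightarrow> b \<in> carrier G \<Longrightarrow>
    a \<otimes> (b \<otimes> h \<otimes> inv b) \<otimes> inv a = (a \<otimes> b) \<otimes> h \<otimes> inv (a \<otimes> b)"
  by (simp add: inv_mult_group m_assoc)

lemma conj_mult:
  assumes "h \<in> carrier G" "h' \<in> carrier G" "g \<in> carrier G"
  shows "g \<otimes> (h \<otimes> h') \<otimes> inv g = (g \<otimes> h \<otimes> inv g) \<otimes> (g \<otimes> h' \<otimes> inv g)"
proof -
  have e: "inv g \<otimes> (g \<otimes> z) = z" if "z \<in> carrier G" for z
    using that assms by (simp add: m_assoc[symmetric])
  show ?thesis using assms by (simp add: m_assoc e)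
qed

lemma sum_H_conj:
  assumes "g \<in> carrier G"
  shows "(\<Sum>h\<in>H. f (g \<otimes> h \<otimes> inv g)) = (\<Sum>h\<in>H. f h)"
  by (rule sum.reindex_bij_witness[of _ "\<lambda>h. inv g \<otimes> h \<otimes> g" "\<lambda>h. g \<otimes> h \<otimes> inv g"])
    (use assms in \<open>auto simp: conj_inverse H_carrier H_conj H_conj'\<close>)

text \<open>The sum of \<open>\<kappa> g ^ j\<close> over all \<open>g\<close> and all
  \<open>j < p\<close>, evaluated in both orders: summing over \<open>j\<close> first gives
  \<open>p\<close> on \<open>H\<close> and 0 elsewhere, summing over \<open>g\<close> first leaves
  only \<open>j = 0\<close>.\<close>

lemma card_G: "card (carrier G) = p * card H"
proof -
  have zero: "(\<Sum>g\<in>carrier G. \<kappa> g ^ j) = 0" if j: "0 < j" "j < p" for j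
  proof -
    have "(\<Sum>g\<in>carrier G. \<kappa> g ^ j) = (\<Sum>g\<in>carrier G. \<kappa> (x \<otimes> g) ^ j)"
      by (rule sum_mult_left[OF x, symmetric])
    also have "\<dots> = \<kappa> x ^ j * (\<Sum>g\<in>carrier G. \<kappa> g ^ j)"
      by (simp add: sum_distrib_left \<kappa>_mult x power_mult_distrib)
    finally have "(\<kappa> x ^ j - 1) * (\<Sum>g\<in>carrier G. \<kappa> g ^ j) = 0" by (simp add: algebra_simps)
    moreover have "\<kappa> x ^ j \<noteq> 1"
      using root_of_unity_power_eq_one[OF p \<kappa>_root[OF x] \<kappa>x] j by (auto dest: dvd_imp_le)
    ultimately show ?thesis by simp
  qed
  have "(\<Sum>j<p. \<Sum>g\<in>carrier G. \<kappa> g ^ j) = (\<Sum>j<p. if j = 0 then of_nat (card (carrier G)) else 0)"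
    by (intro sum.cong) (auto simp: zero)
  also have "\<dots> = of_nat (card (carrier G))" using p_pos by simp
  finally have "of_nat (card (carrier G)) = (\<Sum>g\<in>carrier G. \<Sum>j<p. \<kappa> g ^ j)" by (subst sum.swap) simp
  also have "\<dots> = (\<Sum>g\<in>carrier G. if g \<in> H then of_nat p else (0::complex))"
    by (intro sum.cong) (auto simp: root_of_unity_powers_sum \<kappa>_root H_def)
  also have "\<dots> = (\<Sum>g\<in>H. of_nat p)"
    using fin by (intro sum.mono_neutral_cong_right) (auto simp: H_def)
  finally have "of_nat (card (carrier G)) = (of_nat (p * card H) :: complex)" by simp
  then show ?thesis by (simp only: of_nat_eq_iff)
qed

lemma sum_over_H:
  "(\<And>g. g \<in> carrier G \<Longrightarrow> g \<notin> H \<Longrightarrow> f g = (0::complex)) \<Longrightarrow> (\<Sum>g\<in>carrier G. f g) = (\<Sum>g\<in>H. f g)"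
  using fin by (intro sum.mono_neutral_right) (auto simp: H_def)

lemma ip_K: "ip K f f' = (\<Sum>h\<in>H. f h * f' (inv h)) / of_nat (card H)"
  unfolding ip_def by (simp add: K_inv)

section \<open>Induction from \<open>H\<close> and conjugation by \<open>x\<close>\<close>

lemma Ind_character:
  assumes "f \<in> characters K"
  shows "Ind f \<in> characters G"
proof -
  \<comment> \<open>Inverse powers are the left coset representatives for which
    \<open>inv (?t i) \<otimes> g \<otimes> ?t i\<close> is the conjugate used in
    \<open>Ind\<close>.\<close>
  let ?t = "\<lambda>i. inv (x [^] (i::nat))"
  have "(\<lambda>g\<in>carrier G. \<Sum>i<p. if inv (?t i) \<otimes> g \<otimes> ?t i \<in> H then f (inv (?t i) \<otimes> g \<otimes> ?t i) else 0) \<in> characters G"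
  proof (rule induced_character[OF is_group H_subgroup assms])
    fix g assume g: "g \<in> carrier G"
    have "inv (?t i) \<otimes> g \<in> H \<longleftrightarrow> \<kappa> x ^ i * \<kappa> g = 1" for i
      using g x by (simp add: H_def \<kappa>_mult \<kappa>_pow)
    then show "\<exists>!i. i < p \<and> inv (?t i) \<otimes> g \<in> H"
      using root_of_unity_generates[OF p \<kappa>_root[OF x] \<kappa>x \<kappa>_root[OF g]] by simp
  qed (use x in auto)
  also have "(\<lambda>g\<in>carrier G. \<Sum>i<p. if inv (?t i) \<otimes> g \<otimes> ?t i \<in> H then f (inv (?t i) \<otimes> g \<otimes> ?t i) else 0) = Ind f"
    unfolding Ind_def by (intro restrict_ext) (use x in \<open>auto simp: H_def \<kappa>_conj\<close>)
  finally show ?thesis .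
qed

lemma Ind_H: "h \<in> H \<Longrightarrow> Ind f h = (\<Sum>k<p. cj k f h)"
  by (simp add: Ind_def cj_def H_carrier)

lemma Ind_one: "Ind f \<one> = of_nat p * f \<one>"
  using x \<kappa>_one by (simp add: Ind_def H_def)

lemma frobenius:
  assumes "class_function G \<theta>"
  shows "ip G (Ind f) \<theta> = ip K f \<theta>"
proof -
  have "(\<Sum>g\<in>carrier G. Ind f g * \<theta> (inv g)) = (\<Sum>h\<in>H. Ind f h * \<theta> (inv h))"
    by (rule sum_over_H) (simp add: Ind_def)
  also have "\<dots> = (\<Sum>h\<in>H. \<Sum>i<p. f (x [^] i \<otimes> h \<otimes> inv (x [^] i)) * \<theta> (inv (x [^] i \<otimes> h \<otimes> inv (x [^] i))))"
    using x by (intro sum.cong refl)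
      (simp add: Ind_def H_carrier sum_distrib_right conj_inv class_function_conj[OF assms])
  also have "\<dots> = (\<Sum>i<p. \<Sum>h\<in>H. f (x [^] i \<otimes> h \<otimes> inv (x [^] i)) * \<theta> (inv (x [^] i \<otimes> h \<otimes> inv (x [^] i))))"
    by (rule sum.swap)
  also have "\<dots> = of_nat p * (\<Sum>h\<in>H. f h * \<theta> (inv h))"
    using sum_H_conj[OF nat_pow_closed[OF x], of "\<lambda>h. f h * \<theta> (inv h)"] by simp
  finally show ?thesis using p_pos by (simp add: ip_def[of G] ip_K card_G)
qed

lemma cj_class_function:
  assumes "class_function K f"
  shows "class_function K (cj k f)"
proof (rule class_functionI)
  fix g h assume gh: "g \<in> carrier K" "h \<in> carrier K"
  let ?c = "\<lambda>g. x [^] k \<otimes> g \<otimes> inv (x [^] k)"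
  have c: "g \<in> carrier G" "h \<in> carrier G" "x [^] k \<in> carrier G" using gh x by (auto simp: H_carrier)
  have "?c (h \<otimes> g \<otimes> inv h) = ?c h \<otimes> ?c g \<otimes> inv (?c h)"
    using c by (simp add: conj_mult conj_inv)
  moreover have "f (?c h \<otimes>\<^bsub>K\<^esub> ?c g \<otimes>\<^bsub>K\<^esub> inv\<^bsub>K\<^esub> (?c h)) = f (?c g)"
    using class_function_conj[OF assms, of "?c g" "?c h"] gh c by (simp add: H_conj)
  moreover have "h \<otimes> g \<otimes> inv h \<in> H" using gh c by (simp add: H_conj)
  ultimately show "cj k f (h \<otimes>\<^bsub>K\<^esub> g \<otimes>\<^bsub>K\<^esub> inv\<^bsub>K\<^esub> h) = cj k f g"
    using gh c by (simp add: cj_def K_inv H_conj)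
qed (simp add: cj_def)

lemma cj_character:
  assumes "f \<in> characters K"
  shows "cj k f \<in> characters K"
proof -
  obtain n \<rho> where n: "n > 0" and r: "matrix_rep K n \<rho>" and f: "f = char_of K \<rho>"
    using assms by (auto simp: characters_def)
  let ?c = "\<lambda>g. x [^] k \<otimes> g \<otimes> inv (x [^] k)"
  have xk: "x [^] k \<in> carrier G" using x by simp
  have "matrix_rep K n (\<lambda>h. \<rho> (?c h))"
  proof (rule matrix_repI[OF K.is_group])
    show "\<rho> (?c (g \<otimes>\<^bsub>K\<^esub> h)) = \<rho> (?c g) * \<rho> (?c h)" if "g \<in> carrier K" "h \<in> carrier K" for g h
      using that xk matrix_rep_mult[OF r, of "?c g" "?c h"] by (simp add: conj_mult H_carrier H_conj)
  qed (use xk matrix_rep_carrier[OF r] matrix_rep_one[OF K.is_group r] in \<open>auto simp: H_conj\<close>)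
  moreover have "cj k f = char_of K (\<lambda>h. \<rho> (?c h))"
    unfolding cj_def f char_of_def using xk by (auto simp: H_conj fun_eq_iff)
  ultimately show ?thesis using charactersI n by metis
qed

lemma ip_cj: "ip K (cj k f) (cj k f') = ip K f f'"
proof -
  have "(\<Sum>h\<in>H. cj k f h * cj k f' (inv h)) =
     (\<Sum>h\<in>H. f (x [^] k \<otimes> h \<otimes> inv (x [^] k)) * f' (inv (x [^] k \<otimes> h \<otimes> inv (x [^] k))))"
    using x K.inv_closed K_inv by (intro sum.cong refl) (simp add: cj_def conj_inv H_carrier)
  then show ?thesis
    using sum_H_conj[OF nat_pow_closed[OF x], of "\<lambda>h. f h * f' (inv h)" k] by (simp add: ip_K)
qed

lemma cj_Irr: "f \<in> Irr K \<Longrightarrow> cj k f \<in> Irr K"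
  using K.Irr_if_norm_one[OF cj_character[OF Irr_characters]] K.Irr_ip[of f f] by (simp add: ip_cj)

lemma cj_add: "cj a (cj b f) = cj (a + b) f"
proof -
  have "x [^] b \<otimes> (x [^] a \<otimes> h \<otimes> inv (x [^] a)) \<otimes> inv (x [^] b) = x [^] (a + b) \<otimes> h \<otimes> inv (x [^] (a + b))"
    if "h \<in> H" for h
    using that x by (simp add: conj_conj H_carrier nat_pow_mult add.commute)
  then show ?thesis using x by (auto simp: cj_def fun_eq_iff H_conj)
qed

lemma cj_0: "class_function K f \<Longrightarrow> cj 0 f = f"
  using class_function_ext[of K f] by (auto simp: cj_def fun_eq_iff H_carrier extensional_def)

lemma cj_p: "class_function K f \<Longrightarrow> cj p f = f"
proof -
  assume f: "class_function K f"
  have "f (x [^] p \<otimes> h \<otimes> inv (x [^] p)) = f h" if "h \<in> H" for h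
    using class_function_conj[OF f, of h "x [^] p"] that x_pow_p by (simp add: K_inv)
  then show ?thesis using class_function_ext[OF f] by (auto simp: cj_def fun_eq_iff extensional_def)
qed

lemma cj_fixed_iterate: "class_function K f \<Longrightarrow> cj 1 f = f \<Longrightarrow> cj k f = f"
proof (induct k)
  case (Suc k)
  have "cj (Suc k) f = cj 1 (cj k f)" by (simp add: cj_add)
  then show ?case using Suc by simp
qed (rule cj_0)

text \<open>\<open>k\<close> is invertible modulo \<open>p\<close>, so conjugation by
  \<open>x\<close> is, on class functions of \<open>K\<close>, an iterate of conjugation by
  \<open>x [^] k\<close>.\<close>

lemma cj_fixed_if:
  assumes f: "class_function K f" and k: "0 < k" "k < p" "cj k f = f"
  shows "cj 1 f = f"
proof -
  have mult: "cj (m * n) f = f" if "cj m f = f" for m n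
    by (induct n) (use that cj_0[OF f] cj_add in \<open>auto simp flip: cj_add\<close>)
  have "coprime k p" using p k by (metis coprime_commute nat_dvd_not_less prime_imp_coprime)
  then obtain a b where ab: "k * a = p * b + 1"
    using bezout_nat[of k p] k by (metis coprime_iff_gcd_eq_1 not_gr0)
  have "f = cj (1 + p * b) f" using mult[OF k(3), of a] ab by (simp add: add.commute)
  also have "\<dots> = cj 1 (cj (p * b) f)" by (simp only: cj_add)
  also have "\<dots> = cj 1 f" using mult[OF cj_p[OF f]] by simp
  finally show ?thesis by simp
qed

lemma Irr_class_function: "f \<in> Irr K \<Longrightarrow> class_function K f"
  using characters_class_function[OF K.is_group] Irr_characters by blast

text \<open>Frobenius reciprocity, combined with the fact that \<open>Ind f'\<close> restricts to
  the sum of the conjugates of \<open>f'\<close>.\<close>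

lemma ip_Ind:
  assumes "f' \<in> characters K"
  shows "ip G (Ind f) (Ind f') = (\<Sum>k<p. ip K f (cj k f'))"
proof -
  have "ip G (Ind f) (Ind f') = ip K f (Ind f')"
    by (rule frobenius[OF characters_class_function[OF is_group Ind_character[OF assms]]])
  also have "\<dots> = ip K (Ind f') f" by (rule K.ip_commute)
  also have "\<dots> = ip K (\<lambda>h. \<Sum>k<p. cj k f' h) f" by (rule K.ip_cong) (auto simp: Ind_H)
  also have "\<dots> = (\<Sum>k<p. ip K f (cj k f'))" by (simp add: K.ip_sum_left' K.ip_commute)
  finally show ?thesis .
qed

lemma Ind_Irr:
  assumes f: "f \<in> Irr K" and nf: "cj 1 f \<noteq> f"
  shows "Ind f \<in> Irr G"
proof (rule Irr_if_norm_one)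
  show "Ind f \<in> characters G" using f Ind_character Irr_characters by blast
  have "ip K f (cj k f) = (if k = 0 then 1 else 0)" if "k < p" for k
    using K.Irr_ip[OF f cj_Irr[OF f], of k] cj_0[OF Irr_class_function[OF f]]
      cj_fixed_if[OF Irr_class_function[OF f], of k] that nf by auto
  then show "ip G (Ind f) (Ind f) = 1"
    using p_pos by (simp add: ip_Ind[OF Irr_characters[OF f]])
qed

lemma Ind_invariant_norm:
  assumes f: "f \<in> Irr K" and inv: "cj 1 f = f"
  shows "ip G (Ind f) (Ind f) = of_nat p"
  using K.Irr_ip[OF f f] cj_fixed_iterate[OF Irr_class_function[OF f] inv]
  by (simp add: ip_Ind[OF Irr_characters[OF f]])

lemma Ind_cj:
  assumes f: "class_function K f"
  shows "Ind (cj k f) = Ind f"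
proof -
  have 1: "Ind (cj 1 f) = Ind f" if f: "class_function K f" for f
  proof -
    have shift: "(\<Sum>i<p. cj i (cj 1 f) h) = (\<Sum>i<p. cj i f h)" for h
    proof -
      have "(\<Sum>i<p. cj i (cj 1 f) h) + cj 0 f h = (\<Sum>i<Suc p. cj i f h)"
        by (subst sum.lessThan_Suc_shift) (simp add: cj_add)
      also have "\<dots> = (\<Sum>i<p. cj i f h) + cj 0 f h" by (simp add: cj_p[OF f] cj_0[OF f])
      finally show ?thesis by simp
    qed
    have "Ind f' = (\<lambda>g\<in>carrier G. if g \<in> H then \<Sum>k<p. cj k f' g else 0)" for f'
      unfolding Ind_def by (intro restrict_ext) (simp add: cj_def)
    from this[of "cj 1 f"] this[of f] show ?thesis by (simp only: shift)
  qed
  show ?thesis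
  proof (induct k)
    case (Suc k)
    have "Ind (cj 1 (cj k f)) = Ind (cj k f)" by (rule 1[OF cj_class_function[OF f]])
    then show ?case using Suc by (simp add: cj_add)
  qed (simp add: cj_0[OF f])
qed

section \<open>Restriction to \<open>H\<close>: irreducible or induced\<close>

text \<open>Averaging the twists of \<open>\<theta>\<close> by the powers of \<open>\<kappa>\<close> turns the norm of its restriction into the number
  of these twists that equal \<open>\<theta>\<close>, and the stabilizer of \<open>\<theta>\<close> in a group of prime order is trivial or
  everything.\<close>

lemma twist_power: "\<theta> \<in> characters G \<Longrightarrow> twist (\<lambda>g. \<kappa> g ^ j) \<theta> \<in> characters G"
  "\<theta> \<in> Irr G \<Longrightarrow> twist (\<lambda>g. \<kappa> g ^ j) \<theta> \<in> Irr G"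
  by (rule twist_character; simp add: \<kappa>_mult \<kappa>_one power_mult_distrib)+

lemma restriction_norm:
  "ip K \<theta> \<theta> = (\<Sum>j<p. ip G (twist (\<lambda>g. \<kappa> g ^ j) \<theta>) \<theta>)"
proof -
  have "(\<Sum>j<p. ip G (twist (\<lambda>g. \<kappa> g ^ j) \<theta>) \<theta>) = ip G (\<lambda>g. \<Sum>j<p. twist (\<lambda>g. \<kappa> g ^ j) \<theta> g) \<theta>"
    by (rule ip_sum_left'[symmetric])
  also have "\<dots> = ip G (\<lambda>g. if g \<in> H then of_nat p * \<theta> g else 0) \<theta>"
    by (rule ip_cong) (auto simp: twist_def sum_distrib_right[symmetric] root_of_unity_powers_sum \<kappa>_root H_def)
  also have "\<dots> = (\<Sum>h\<in>H. of_nat p * \<theta> h * \<theta> (inv h)) / of_nat (card (carrier G))"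
    unfolding ip_def by (subst sum_over_H) (auto intro!: arg_cong2[of _ _ _ _ "(/)"] sum.cong)
  also have "\<dots> = ip K \<theta> \<theta>"
    using p_pos by (simp add: ip_K card_G mult.assoc flip: sum_distrib_left)
  finally show ?thesis by simp
qed

lemma twist_eq_if:
  assumes t: "\<theta> \<in> Irr G" and j: "0 < j" "j < p" "twist (\<lambda>g. \<kappa> g ^ j) \<theta> = \<theta>" and g: "g \<in> carrier G"
  shows "\<kappa> g * \<theta> g = \<theta> g"
proof -
  have "\<kappa> g ^ j * \<theta> g = \<theta> g" using fun_cong[OF j(3), of g] g by (simp add: twist_def)
  moreover have "\<kappa> g = 1" if "\<kappa> g ^ j = 1"
    using root_of_unity_power_eq_one[OF p \<kappa>_root[OF g], of j] that j(1,2) by (metis nat_dvd_not_less)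
  ultimately show ?thesis by auto
qed

lemma vanish_off_H:
  "(\<And>g. g \<in> carrier G \<Longrightarrow> \<kappa> g * \<theta> g = \<theta> g) \<Longrightarrow> g \<in> carrier G \<Longrightarrow> g \<notin> H \<Longrightarrow> \<theta> g = 0"
  by (metis (mono_tags, lifting) H_def mem_Collect_eq mult_cancel_right1)

lemma restriction_Irr:
  assumes t: "\<theta> \<in> Irr G" and s: "\<not> (\<forall>g\<in>carrier G. \<kappa> g * \<theta> g = \<theta> g)"
  shows "restrict \<theta> H \<in> Irr K"
proof (rule K.Irr_if_norm_one)
  show "restrict \<theta> H \<in> characters K"
    by (rule characters_restrict[OF is_group H_subgroup Irr_characters[OF t]])
  have "twist (\<lambda>g. \<kappa> g ^ 0) \<theta> = \<theta>"
    using characters_ext[OF Irr_characters[OF t]] by (auto simp: twist_def fun_eq_iff extensional_def)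
  then have "twist (\<lambda>g. \<kappa> g ^ j) \<theta> = \<theta> \<longleftrightarrow> j = 0" if "j < p" for j
    using twist_eq_if[OF t _ that] s by (metis gr0I)
  then have "ip G (twist (\<lambda>g. \<kappa> g ^ j) \<theta>) \<theta> = (if j = 0 then 1 else 0)" if "j < p" for j
    using Irr_ip[OF twist_power(2)[OF t] t] that by auto
  then have "ip K \<theta> \<theta> = 1" using p_pos by (simp add: restriction_norm)
  then show "ip K (restrict \<theta> H) (restrict \<theta> H) = 1"
    using K.ip_cong[of "restrict \<theta> H" \<theta> "restrict \<theta> H" \<theta>] by simp
qed

end

lemma of_nat_sum_eq_0:
  assumes "finite A" "(\<Sum>a\<in>A. of_nat (f a)) = (0::complex)" "a \<in> A"
  shows "f a = 0"
proof -
  have "of_nat (\<Sum>a\<in>A. f a) = (0::complex)" using assms by simp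
  then have "(\<Sum>a\<in>A. f a) = 0" by (simp only: of_nat_eq_0_iff)
  then show ?thesis using assms by simp
qed

context prime_kernel
begin

lemma G_Irr_class_function: "\<theta> \<in> Irr G \<Longrightarrow> class_function G \<theta>"
  using characters_class_function[OF is_group] Irr_characters by blast

lemma ip_K_restrict: "ip K (restrict \<theta> H) f = ip K \<theta> f"
  by (rule K.ip_cong) auto

lemma ip_K_restrict': "ip K f (restrict \<theta> H) = ip K f \<theta>"
  by (rule K.ip_cong) auto

text \<open>Otherwise \<open>\<theta>\<close> vanishes off \<open>H\<close>, so its restriction induces to \<open>p\<close> times \<open>\<theta>\<close>, and \<open>Ind \<phi>\<close> is a multiple
  \<open>m \<cdot> \<theta>\<close>; its norm would give \<open>p = m\<^sup>2\<close>.\<close>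

lemma Ind_invariant_not_stable:
  assumes f: "\<phi> \<in> Irr K" "cj 1 \<phi> = \<phi>" and t: "\<theta> \<in> Irr G" and ne: "ip K \<phi> \<theta> \<noteq> 0"
  shows "\<not> (\<forall>g\<in>carrier G. \<kappa> g * \<theta> g = \<theta> g)"
proof
  assume s: "\<forall>g\<in>carrier G. \<kappa> g * \<theta> g = \<theta> g"
  have res: "restrict \<theta> H \<in> characters K"
    by (rule characters_restrict[OF is_group H_subgroup Irr_characters[OF t]])
  obtain m :: "('a \<Rightarrow> complex) \<Rightarrow> nat" where
      m0: "\<forall>g\<in>H. restrict \<theta> H g = (\<Sum>\<xi>\<in>Irr K. of_nat (m \<xi>) * \<xi> g)"
        "\<forall>\<xi>\<in>Irr K. ip K (restrict \<theta> H) \<xi> = of_nat (m \<xi>)"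
    using K.characters_decompose[OF res] by (elim exE conjE)
  note m = bspec[OF m0(1)] bspec[OF m0(2)]
  have "m \<phi> \<noteq> 0" using m(2)[OF f(1)] ne K.ip_commute[of \<theta> \<phi>] by (simp add: ip_K_restrict)
  have Indt: "Ind (restrict \<theta> H) g = of_nat p * \<theta> g" if g: "g \<in> carrier G" for g
  proof (cases "g \<in> H")
    case True
    then show ?thesis using g x class_function_conj[OF G_Irr_class_function[OF t] g]
      by (simp add: Ind_def H_conj)
  next
    case False
    then show ?thesis using g vanish_off_H[of \<theta> g] s by (simp add: Ind_def)
  qed
  have IndI: "Ind \<xi> \<in> characters G" if "\<xi> \<in> Irr K" for \<xi>
    by (rule Ind_character[OF Irr_characters[OF that]])
  have other: "ip G (Ind \<phi>) \<eta> = 0" if e: "\<eta> \<in> Irr G" "\<eta> \<noteq> \<theta>" for \<eta>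
  proof -
    note ce = G_Irr_class_function[OF e(1)]
    \<comment> \<open>By reciprocity the pairing is a multiplicity in \<open>Ind \<xi>\<close>. The
      vanishing sum below therefore has natural summands, and each of them is zero.\<close>
    have "\<exists>k::nat. ip K \<xi> \<eta> = of_nat k" if xi: "\<xi> \<in> Irr K" for \<xi>
    proof -
      obtain k :: "_ \<Rightarrow> nat" where "\<forall>\<eta>\<in>Irr G. ip G (Ind \<xi>) \<eta> = of_nat (k \<eta>)"
        using characters_decompose[OF IndI[OF xi]] by (elim exE conjE)
      then have "ip G (Ind \<xi>) \<eta> = of_nat (k \<eta>)" using e(1) by blast
      then show ?thesis using frobenius[OF ce, of \<xi>] by metis
    qed
    then obtain k :: "_ \<Rightarrow> nat" where k: "\<And>\<xi>. \<xi> \<in> Irr K \<Longrightarrow> ip K \<xi> \<eta> = of_nat (k \<xi>)" by metis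
    have "0 = of_nat p * ip G \<theta> \<eta>" using Irr_ip[OF t e(1)] e(2) by simp
    also have "\<dots> = ip G (Ind (restrict \<theta> H)) \<eta>"
      unfolding ip_scale_left[symmetric] by (rule ip_cong) (simp_all add: Indt)
    also have "\<dots> = ip K (restrict \<theta> H) \<eta>" by (rule frobenius[OF ce])
    also have "\<dots> = (\<Sum>\<xi>\<in>Irr K. of_nat (m \<xi>) * ip K \<xi> \<eta>)"
      by (rule K.ip_combination(1)) (use m(1) in simp)
    also have "\<dots> = (\<Sum>\<xi>\<in>Irr K. of_nat (m \<xi> * k \<xi>))" by (intro sum.cong) (simp_all add: k)
    finally have "(\<Sum>\<xi>\<in>Irr K. of_nat (m \<xi> * k \<xi>)) = (0::complex)" by simp
    then have "m \<phi> * k \<phi> = 0" by (rule of_nat_sum_eq_0[OF K.finite_Irr _ f(1)])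
    then have "k \<phi> = 0" using \<open>m \<phi> \<noteq> 0\<close> by simp
    then show ?thesis using k[OF f(1)] frobenius[OF ce, of \<phi>] by simp
  qed
  obtain M :: "('a \<Rightarrow> complex) \<Rightarrow> nat" where
      M0: "\<forall>g\<in>carrier G. Ind \<phi> g = (\<Sum>\<xi>\<in>Irr G. of_nat (M \<xi>) * \<xi> g)"
        "\<forall>\<xi>\<in>Irr G. ip G (Ind \<phi>) \<xi> = of_nat (M \<xi>)"
    using characters_decompose[OF IndI[OF f(1)]] by (elim exE conjE)
  note M = bspec[OF M0(1)] bspec[OF M0(2)]
  have "M \<xi> = 0" if "\<xi> \<in> Irr G" "\<xi> \<noteq> \<theta>" for \<xi> using M(2) other that by simp
  then have "(\<Sum>\<xi>\<in>Irr G. M \<xi> ^ 2) = (\<Sum>\<xi>\<in>Irr G. if \<xi> = \<theta> then M \<theta> ^ 2 else 0)"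
    by (intro sum.cong) auto
  also have "\<dots> = M \<theta> ^ 2" using t finite_Irr by simp
  finally have "of_nat p = (of_nat (M \<theta> ^ 2) :: complex)"
    using ip_self_decompose[of "Ind \<phi>" M, OF M(1)] Ind_invariant_norm[OF f] by simp
  then have "p = M \<theta> ^ 2" by (simp only: of_nat_eq_iff)
  then show False using p by (simp add: prime_power_iff)
qed

text \<open>A constituent \<open>\<theta>\<close> of \<open>Ind \<phi>\<close> is not stable under
  \<open>\<kappa>\<close>, hence restricts irreducibly, and so to \<open>\<phi>\<close>. Its
  \<open>p\<close> twists by powers of \<open>\<kappa>\<close> are distinct extensions; they add up
  to \<open>Ind \<phi>\<close> because the powers of \<open>\<kappa> g\<close> sum to
  \<open>p\<close> on \<open>H\<close> and to 0 off \<open>H\<close>.\<close>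

lemma Ind_invariant:
  assumes f: "\<phi> \<in> Irr K" and inv: "cj 1 \<phi> = \<phi>"
  obtains E where "E \<subseteq> Irr G" "finite E" "card E = p" "\<And>\<theta>. \<theta> \<in> E \<Longrightarrow> restrict \<theta> H = \<phi>"
    "\<And>g. g \<in> carrier G \<Longrightarrow> Ind \<phi> g = (\<Sum>\<theta>\<in>E. \<theta> g)"
proof -
  have "Ind \<phi> \<in> characters G" by (rule Ind_character[OF Irr_characters[OF f]])
  then obtain \<theta> where t: "\<theta> \<in> Irr G" "ip G (Ind \<phi>) \<theta> \<noteq> 0" by (rule characters_constituent)
  have ne: "ip K \<phi> \<theta> \<noteq> 0" using t frobenius[OF G_Irr_class_function[OF t(1)]] by simp
  have ns: "\<not> (\<forall>g\<in>carrier G. \<kappa> g * \<theta> g = \<theta> g)" by (rule Ind_invariant_not_stable[OF f inv t(1) ne])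
  have "restrict \<theta> H \<in> Irr K" by (rule restriction_Irr[OF t(1) ns])
  then have res: "restrict \<theta> H = \<phi>" using K.Irr_ip[OF f, of "restrict \<theta> H"] ne by (simp add: ip_K_restrict' split: if_splits)
  define T where "T j = twist (\<lambda>g. \<kappa> g ^ j) \<theta>" for j :: nat
  have ne': "T i \<noteq> T j" if ij: "i < j" "j < p" for i j
  proof
    assume e: "T i = T j"
    have "twist (\<lambda>g. \<kappa> g ^ (j - i)) \<theta> = \<theta>"
    proof (rule ext_eqI)
      fix g assume g: "g \<in> carrier G"
      have "\<kappa> g ^ j = \<kappa> g ^ i * \<kappa> g ^ (j - i)" using ij(1) by (simp flip: power_add)
      then have "\<kappa> g ^ i * \<theta> g = \<kappa> g ^ i * (\<kappa> g ^ (j - i) * \<theta> g)"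
        using fun_cong[OF e, of g] g by (simp only: T_def twist_def restrict_apply' mult.assoc)
      then show "twist (\<lambda>g. \<kappa> g ^ (j - i)) \<theta> g = \<theta> g" using \<kappa>_nonzero[OF g] g by (simp add: twist_def)
    qed (use characters_ext[OF Irr_characters[OF t(1)]] in \<open>auto simp: twist_def\<close>)
    then have "\<kappa> g * \<theta> g = \<theta> g" if "g \<in> carrier G" for g
      using twist_eq_if[OF t(1), of "j - i"] ij that by auto
    then show False using ns by blast
  qed
  have inj: "inj_on T {..<p}"
    by (rule inj_onI) (metis ne' lessThan_iff linorder_neqE_nat)
  show thesis
  proof (rule that[of "T ` {..<p}"])
    show "T ` {..<p} \<subseteq> Irr G" using twist_power(2)[OF t(1)] by (auto simp: T_def)
    show "card (T ` {..<p}) = p" by (simp add: card_image[OF inj])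
    show "restrict \<theta>' H = \<phi>" if "\<theta>' \<in> T ` {..<p}" for \<theta>'
      using that by (auto simp: T_def twist_def res[symmetric] H_def fun_eq_iff)
    show "Ind \<phi> g = (\<Sum>\<theta>\<in>T ` {..<p}. \<theta> g)" if g: "g \<in> carrier G" for g
    proof -
      have "(\<Sum>\<theta>\<in>T ` {..<p}. \<theta> g) = (\<Sum>j<p. \<kappa> g ^ j) * \<theta> g"
        unfolding sum.reindex[OF inj] using g by (simp add: T_def twist_def sum_distrib_right)
      also have "\<dots> = (if g \<in> H then of_nat p * \<theta> g else 0)"
        using g by (simp add: root_of_unity_powers_sum \<kappa>_root H_def)
      also have "\<dots> = Ind \<phi> g"
      proof (cases "g \<in> H")
        case True
        have "\<theta> g = \<phi> g" using True by (simp add: res[symmetric])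
        then show ?thesis using True cj_fixed_iterate[OF Irr_class_function[OF f] inv] by (simp add: Ind_H)
      qed (simp add: Ind_def g)
      finally show ?thesis by simp
    qed
  qed simp
qed

text \<open>A constituent \<open>\<phi>\<close> of the restriction cannot be invariant, by
  \<open>Ind_invariant_not_stable\<close>. So \<open>Ind \<phi>\<close> is irreducible, and
  reciprocity identifies it with \<open>\<theta>\<close>.\<close>

lemma stable_induced:
  assumes t: "\<theta> \<in> Irr G" and s: "\<And>g. g \<in> carrier G \<Longrightarrow> \<kappa> g * \<theta> g = \<theta> g"
  obtains \<phi> where "\<phi> \<in> Irr K" "cj 1 \<phi> \<noteq> \<phi>" "\<theta> = Ind \<phi>"
proof -
  obtain \<phi> where f: "\<phi> \<in> Irr K" "ip K (restrict \<theta> H) \<phi> \<noteq> 0"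
    using K.characters_constituent[OF characters_restrict[OF is_group H_subgroup Irr_characters[OF t]]] .
  then have ne: "ip K \<phi> \<theta> \<noteq> 0" using K.ip_commute[of \<phi> \<theta>] by (simp add: ip_K_restrict)
  have nf: "cj 1 \<phi> \<noteq> \<phi>" using Ind_invariant_not_stable[OF f(1) _ t ne] s by blast
  have "ip G (Ind \<phi>) \<theta> \<noteq> 0" using ne frobenius[OF G_Irr_class_function[OF t]] by simp
  then have "\<theta> = Ind \<phi>" using Irr_ip[OF Ind_Irr[OF f(1) nf] t] by (simp split: if_splits)
  then show thesis using that f(1) nf by blast
qed

lemma Ind_eq_conjugate:
  assumes f: "f \<in> Irr K" "cj 1 f \<noteq> f" and f': "f' \<in> Irr K" and e: "Ind f = Ind f'"
  obtains k where "f = cj k f'"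
proof -
  have "(\<Sum>k<p. ip K f (cj k f')) = 1"
    using Irr_ip[OF Ind_Irr[OF f] Ind_Irr[OF f]] e by (simp add: ip_Ind[OF Irr_characters[OF f'], symmetric])
  then obtain k where "ip K f (cj k f') \<noteq> 0"
    by (metis (no_types, lifting) sum.neutral zero_neq_one)
  then show thesis using that K.Irr_ip[OF f(1) cj_Irr[OF f']] by (simp split: if_splits)
qed

text \<open>The projection formula: \<open>\<psi>\<close> is constant on conjugates and factors out
  of the sum over conjugates.\<close>

lemma char_prod_Ind:
  assumes c: "class_function G \<psi>"
  shows "char_prod G (Ind f) \<psi> = Ind (K.twist f \<psi>)"
proof -
  have "\<psi> (x [^] i \<otimes> g \<otimes> inv (x [^] i)) = \<psi> g" if "g \<in> carrier G" for g and i :: nat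
    by (rule class_function_conj[OF c that nat_pow_closed[OF x]])
  then show ?thesis
    using x by (auto simp: char_prod_def Ind_def K.twist_def H_conj sum_distrib_right fun_eq_iff)
qed

end

section \<open>The module of linear characters\<close>

text \<open>Multiplication of nonzero complex numbers is written additively, so that \<open>cyclic_action\<close> applies to linear
  characters.\<close>

typedef cunit = "{z::complex. z \<noteq> 0}" by (rule exI[of _ 1]) simp

instantiation cunit :: ab_group_add
begin
definition "0 = Abs_cunit 1"
definition "a + b = Abs_cunit (Rep_cunit a * Rep_cunit b)"
definition "- a = Abs_cunit (inverse (Rep_cunit a))"
definition "a - b = Abs_cunit (Rep_cunit a * inverse (Rep_cunit b))"
instance
proof
  have nz: "Rep_cunit a \<noteq> 0" for a using Rep_cunit[of a] by simp
  note defs = zero_cunit_def plus_cunit_def uminus_cunit_def minus_cunit_def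
  show "a + b + c = a + (b + c)" "a + b = b + a" "0 + a = a" "- a + a = 0" "a - b = a + - b" for a b c :: cunit
    using nz by (simp_all add: defs Abs_cunit_inverse Rep_cunit_inverse mult_ac)
qed
end

lemma Rep_cunit_nonzero: "Rep_cunit a \<noteq> 0"
  using Rep_cunit[of a] by simp

lemma Rep_cunit_0: "Rep_cunit 0 = 1"
  by (simp add: zero_cunit_def Abs_cunit_inverse)

lemma Rep_cunit_add: "Rep_cunit (a + b) = Rep_cunit a * Rep_cunit b"
  by (simp add: plus_cunit_def Abs_cunit_inverse Rep_cunit_nonzero)

lemma Abs_cunit_mult: "a \<noteq> 0 \<Longrightarrow> b \<noteq> 0 \<Longrightarrow> Abs_cunit (a * b) = Abs_cunit a + Abs_cunit b"
  by (simp add: plus_cunit_def Abs_cunit_inverse)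

lemma Rep_nat_mult: "Rep_cunit (nat_mult n a) = Rep_cunit a ^ n"
  by (induct n) (auto simp: nat_mult_Suc Rep_cunit_0 Rep_cunit_add)

lemma nat_mult_fun: "nat_mult n (v :: 'a \<Rightarrow> 'm::ab_group_add) h = nat_mult n (v h)"
  by (induct n) (auto simp: nat_mult_Suc)

locale nilpotent_kernel = prime_kernel +
  assumes nil: "nilpotent_group G"
begin

text \<open>The neutral value off \<open>H\<close> makes \<open>X\<close> additive on all functions
  and compatible with \<open>lift\<close>, so that equality of vectors is equality on
  \<open>H\<close>.\<close>

definition X :: "('a \<Rightarrow> cunit) \<Rightarrow> 'a \<Rightarrow> cunit" where
  "X v h = (if h \<in> H then v (x \<otimes> h \<otimes> inv x) else 0)"

sublocale A: cyclic_action X p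
  by unfold_locales (auto simp: X_def fun_eq_iff p)

text \<open>Homomorphisms from \<open>H\<close> to the nonzero complex numbers, extended by the
  neutral value; they are closed under \<open>Y\<close>, so the nilpotency argument can iterate
  without returning to characters.\<close>

definition additive :: "('a \<Rightarrow> cunit) \<Rightarrow> bool" where
  "additive v \<longleftrightarrow> (\<forall>h\<in>H. \<forall>h'\<in>H. v (h \<otimes> h') = v h + v h') \<and> (\<forall>h. h \<notin> H \<longrightarrow> v h = 0)"

definition linear :: "('a \<Rightarrow> complex) \<Rightarrow> bool" where
  "linear f \<longleftrightarrow> f \<in> characters K \<and> f \<one> = 1"

definition lift :: "('a \<Rightarrow> complex) \<Rightarrow> 'a \<Rightarrow> cunit" where
  "lift f h = (if h \<in> H then Abs_cunit (f h) else 0)"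

lemma linear_Irr: "linear f \<Longrightarrow> f \<in> Irr K"
  using K.linear_character_Irr by (simp add: linear_def)

lemma linear_class_function: "linear f \<Longrightarrow> class_function K f"
  using linear_Irr Irr_class_function by blast

lemma linear_nonzero: "linear f \<Longrightarrow> h \<in> H \<Longrightarrow> f h \<noteq> 0"
  using K.linear_character_nonzero by (simp add: linear_def)

lemma linear_mult: "linear f \<Longrightarrow> h \<in> H \<Longrightarrow> h' \<in> H \<Longrightarrow> f (h \<otimes> h') = f h * f h'"
  using K.linear_character_mult by (simp add: linear_def)

lemma linear_cj: "linear f \<Longrightarrow> linear (cj k f)"
  using cj_character x by (simp add: linear_def cj_def)

lemma linear_twist: "linear f \<Longrightarrow> linear f' \<Longrightarrow> linear (K.twist f f')"
  using K.twist_character(1)[of f f'] linear_mult by (simp add: linear_def K.twist_def)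

lemma lift_inj: "linear f \<Longrightarrow> linear f' \<Longrightarrow> lift f = lift f' \<longleftrightarrow> f = f'"
proof
  assume l: "linear f" "linear f'" and e: "lift f = lift f'"
  show "f = f'"
  proof (rule K.ext_eqI)
    fix h assume "h \<in> H"
    then show "f h = f' h" using fun_cong[OF e, of h] linear_nonzero l by (simp add: lift_def Abs_cunit_inject)
  qed (use l K.characters_ext in \<open>auto simp: linear_def\<close>)
qed simp

lemma lift_twist: "linear f \<Longrightarrow> linear f' \<Longrightarrow> lift (K.twist f f') = lift f + lift f'"
  by (auto simp: lift_def K.twist_def fun_eq_iff Abs_cunit_mult linear_nonzero)

lemma lift_cj1: "linear f \<Longrightarrow> lift (cj 1 f) = X (lift f)"
  using x by (auto simp: lift_def X_def cj_def fun_eq_iff H_conj)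

lemma lift_cj: "linear f \<Longrightarrow> lift (cj k f) = (X ^^ k) (lift f)"
proof (induct k)
  case 0
  then show ?case using cj_0 linear_class_function by simp
next
  case (Suc k)
  have "lift (cj (Suc k) f) = lift (cj 1 (cj k f))" by (simp add: cj_add)
  also have "\<dots> = X (lift (cj k f))" using lift_cj1 linear_cj Suc by blast
  finally show ?case using Suc by simp
qed

lemma additive_lift: "linear f \<Longrightarrow> additive (lift f)"
  using K.m_closed by (auto simp: additive_def lift_def linear_mult Abs_cunit_mult linear_nonzero)

lemma additive_one: "additive v \<Longrightarrow> v \<one> = 0"
proof -
  assume "additive v"
  then have "v (\<one> \<otimes> \<one>) = v \<one> + v \<one>" using K.one_closed unfolding additive_def by blast
  then show ?thesis by simp
qed

lemma additive_Y_eq: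
  assumes v: "additive v" and h: "h \<in> H"
  shows "A.Y v h = v (x \<otimes> h \<otimes> inv x \<otimes> inv h)"
proof -
  have ih: "inv h \<in> H" using h K.inv_closed K_inv by metis
  have c: "x \<otimes> h \<otimes> inv x \<in> H" using h x by (rule H_conj)
  have "v h + v (inv h) = 0"
    using v h ih additive_one[OF v] unfolding additive_def by (metis H_carrier r_inv)
  then have "v (inv h) = - v h" by (simp add: eq_neg_iff_add_eq_0 add.commute)
  moreover have "v (x \<otimes> h \<otimes> inv x \<otimes> inv h) = v (x \<otimes> h \<otimes> inv x) + v (inv h)"
    using v c ih unfolding additive_def by blast
  ultimately show ?thesis using h by (simp add: A.Y_def X_def)
qed

lemma additive_Y:
  assumes v: "additive v"
  shows "additive (A.Y v)"
proof -
  have "X v (h \<otimes> h') = X v h + X v h'" if "h \<in> H" "h' \<in> H" for h h'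
  proof -
    have "v ((x \<otimes> h \<otimes> inv x) \<otimes> (x \<otimes> h' \<otimes> inv x)) = v (x \<otimes> h \<otimes> inv x) + v (x \<otimes> h' \<otimes> inv x)"
      using v that x H_conj unfolding additive_def by blast
    then show ?thesis using that x by (simp add: X_def conj_mult H_carrier)
  qed
  then show ?thesis using v by (auto simp: additive_def A.Y_def X_def algebra_simps)
qed

text \<open>\<open>(Y v) h\<close> is the value of \<open>v\<close> on a commutator of \<open>h\<close>, so \<open>Y\<close> moves the vanishing of \<open>v\<close> up the
  lower central series.\<close>

lemma Y_nilpotent:
  "\<exists>n. \<forall>v. additive v \<longrightarrow> (A.Y ^^ n) v = 0"
proof -
  obtain c where c: "lower_central G c = {\<one>}" using nil by (auto simp: nilpotent_group_def)
  have "(A.Y ^^ n) v = 0" if "additive v" "\<forall>h\<in>H \<inter> lower_central G n. v h = 0" for n v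
    using that
  proof (induct n arbitrary: v)
    case 0
    then show ?case using H_carrier by (auto simp: additive_def fun_eq_iff)
  next
    case (Suc n)
    have "A.Y v h = 0" if h: "h \<in> H" "h \<in> lower_central G n" for h
    proof -
      let ?c = "h \<otimes> x \<otimes> inv h \<otimes> inv x"
      have hc: "h \<in> carrier G" using h by (simp add: H_carrier)
      \<comment> \<open>The lower central series contains the commutator \<open>?c\<close>, while
        \<open>Y\<close> evaluates at its inverse; additivity moves the vanishing from one to the
        other.\<close>
      have e: "x \<otimes> h \<otimes> inv x \<otimes> inv h = inv ?c" using hc x by (simp add: inv_mult_group m_assoc)
      have ih: "inv h \<in> H" using h K.inv_closed K_inv by metis
      have "x \<otimes> h \<otimes> inv x \<otimes> inv h \<in> H" using H_conj[OF h(1) x] ih K.m_closed by simp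
      then have "inv ?c \<in> H" using e by simp
      then have cH: "?c \<in> H" using K.inv_closed[of "inv ?c"] hc x by (simp add: K_inv)
      have "?c \<in> lower_central G (Suc n)" using h x by (auto intro!: generate.incl)
      then have "v ?c = 0" using Suc.prems(2) cH by blast
      moreover have "v ?c + v (inv ?c) = 0"
        using Suc.prems(1) cH \<open>inv ?c \<in> H\<close> additive_one[OF Suc.prems(1)] hc x unfolding additive_def
        by (metis H_carrier r_inv)
      ultimately show ?thesis using additive_Y_eq[OF Suc.prems(1) h(1)] e by simp
    qed
    then have "(A.Y ^^ n) (A.Y v) = 0" using Suc.hyps[OF additive_Y[OF Suc.prems(1)]] by blast
    then show ?case by (simp add: A.Yn_Y)
  qed
  from this[of _ c] show ?thesis using c additive_one by auto
qed

lemma lift_unipotent: "linear f \<Longrightarrow> lift f \<in> A.unipotent"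
  using Y_nilpotent additive_lift lift_cj[of f p] cj_p[OF linear_class_function] by (fastforce simp: A.unipotent_def)

end

section \<open>Products of characters of prime degree\<close>

text \<open>Fibres of size at most two give \<open>p \<le> 2 * m\<close> for the number
  \<open>m\<close> of values. For odd \<open>p\<close> parity improves this by one; for
  \<open>p = 2\<close> a map that is not constant has two values.\<close>

lemma card_image_two_to_one:
  fixes f :: "nat \<Rightarrow> 'b"
  assumes p: "prime p" and f: "(\<forall>i<p. f i = f 0) \<or> (\<forall>i<p. card {j. j < p \<and> f j = f i} \<le> 2)"
  shows "(\<forall>i<p. f i = f 0) \<or> p + 1 \<le> 2 * card (f ` {..<p})"
proof (cases "\<forall>i<p. f i = f 0")
  case False
  then have two: "card {j. j < p \<and> f j = f i} \<le> 2" if "i < p" for i using f that by blast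
  let ?m = "card (f ` {..<p})"
  obtain i where i: "i < p" "f i \<noteq> f 0" using False by blast
  have "card {f 0, f i} \<le> ?m" using i by (intro card_mono) auto
  then have m2: "?m \<ge> 2" using i by simp
  have "p = (\<Sum>i<p. 1)" by simp
  also have "\<dots> = (\<Sum>y\<in>f ` {..<p}. \<Sum>j\<in>{j \<in> {..<p}. f j = y}. 1)" by (rule sum.group[symmetric]) auto
  also have "\<dots> \<le> (\<Sum>y\<in>f ` {..<p}. 2)"
  proof (rule sum_mono)
    fix y assume "y \<in> f ` {..<p}"
    then obtain i where "i < p" "y = f i" by blast
    then show "(\<Sum>j\<in>{j \<in> {..<p}. f j = y}. 1) \<le> (2::nat)" using two[of i] by simp
  qed
  finally have le: "p \<le> 2 * ?m" by simp
  show ?thesis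
  proof (cases "p = 2")
    case False
    then have "odd p" using p primes_dvd_imp_eq[OF two_is_prime_nat p] by blast
    then have "p \<noteq> 2 * k" for k by auto
    from this[of ?m] have "p + 1 \<le> 2 * ?m" using le by linarith
    then show ?thesis ..
  next
    case True
    then have "p + 1 \<le> 2 * ?m" using m2 by linarith
    then show ?thesis ..
  qed
next
  case True
  then show ?thesis ..
qed

context finite_grp
begin

text \<open>Allowing repetitions in \<open>f\<close> lets this serve both sources of the third
  alternative: coinciding induced characters and the \<open>p\<close> distinct extensions of an
  invariant character.\<close>

lemma sum_of_degree_p_constituents:
  assumes p: "prime p" and f: "\<And>i. i < p \<Longrightarrow> f i \<in> Irr G" "\<And>i. i < p \<Longrightarrow> f i \<one> = of_nat p"
    and phi: "\<phi> = (\<lambda>g\<in>carrier G. \<Sum>i<p. f i g)"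
    and two: "(\<forall>i<p. f i = f 0) \<or> (\<forall>i<p. card {j. j < p \<and> f j = f i} \<le> 2)"
  shows "\<forall>\<theta>\<in>irr_constituents G \<phi>. \<theta> \<one> = of_nat p"
    and "multiple_of_irreducible G \<phi> \<or> (real p + 1) / 2 \<le> real (eta G \<phi>) \<and> eta G \<phi> \<le> p"
    and "eta G \<phi> = 1 \<or> (real p + 1) / 2 \<le> real (eta G \<phi>) \<and> eta G \<phi> \<le> p"
proof -
  have p0: "0 < p" using p by (rule prime_gt_0_nat)
  have c: "irr_constituents G \<phi> = f ` {..<p}"
    by (rule irr_constituents_sum[OF _ _ phi]) (use f in auto)
  show "\<forall>\<theta>\<in>irr_constituents G \<phi>. \<theta> \<one> = of_nat p" using f(2) by (auto simp: c)
  have eta: "eta G \<phi> = card (f ` {..<p})" by (simp add: eta_def c)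
  have le: "eta G \<phi> \<le> p" using card_image_le[of "{..<p}" f] by (simp add: eta)
  have "(\<forall>i<p. f i = f 0) \<or> p + 1 \<le> 2 * eta G \<phi>" unfolding eta by (rule card_image_two_to_one[OF p two])
  then have "(multiple_of_irreducible G \<phi> \<and> eta G \<phi> = 1) \<or> (real p + 1) / 2 \<le> real (eta G \<phi>)"
  proof
    assume all: "\<forall>i<p. f i = f 0"
    have "(\<Sum>i<p. f i g) = (\<Sum>i<p. f 0 g)" for g
      by (rule sum.cong[OF refl], rule fun_cong[OF all[rule_format]]) simp
    then have "\<phi> = (\<lambda>g\<in>carrier G. of_nat p * f 0 g)" unfolding phi by simp
    then have mult: "multiple_of_irreducible G \<phi>" unfolding multiple_of_irreducible_def using f(1)[OF p0] p0 by blast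
    have "f ` {..<p} = (\<lambda>_. f 0) ` {..<p}"
      by (rule image_cong[OF refl], rule all[rule_format]) simp
    moreover have "{..<p} \<noteq> {}" using p0 by auto
    ultimately have "eta G \<phi> = 1" by (simp add: eta image_constant_conv)
    then show ?thesis using mult by blast
  next
    assume "p + 1 \<le> 2 * eta G \<phi>"
    then have "real (p + 1) \<le> real (2 * eta G \<phi>)" by (simp only: of_nat_le_iff)
    then have "(real p + 1) / 2 \<le> real (eta G \<phi>)" by simp
    then show ?thesis by blast
  qed
  then show "multiple_of_irreducible G \<phi> \<or> (real p + 1) / 2 \<le> real (eta G \<phi>) \<and> eta G \<phi> \<le> p"
    and "eta G \<phi> = 1 \<or> (real p + 1) / 2 \<le> real (eta G \<phi>) \<and> eta G \<phi> \<le> p" using le by blast+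
qed

end

context nilpotent_kernel
begin

text \<open>The last nonzero iterate \<open>w\<close> of \<open>Y\<close> on the lift of \<open>\<mu>\<close> has order \<open>p\<close> and is trivial where \<open>\<psi>\<close>
  does not vanish. So the restriction of \<open>\<psi>\<close> to \<open>H\<close> is stable under the linear character \<open>w\<close>, hence induced
  from the kernel of \<open>w\<close>.\<close>

lemma prime_dvd_degree:
  assumes l: "linear \<mu>" "cj 1 \<mu> \<noteq> \<mu>" and psi: "\<psi> \<in> Irr G" "restrict \<psi> H \<in> Irr K" "\<psi> \<one> = of_nat q"
    and inv: "cj 1 (K.twist \<mu> \<psi>) = K.twist \<mu> \<psi>"
  shows "p dvd q"
proof -
  define u where "u = lift \<mu>"
  have ud: "u \<in> A.unipotent" using lift_unipotent[OF l(1)] by (simp add: u_def)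
  have "X u \<noteq> u" using l lift_cj1[OF l(1)] lift_inj[OF linear_cj[OF l(1)] l(1)] by (metis u_def)
  then have Yu: "A.Y u \<noteq> 0" by (simp add: A.Y_eq_0)
  have psi_conj: "\<psi> (x \<otimes> h \<otimes> inv x) = \<psi> h" if "h \<in> H" for h
    using class_function_conj[OF G_Irr_class_function[OF psi(1)] H_carrier[OF that] x] .
  \<comment> \<open>Where \<open>\<psi>\<close> does not vanish it cancels from the invariance of
    the product, leaving invariance of \<open>\<mu>\<close>.\<close>
  have base: "A.Y u h = 0" if h: "h \<in> H" "\<psi> h \<noteq> 0" for h
  proof -
    have "K.twist \<mu> \<psi> (x \<otimes> h \<otimes> inv x) = K.twist \<mu> \<psi> h"
      using fun_cong[OF inv, of h] h x by (simp add: cj_def)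
    then have "\<mu> (x \<otimes> h \<otimes> inv x) = \<mu> h" using h x by (simp add: K.twist_def H_conj psi_conj)
    then show ?thesis using h x by (simp add: A.Y_def X_def u_def lift_def H_conj)
  qed
  \<comment> \<open>The support of \<open>\<psi>\<close> is stable under conjugation by
    \<open>x\<close>, so all further iterates of \<open>Y\<close> also vanish on it.\<close>
  have supp: "(A.Y ^^ n) (A.Y u) h = 0" if "h \<in> H" "\<psi> h \<noteq> 0" for n h
    using that
  proof (induct n arbitrary: h)
    case (Suc n)
    have "A.Y v h = v (x \<otimes> h \<otimes> inv x) - v h" for v using Suc.prems by (simp add: A.Y_def X_def)
    then show ?case using Suc x by (simp add: H_conj psi_conj)
  qed (simp add: base)
  have "\<exists>n. (A.Y ^^ n) (A.Y u) = 0" using A.unipotent_Y[OF ud] by (auto simp: A.unipotent_def)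
  then obtain n where n: "(A.Y ^^ n) (A.Y u) \<noteq> 0" "(A.Y ^^ Suc n) (A.Y u) = 0"
    using Yu exists_least_lemma[of "\<lambda>n. (A.Y ^^ n) (A.Y u) = 0"] by auto
  define w where "w = (A.Y ^^ n) (A.Y u)"
  have wY: "w = A.Y ((A.Y ^^ n) u)" by (simp add: w_def A.Yn_Y)
  have "A.Y w = 0" using n(2) by (simp add: w_def)
  then have Xw: "X w = w" by (simp add: A.Y_eq_0)
  have "A.bracket p w = 0"
    using ud by (simp add: wY A.bracket_Y A.unipotent_def A.Yn_Xm[symmetric])
  then have pw: "nat_mult p w = 0" using A.bracket_fixed[OF Xw] by simp
  have aw: "additive w"
  proof -
    have "additive ((A.Y ^^ k) u)" for k
      by (induct k) (auto simp: additive_Y additive_lift[OF l(1)] u_def)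
    then show ?thesis using additive_Y by (simp add: wY)
  qed
  have "\<exists>h\<in>H. w h \<noteq> 0"
  proof (rule ccontr)
    assume "\<not> (\<exists>h\<in>H. w h \<noteq> 0)"
    then have "w h = 0" for h using aw unfolding additive_def by blast
    then have "w = 0" by (simp add: fun_eq_iff)
    then show False using n(1) by (simp add: w_def)
  qed
  then obtain h0 where h0: "h0 \<in> H" "w h0 \<noteq> 0" by blast
  define \<kappa>' where "\<kappa>' h = Rep_cunit (w h)" for h
  \<comment> \<open>The theory of a kernel of prime index again, now for the group \<open>K\<close>
    and the linear character \<open>\<kappa>'\<close> of order \<open>p\<close>.\<close>
  interpret P: prime_kernel K p \<kappa>' h0
  proof (rule prime_kernel.intro[OF K_grp prime_kernel_axioms.intro])
    show "\<kappa>' (g \<otimes>\<^bsub>K\<^esub> h) = \<kappa>' g * \<kappa>' h" if "g \<in> carrier K" "h \<in> carrier K" for g h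
      using aw that by (simp add: additive_def \<kappa>'_def Rep_cunit_add)
    show "\<kappa>' g ^ p = 1" if "g \<in> carrier K" for g
      using fun_cong[OF pw, of g] by (simp add: \<kappa>'_def Rep_nat_mult[symmetric] nat_mult_fun Rep_cunit_0)
    show "\<kappa>' h0 \<noteq> 1" using h0(2) by (metis \<kappa>'_def Rep_cunit_0 Rep_cunit_inject)
    show "h0 \<in> carrier K" using h0(1) by simp
  qed (rule p)
  have "\<kappa>' g * restrict \<psi> H g = restrict \<psi> H g" if "g \<in> carrier K" for g
    using supp[of g n] that by (cases "\<psi> g = 0") (auto simp: \<kappa>'_def w_def Rep_cunit_0)
  then obtain \<phi> where \<phi>: "\<phi> \<in> Irr P.K" "restrict \<psi> H = P.Ind \<phi>" using P.stable_induced[OF psi(2)] by metis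
  obtain d where "\<phi> \<one>\<^bsub>P.K\<^esub> = of_nat d"
    using characters_degree[OF P.K.is_group Irr_characters[OF \<phi>(1)]] by metis
  then have "restrict \<psi> H \<one> = of_nat p * of_nat d" using P.Ind_one[of \<phi>] \<phi>(2) by simp
  then have "of_nat q = (of_nat (p * d) :: complex)" using psi(3) K.one_closed by simp
  then have "q = p * d" by (simp only: of_nat_eq_iff)
  then show ?thesis by simp
qed

lemma linear_lift_fixed:
  assumes "linear f"
  shows "cj 1 f = f \<longleftrightarrow> X (lift f) = lift f"
  unfolding lift_cj1[OF assms, symmetric] using lift_inj[OF linear_cj[OF assms] assms] by simp

text \<open>The irreducible \<open>K.twist \<mu> \<psi>\<close> fails to induce irreducibly only if
  it is invariant. Then \<open>p\<close> divides the prime \<open>q\<close>, so its extensions,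
  which have degree \<open>q\<close>, have degree \<open>p\<close>.\<close>

lemma product_if_restriction_irreducible:
  assumes l: "linear \<mu>" "cj 1 \<mu> \<noteq> \<mu>" and psi: "\<psi> \<in> Irr G" "restrict \<psi> H \<in> Irr K"
    and q: "\<psi> \<one> = of_nat q" "prime q" and n: "char_prod G (Ind \<mu>) \<psi> \<notin> Irr G"
  shows "\<exists>E. E \<subseteq> Irr G \<and> card E = p \<and> (\<forall>\<theta>\<in>E. \<theta> \<one> = of_nat p) \<and>
    char_prod G (Ind \<mu>) \<psi> = (\<lambda>g\<in>carrier G. \<Sum>\<theta>\<in>E. \<theta> g)"
proof -
  let ?f = "K.twist \<mu> \<psi>"
  have e: "char_prod G (Ind \<mu>) \<psi> = Ind ?f" by (rule char_prod_Ind[OF G_Irr_class_function[OF psi(1)]])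
  have "K.twist \<mu> (restrict \<psi> H) = ?f" by (auto simp: K.twist_def fun_eq_iff)
  moreover have "\<mu> \<one> = 1" using l(1) by (simp add: linear_def)
  ultimately have f: "?f \<in> Irr K" using K.twist_character(2)[of \<mu> "restrict \<psi> H"] linear_mult[OF l(1)] psi(2) by simp
  have inv: "cj 1 ?f = ?f" using Ind_Irr[OF f] n e by auto
  have "p dvd q" by (rule prime_dvd_degree[OF l psi q(1) inv])
  then have "p = q" using p q(2) by (simp add: primes_dvd_imp_eq)
  obtain E where E: "E \<subseteq> Irr G" "card E = p" "\<And>\<theta>. \<theta> \<in> E \<Longrightarrow> restrict \<theta> H = ?f"
    "\<And>g. g \<in> carrier G \<Longrightarrow> Ind ?f g = (\<Sum>\<theta>\<in>E. \<theta> g)" using Ind_invariant[OF f inv] by metis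
  have "\<theta> \<one> = of_nat p" if "\<theta> \<in> E" for \<theta>
    using fun_cong[OF E(3)[OF that], of \<one>] K.one_closed \<open>\<mu> \<one> = 1\<close> q(1) \<open>p = q\<close> by (simp add: K.twist_def)
  moreover have "char_prod G (Ind \<mu>) \<psi> = (\<lambda>g\<in>carrier G. \<Sum>\<theta>\<in>E. \<theta> g)"
  proof (rule ext_eqI)
    show "char_prod G (Ind \<mu>) \<psi> g = (\<lambda>g\<in>carrier G. \<Sum>\<theta>\<in>E. \<theta> g) g" if "g \<in> carrier G" for g
      using E(4) that by (simp add: e)
  qed (auto simp: char_prod_def)
  ultimately show ?thesis using E(1,2) by blast
qed

text \<open>The alternatives correspond to all, exactly one or none of the \<open>\<nu> i\<close>
  being fixed. A fixed one contributes \<open>p\<close> linear extensions, any other an irreducible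
  character of degree \<open>p\<close>. The last alternative keeps a list with possible repetitions,
  to be counted afterwards.\<close>

lemma product_of_induced_linear:
  assumes l: "linear \<alpha>" "cj 1 \<alpha> \<noteq> \<alpha>" and m: "linear \<mu>" "cj 1 \<mu> \<noteq> \<mu>"
  defines "\<phi> \<equiv> char_prod G (Ind \<alpha>) (Ind \<mu>)"
  shows "(\<exists>L \<subseteq> linear_characters G. card L = p^2 \<and> \<phi> = char_sum G L)
   \<or> (\<exists>L \<subseteq> linear_characters G. \<exists>D \<subseteq> {\<theta> \<in> Irr G. \<theta> \<one> = of_nat p}.
        card L = p \<and> card D = p - 1 \<and> \<phi> = char_sum G (L \<union> D))
   \<or> (\<exists>f. (\<forall>i<p. f i \<in> Irr G) \<and> (\<forall>i<p. f i \<one> = of_nat p) \<and> \<phi> = (\<lambda>g\<in>carrier G. \<Sum>i<p. f i g) \<and>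
        ((\<forall>i<p. f i = f 0) \<or> (\<forall>i<p. card {j. j < p \<and> f j = f i} \<le> 2)))"
proof -
  define \<nu> where "\<nu> i = K.twist \<alpha> (cj i \<mu>)" for i
  define F where "F i = Ind (\<nu> i)" for i
  let ?l = "lift \<alpha>" and ?m = "lift \<mu>"
  have lin: "linear (\<nu> i)" for i unfolding \<nu>_def by (rule linear_twist[OF l(1) linear_cj[OF m(1)]])
  have lift_nu: "lift (\<nu> i) = ?l + (X ^^ i) ?m" for i
    unfolding \<nu>_def using lift_twist[OF l(1) linear_cj[OF m(1)]] lift_cj[OF m(1)] by simp
  have ld: "?l \<in> A.unipotent" and md: "?m \<in> A.unipotent" using lift_unipotent l m by blast+
  have fixed: "cj 1 (\<nu> i) = \<nu> i \<longleftrightarrow> X (?l + (X ^^ i) ?m) = ?l + (X ^^ i) ?m" for i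
    using linear_lift_fixed[OF lin] by (simp add: lift_nu)
  have nu_one: "\<nu> i \<one> = 1" for i using lin by (simp add: linear_def)
  \<comment> \<open>After cancelling the lift of \<open>\<alpha>\<close>, a coincidence makes a
    power \<open>x [^] (j - i)\<close> with \<open>0 < j - i < p\<close> fix \<open>\<mu>\<close>,
    and then \<open>x\<close> fixes it.\<close>
  have mneq: "\<nu> i \<noteq> \<nu> j" if ij: "i < j" "j < p" for i j
  proof
    assume e: "\<nu> i = \<nu> j"
    have "(X ^^ i) ?m = (X ^^ j) ?m" using lift_nu[of i] lift_nu[of j] e by simp
    then have "(X ^^ (p - i)) ((X ^^ i) ?m) = (X ^^ (p - i)) ((X ^^ j) ?m)" by simp
    then have "(X ^^ p) ?m = (X ^^ (p + (j - i))) ?m" using ij by (simp add: A.Xn_Xm)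
    moreover have "(X ^^ (p + (j - i))) ?m = (X ^^ (j - i)) ?m"
      by (rule A.Xn_cong[OF md]) (simp add: cong_def)
    ultimately have "(X ^^ (j - i)) ?m = ?m" using md by (simp add: A.unipotent_def)
    then have "lift (cj (j - i) \<mu>) = lift \<mu>" by (simp add: lift_cj[OF m(1)])
    then have "cj (j - i) \<mu> = \<mu>" using lift_inj[OF linear_cj[OF m(1)] m(1)] by blast
    then show False using cj_fixed_if[OF linear_class_function[OF m(1)], of "j - i"] ij m(2) by auto
  qed
  have nu_inj: "inj_on \<nu> {..<p}" by (rule inj_onI) (metis mneq lessThan_iff linorder_neqE_nat)
  have phi: "\<phi> = (\<lambda>g\<in>carrier G. \<Sum>i<p. F i g)"
  proof (rule ext_eqI)
    fix g assume g: "g \<in> carrier G"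
    have e: "\<phi> = Ind (K.twist \<alpha> (Ind \<mu>))"
      unfolding \<phi>_def using m linear_Irr
      by (intro char_prod_Ind G_Irr_class_function Ind_Irr) auto
    show "\<phi> g = (\<lambda>g\<in>carrier G. \<Sum>i<p. F i g) g"
    proof (cases "g \<in> H")
      case True
      have "cj k (K.twist \<alpha> (Ind \<mu>)) g = (\<Sum>i<p. cj k (\<nu> i) g)" for k
        using True x by (simp add: cj_def[of k] K.twist_def H_conj Ind_H \<nu>_def sum_distrib_left)
      then have "\<phi> g = (\<Sum>k<p. \<Sum>i<p. cj k (\<nu> i) g)" using True by (simp add: e Ind_H)
      also have "\<dots> = (\<Sum>i<p. F i g)" using True by (subst sum.swap) (simp add: F_def Ind_H)
      finally show ?thesis using g by simp
    qed (use g in \<open>simp add: e F_def Ind_def\<close>)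
  qed (auto simp: \<phi>_def char_prod_def)
  have F_Irr: "F i \<in> Irr G" if "cj 1 (\<nu> i) \<noteq> \<nu> i" for i
    unfolding F_def by (rule Ind_Irr[OF linear_Irr[OF lin] that])
  have F_one: "F i \<one> = of_nat p" for i by (simp add: F_def Ind_one nu_one)
  have ext: "\<exists>E. E \<subseteq> linear_characters G \<and> finite E \<and> card E = p \<and> (\<forall>\<theta>\<in>E. restrict \<theta> H = \<nu> i) \<and>
      (\<forall>g\<in>carrier G. F i g = (\<Sum>\<theta>\<in>E. \<theta> g))" if inv: "cj 1 (\<nu> i) = \<nu> i" for i
  proof -
    obtain E where E: "E \<subseteq> Irr G" "finite E" "card E = p" "\<And>\<theta>. \<theta> \<in> E \<Longrightarrow> restrict \<theta> H = \<nu> i"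
      "\<And>g. g \<in> carrier G \<Longrightarrow> F i g = (\<Sum>\<theta>\<in>E. \<theta> g)"
      unfolding F_def using Ind_invariant[OF linear_Irr[OF lin] inv] by metis
    have "\<theta> \<one> = 1" if "\<theta> \<in> E" for \<theta>
      using fun_cong[OF E(4)[OF that], of \<one>] K.one_closed by (simp add: nu_one)
    then have "E \<subseteq> linear_characters G" using E(1) Irr_characters by (auto simp: linear_characters_def)
    then show ?thesis using E by blast
  qed
  consider (all) "\<forall>i<p. cj 1 (\<nu> i) = \<nu> i"
    | (one) i0 i1 where "i0 < p" "cj 1 (\<nu> i0) = \<nu> i0" "i1 < p" "cj 1 (\<nu> i1) \<noteq> \<nu> i1"
    | (none) "\<forall>i<p. cj 1 (\<nu> i) \<noteq> \<nu> i" by blast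
  then show ?thesis
  proof cases
    case all
    then obtain E where E: "\<And>i. i < p \<Longrightarrow> E i \<subseteq> linear_characters G \<and> finite (E i) \<and> card (E i) = p \<and>
       (\<forall>\<theta>\<in>E i. restrict \<theta> H = \<nu> i) \<and> (\<forall>g\<in>carrier G. F i g = (\<Sum>\<theta>\<in>E i. \<theta> g))"
      using ext by metis
    let ?L = "\<Union>i<p. E i"
    \<comment> \<open>Members of different \<open>E i\<close> have different restrictions to
      \<open>H\<close>.\<close>
    have disj: "E i \<inter> E j = {}" if "i < p" "j < p" "i \<noteq> j" for i j
    proof (rule ccontr)
      assume "E i \<inter> E j \<noteq> {}"
      then obtain \<theta> where "\<theta> \<in> E i" "\<theta> \<in> E j" by blast
      then have "\<nu> i = \<nu> j" using E that by metis
      then show False using nu_inj that by (auto simp: inj_on_def)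
    qed
    have "card ?L = (\<Sum>i<p. card (E i))" using E disj by (intro card_UN_disjoint) auto
    then have "card ?L = p^2" using E by (simp add: power2_eq_square)
    moreover have "\<phi> = char_sum G ?L"
    proof -
      have "(\<Sum>\<theta>\<in>?L. \<theta> g) = (\<Sum>i<p. \<Sum>\<theta>\<in>E i. \<theta> g)" for g :: 'a
        using E disj by (intro sum.UNION_disjoint) auto
      then show ?thesis unfolding phi char_sum_def using E by (intro restrict_ext) simp
    qed
    moreover have "?L \<subseteq> linear_characters G" using E by blast
    ultimately show ?thesis by blast
  next
    case one
    have noninv: "cj 1 (\<nu> i) \<noteq> \<nu> i" if i: "i < p" "i \<noteq> i0" for i
    proof
      assume "cj 1 (\<nu> i) = \<nu> i"
      then have "cj 1 (\<nu> i1) = \<nu> i1"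
        using A.all_fixed_if_two_fixed[OF md i(1) one(1) i(2)] one(2) unfolding fixed by blast
      then show False using one by simp
    qed
    \<comment> \<open>Equal induced characters come from conjugate linear ones, which the presence
      of exactly one fixed vector excludes.\<close>
    have nonconj: "F i \<noteq> F j" if ij: "i < p" "j < p" "i \<noteq> i0" "j \<noteq> i0" "i \<noteq> j" for i j
    proof
      assume "F i = F j"
      then obtain k where k: "\<nu> i = cj k (\<nu> j)"
        using Ind_eq_conjugate[OF linear_Irr[OF lin] noninv[OF ij(1,3)] linear_Irr[OF lin]] unfolding F_def by metis
      have "(X ^^ k) (?l + (X ^^ j) ?m) = ?l + (X ^^ i) ?m"
        using lift_cj[OF lin, of k j] unfolding k[symmetric] lift_nu by (rule sym)
      then show False
        using A.nonconjugate_if_one_fixed[OF md one(1) ij(2,1) ij(5)[symmetric]] one(2,4) unfolding fixed by blast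
    qed
    obtain L where L: "L \<subseteq> linear_characters G" "finite L" "card L = p"
        "\<forall>g\<in>carrier G. F i0 g = (\<Sum>\<theta>\<in>L. \<theta> g)" using ext[OF one(2)] by blast
    let ?I = "{..<p} - {i0}"
    have inj: "inj_on F ?I" using nonconj by (auto simp: inj_on_def)
    have cD: "card (F ` ?I) = p - 1" using one(1) by (simp add: card_image[OF inj])
    have D: "F ` ?I \<subseteq> {\<theta> \<in> Irr G. \<theta> \<one> = of_nat p}" using F_Irr noninv F_one by auto
    have "L \<inter> F ` ?I = {}"
    proof (rule ccontr)
      assume "L \<inter> F ` ?I \<noteq> {}"
      then obtain \<theta> where "\<theta> \<in> L" "\<theta> \<in> F ` ?I" by blast
      then have "\<theta> \<one> = 1" "\<theta> \<one> = of_nat p" using L(1) D unfolding linear_characters_def by blast+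
      then have "of_nat p = (of_nat 1 :: complex)" by simp
      then have "p = 1" by (simp only: of_nat_eq_iff)
      then show False using p by simp
    qed
    then have s: "(\<Sum>\<theta>\<in>L \<union> F ` ?I. \<theta> g) = (\<Sum>\<theta>\<in>L. \<theta> g) + (\<Sum>i\<in>?I. F i g)" for g
      using L(2) by (simp add: sum.union_disjoint sum.reindex[OF inj])
    have "\<phi> = char_sum G (L \<union> F ` ?I)"
      unfolding phi char_sum_def
    proof (intro restrict_ext)
      fix g assume g: "g \<in> carrier G"
      have "(\<Sum>i<p. F i g) = F i0 g + (\<Sum>i\<in>?I. F i g)" using one(1) by (intro sum.remove) auto
      then show "(\<Sum>i<p. F i g) = (\<Sum>\<theta>\<in>L \<union> F ` ?I. \<theta> g)" using L(4) g by (simp add: s)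
    qed
    then show ?thesis using L(1,3) D cD by blast
  next
    case none
    have FI: "\<forall>i<p. F i \<in> Irr G" using none F_Irr by blast
    have conj: "\<exists>k. (X ^^ k) (?l + (X ^^ i) ?m) = ?l + (X ^^ j) ?m" if ij: "i < p" "j < p" "F j = F i" for i j
    proof -
      obtain k where k: "\<nu> j = cj k (\<nu> i)"
        using Ind_eq_conjugate[OF linear_Irr[OF lin] _ linear_Irr[OF lin]] none ij unfolding F_def by metis
      have "(X ^^ k) (?l + (X ^^ i) ?m) = ?l + (X ^^ j) ?m"
        using lift_cj[OF lin, of k i] unfolding k[symmetric] lift_nu by (rule sym)
      then show ?thesis by blast
    qed
    have two: "(\<forall>i<p. F i = F 0) \<or> (\<forall>i<p. card {j. j < p \<and> F j = F i} \<le> 2)"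
    proof (rule disjCI)
      assume "\<not> (\<forall>i<p. card {j. j < p \<and> F j = F i} \<le> 2)"
      then obtain i where i: "i < p" "card {j. j < p \<and> F j = F i} > 2" by (auto simp: not_le)
      \<comment> \<open>A fibre with more than two elements yields two further indices
        \<open>b\<close> and \<open>c\<close> besides \<open>i\<close>, hence three conjugate
        vectors.\<close>
      have "card ({j. j < p \<and> F j = F i} - {i}) = card {j. j < p \<and> F j = F i} - 1"
        using i by (intro card_Diff_singleton) simp
      then have "2 \<le> card ({j. j < p \<and> F j = F i} - {i})" using i by simp
      then obtain S where "S \<subseteq> {j. j < p \<and> F j = F i} - {i}" "card S = 2"
        by (rule obtain_subset_with_card_n)
      then obtain b c where bc: "b < p" "c < p" "F b = F i" "F c = F i" "b \<noteq> i" "c \<noteq> i" "b \<noteq> c"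
        by (auto simp: card_2_iff)
      obtain k1 where k1: "(X ^^ k1) (?l + (X ^^ i) ?m) = ?l + (X ^^ b) ?m" using conj[OF i(1) bc(1,3)] by blast
      obtain k2 where k2: "(X ^^ k2) (?l + (X ^^ i) ?m) = ?l + (X ^^ c) ?m" using conj[OF i(1) bc(2,4)] by blast
      have nf: "X (?l + (X ^^ i) ?m) \<noteq> ?l + (X ^^ i) ?m" using none i(1) unfolding fixed by blast
      have "F n = F i" for n
      proof -
        obtain k where "(X ^^ k) (?l + (X ^^ i) ?m) = ?l + (X ^^ n) ?m"
          using A.all_conjugate_if_three_conjugate[OF ld md i(1) bc(1,2) bc(5,6)[symmetric] bc(7) nf k1 k2] by blast
        then have "lift (cj k (\<nu> i)) = lift (\<nu> n)" by (simp add: lift_cj[OF lin] lift_nu)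
        then have "cj k (\<nu> i) = \<nu> n" using lift_inj[OF linear_cj[OF lin] lin] by blast
        then show ?thesis using Ind_cj[OF linear_class_function[OF lin], of k i] by (simp add: F_def)
      qed
      then show "\<forall>i<p. F i = F 0" by metis
    qed
    have F1: "\<forall>i<p. F i \<one> = of_nat p" using F_one by blast
    show ?thesis by (rule disjI2, rule disjI2, rule exI[of _ F]) (intro conjI FI F1 phi two)
  qed
qed

end

theorem theoremA:
  fixes G :: "('a, 'b) monoid_scheme" and p q :: nat and \<chi> \<psi> :: "'a \<Rightarrow> complex"
  assumes "prime p"
    and "finite (carrier G)" and "nilpotent_group G"
    and "\<chi> \<in> Irr G" and "\<psi> \<in> Irr G"
    and "\<chi> \<one>\<^bsub>G\<^esub> = of_nat p"
    and "prime q" and "\<psi> \<one>\<^bsub>G\<^esub> = of_nat q"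
  shows
    "(\<exists>L \<subseteq> linear_characters G. card L = p^2 \<and> char_prod G \<chi> \<psi> = char_sum G L)
   \<or> (\<exists>L \<subseteq> linear_characters G. \<exists>D \<subseteq> {\<theta> \<in> Irr G. \<theta> \<one>\<^bsub>G\<^esub> = of_nat p}.
        card L = p \<and> card D = p - 1 \<and> char_prod G \<chi> \<psi> = char_sum G (L \<union> D))
   \<or> ((\<forall>\<theta> \<in> irr_constituents G (char_prod G \<chi> \<psi>). \<theta> \<one>\<^bsub>G\<^esub> = of_nat p)
      \<and> (multiple_of_irreducible G (char_prod G \<chi> \<psi>)
          \<or> (real p + 1) / 2 \<le> real (eta G (char_prod G \<chi> \<psi>)) \<and> eta G (char_prod G \<chi> \<psi>) \<le> p)
      \<and> (eta G (char_prod G \<chi> \<psi>) = 1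
          \<or> (real p + 1) / 2 \<le> real (eta G (char_prod G \<chi> \<psi>)) \<and> eta G (char_prod G \<chi> \<psi>) \<le> p))
   \<or> char_prod G \<chi> \<psi> \<in> Irr G"
proof -
  have G: "group G" using assms(3) by (simp add: nilpotent_group_def)
  have fg: "finite_grp G" by (intro finite_grp.intro finite_grp_axioms.intro G assms(2))
  then interpret finite_grp G .
  obtain \<kappa> where \<kappa>: "\<And>g h. g \<in> carrier G \<Longrightarrow> h \<in> carrier G \<Longrightarrow> \<kappa> (g \<otimes>\<^bsub>G\<^esub> h) = \<kappa> g * \<kappa> h"
    "\<And>g. g \<in> carrier G \<Longrightarrow> \<kappa> g ^ p = 1" "\<exists>x\<in>carrier G. \<kappa> x \<noteq> 1"
    "\<And>g. g \<in> carrier G \<Longrightarrow> \<kappa> g * \<chi> g = \<chi> g"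
    using scalar_commutator_character[OF assms(3,4,6) prime_gt_1_nat[OF assms(1)]] by metis
  obtain x where x: "x \<in> carrier G" "\<kappa> x \<noteq> 1" using \<kappa>(3) by blast
  interpret nilpotent_kernel G p \<kappa> x
    by (intro nilpotent_kernel.intro prime_kernel.intro prime_kernel_axioms.intro
        nilpotent_kernel_axioms.intro fg assms(1,3) \<kappa>(1,2) x)
  \<comment> \<open>An induced character has degree \<open>p * d\<close>; if that is prime,
    \<open>d = 1\<close> and the inducing character is linear.\<close>
  have induced: "\<exists>\<mu>. linear \<mu> \<and> cj 1 \<mu> \<noteq> \<mu> \<and> \<theta> = Ind \<mu> \<and> r = p"
    if t: "\<theta> \<in> Irr G" and s: "\<And>g. g \<in> carrier G \<Longrightarrow> \<kappa> g * \<theta> g = \<theta> g"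
      and r: "\<theta> \<one>\<^bsub>G\<^esub> = of_nat r" "prime r" for \<theta> r
  proof -
    obtain \<mu> where m: "\<mu> \<in> Irr K" "cj 1 \<mu> \<noteq> \<mu>" "\<theta> = Ind \<mu>" using stable_induced[OF t s] by metis
    obtain d where "\<mu> \<one>\<^bsub>K\<^esub> = of_nat d"
      using characters_degree[OF K.is_group Irr_characters[OF m(1)]] by metis
    then have d: "\<mu> \<one>\<^bsub>G\<^esub> = of_nat d" by simp
    have "of_nat r = (of_nat (p * d) :: complex)" using r(1) d by (simp add: m(3) Ind_one)
    then have rd: "r = p * d" by (simp only: of_nat_eq_iff)
    then have "p = r" using p r(2) by (metis dvd_triv_left primes_dvd_imp_eq)
    then have "d = 1" using rd p by (metis mult_cancel1 mult.right_neutral prime_gt_0_nat less_numeral_extra(3))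
    then show ?thesis using m d \<open>p = r\<close> Irr_characters by (auto simp: linear_def)
  qed
  obtain \<mu> where m: "linear \<mu>" "cj 1 \<mu> \<noteq> \<mu>" "\<chi> = Ind \<mu>" using induced[OF assms(4) \<kappa>(4) assms(6,1)] by blast
  have case_iii: ?thesis
    if f: "\<forall>i<p. f i \<in> Irr G" "\<forall>i<p. f i \<one>\<^bsub>G\<^esub> = of_nat p" "char_prod G \<chi> \<psi> = (\<lambda>g\<in>carrier G. \<Sum>i<p. f i g)"
      "(\<forall>i<p. f i = f 0) \<or> (\<forall>i<p. card {j. j < p \<and> f j = f i} \<le> 2)" for f
    using sum_of_degree_p_constituents[OF p _ _ f(3,4)] f(1,2) by blast
  show ?thesis
  proof (cases "\<forall>g\<in>carrier G. \<kappa> g * \<psi> g = \<psi> g")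
    case True
    then obtain \<mu>' where m': "linear \<mu>'" "cj 1 \<mu>' \<noteq> \<mu>'" "\<psi> = Ind \<mu>'" using induced[OF assms(5) _ assms(8,7)] by blast
    from product_of_induced_linear[OF m(1,2) m'(1,2), folded m(3) m'(3)] show ?thesis
    proof (elim disjE)
      assume "\<exists>f. (\<forall>i<p. f i \<in> Irr G) \<and> (\<forall>i<p. f i \<one>\<^bsub>G\<^esub> = of_nat p) \<and>
        char_prod G \<chi> \<psi> = (\<lambda>g\<in>carrier G. \<Sum>i<p. f i g) \<and>
        ((\<forall>i<p. f i = f 0) \<or> (\<forall>i<p. card {j. j < p \<and> f j = f i} \<le> 2))"
      then show ?thesis by (elim exE conjE) (rule case_iii)
    qed (rule disjI1, assumption, rule disjI2, rule disjI1, assumption)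
  next
    case False
    have res: "restrict \<psi> H \<in> Irr K" by (rule restriction_Irr[OF assms(5) False])
    show ?thesis
    proof (cases "char_prod G \<chi> \<psi> \<in> Irr G")
      case False
      obtain E where E: "E \<subseteq> Irr G" "card E = p" "\<forall>\<theta>\<in>E. \<theta> \<one>\<^bsub>G\<^esub> = of_nat p"
        "char_prod G \<chi> \<psi> = (\<lambda>g\<in>carrier G. \<Sum>\<theta>\<in>E. \<theta> g)"
        using product_if_restriction_irreducible[OF m(1,2) assms(5) res assms(8,7), folded m(3), OF False] by blast
      \<comment> \<open>Enumerating \<open>E\<close> without repetition makes every fibre a
        singleton, so the count for the third alternative applies.\<close>
      have "finite E" using E(2) p_pos by (auto intro: card_ge_0_finite)
      then obtain f where f: "bij_betw f {..<p} E"
        using ex_bij_betw_nat_finite[of E] E(2) by (auto simp: lessThan_atLeast0)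
      have s: "(\<Sum>\<theta>\<in>E. \<theta> g) = (\<Sum>i<p. f i g)" for g
        by (rule sum.reindex_bij_betw[OF f, symmetric])
      have fE: "f i \<in> E" if "i < p" for i using f that by (auto simp: bij_betw_def)
      have "{j. j < p \<and> f j = f i} = {i}" if "i < p" for i
        using f that by (auto simp: bij_betw_def inj_on_def)
      then have "\<forall>i<p. card {j. j < p \<and> f j = f i} \<le> 2" by simp
      moreover have "\<forall>i<p. f i \<in> Irr G" "\<forall>i<p. f i \<one>\<^bsub>G\<^esub> = of_nat p" using fE E(1,3) by blast+
      ultimately show ?thesis using case_iii[OF _ _ E(4)[unfolded s]] by blast
    qed simp
  qed
qed

end
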